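(* Let $E$ be an arbitrary directed graph, $K$ a field, $L=L_K(E)$ the Leavitt path algebra, and $I$ a proper ideal of $L$ with graded part $gr(I)=I(H,S)$. The following are equivalent: (1) $I$ is an intersection of finitely many (strongly) irreducible ideals of $L$; (2) $gr(I)=P_1\cap\cdots\cap P_m$ is an irredundant intersection of finitely many graded prime ideals $P_1,\dots,P_m$ of $L$; (3) $gr(I)=I(H,S)=P_1\cap\cdots\cap P_m$ is an irredundant intersection of finitely many graded prime ideals, and $I=I(H,S)+\sum_{t=1}^{k}\langle f_t(c_t)\rangle$, where $k\le m$ and, for each $t=1,\dots,k$, $c_t$ is a cycle without exits in $E\backslash(H,S)$ based at a vertex $v_t\notin P_t$ and $f_t(x)\in K[x]$ has non-zero constant term; (4) $I$ is a product of (finitely many) strongly irreducible ideals of $L$. (In (3), $k=0$ is allowed, which is the case when $I$ is graded.)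
   Context: A directed graph $E=(E^0,E^1,r,s)$ consists of sets $E^0$ (vertices), $E^1$ (edges) and maps $r,s:E^1\to E^0$; no finiteness or countability is assumed. A vertex is regular if it emits a nonempty finite set of edges, and an infinite emitter if it emits infinitely many. $L_K(E)$ is the (not necessarily unital) $K$-algebra generated by pairwise orthogonal idempotents $v\in E^0$ and elements $e,e^*$ ($e\in E^1$) subject to: $s(e)e=e=er(e)$; $r(e)e^*=e^*=e^*s(e)$; $e^*e=r(e)$ and $e^*f=0$ for edges $e\neq f$; $v=\sum_{s(e)=v}ee^*$ for every regular vertex $v$. It is $\mathbb Z$-graded by $\deg v=0$, $\deg e=1$, $\deg e^*=-1$. "Ideal" means two-sided ideal; $\langle X\rangle$ is the ideal generated by $X$; prime ideals are proper; a graded prime ideal is a graded ideal that is prime. Write $u\ge v$ if there is a path (possibly of length $0$) from $u$ to $v$. $H\subseteq E^0$ is hereditary if $v\in H$, $v\ge w$ imply $w\in H$; it is saturated if a regular vertex $v$ with $r(s^{-1}(v))\subseteq H$ lies in $H$. For $H$ hereditary saturated, $B_H$ is the set of infinite emitters $w\in E^0\backslash H$ with $0<|s^{-1}(w)\cap r^{-1}(E^0\backslash H)|<\infty$, and for $v\in B_H$, $v^H=v-\sum_{s(e)=v,\,r(e)\notin H}ee^*$. An admissible pair is $(H,S)$ with $H$ hereditary saturated and $S\subseteq B_H$; $I(H,S)$ is the ideal generated by $H\cup\{v^H:v\in S\}$ (these are exactly the graded ideals). For an ideal $I$, its graded part is $gr(I)=I(H,S)$ with $H=I\cap E^0$, $S=\{v\in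 B_H:v^H\in I\}$. The quotient graph $E\backslash(H,S)$ has vertices $(E^0\backslash H)\cup\{v':v\in B_H\backslash S\}$ and edges $\{e\in E^1:r(e)\notin H\}\cup\{e':e\in E^1,\ r(e)\in B_H\backslash S\}$, with $s(e')=s(e)$, $r(e')=r(e)'$. A cycle is a closed path $c=e_1\cdots e_n$ ($n\ge1$) with $s(e_i)\ne s(e_j)$ for $i\neq j$, based at $s(e_1)$; an exit for it is an edge $e$ with $s(e)=s(e_i)$, $e\ne e_i$ for some $i$. If $c$ is a cycle based at $v$ and $f(x)=k_0+k_1x+\cdots+k_nx^n$, then $f(c)=k_0v+k_1c+\cdots+k_nc^n$; cycles of $E\backslash(H,S)$ are viewed as cycles of $E$. An ideal $I$ is irreducible if $A\cap B=I$ implies $A=I$ or $B=I$ (for ideals $A,B$), and strongly irreducible if $A\cap B\subseteq I$ implies $A\subseteq I$ or $B\subseteq I$. In (1), "(strongly)" means that either notion may be used. An intersection $\bigcap_{i}A_i$ is irredundant if $\bigcap_{i\neq j}A_i\nsubseteq A_j$ for every $j$. *)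

theory Defs
  imports
    "HOL-Algebra.QuotRing"
    "HOL-Algebra.Ideal_Product"
    "HOL-Algebra.Module"
    "HOL-Library.Poly_Mapping"
    "HOL-Computational_Algebra.Polynomial"
    "Graph_Theory.Digraph"
    "Graph_Theory.Arc_Walk"
begin

section \<open>Ideals of rings that need not have a unit\<close>

text \<open>
  Leavitt path algebras need not be unital, whereas the locale \<^locale>\<open>ideal\<close> presupposes a
  unital ring. The notions below are phrased for the ring records of HOL-Algebra, but never use
  the field \<open>one\<close>.
\<close>

definition two_sided_ideal :: "('a, 'm) ring_scheme \<Rightarrow> 'a set \<Rightarrow> bool" where
  "two_sided_ideal R I \<longleftrightarrow>
     additive_subgroup I R \<and>
     (\<forall>a\<in>I. \<forall>x\<in>carrier R. x \<otimes>\<^bsub>R\<^esub> a \<in> I \<and> a \<otimes>\<^bsub>R\<^esub> x \<in> I)"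

definition ideal_gen :: "('a, 'm) ring_scheme \<Rightarrow> 'a set \<Rightarrow> 'a set" where
  "ideal_gen R X = \<Inter>{I. two_sided_ideal R I \<and> X \<subseteq> I}"

definition ideal_sum :: "('a, 'm) ring_scheme \<Rightarrow> 'i set \<Rightarrow> ('i \<Rightarrow> 'a set) \<Rightarrow> 'a set" where
  "ideal_sum R T J = {(\<Oplus>\<^bsub>R\<^esub>t\<in>T. b t) |b. \<forall>t\<in>T. b t \<in> J t}"

definition prime_ideal :: "('a, 'm) ring_scheme \<Rightarrow> 'a set \<Rightarrow> bool" where
  "prime_ideal R P \<longleftrightarrow>
     two_sided_ideal R P \<and> P \<noteq> carrier R \<and>
     (\<forall>A B. two_sided_ideal R A \<longrightarrow> two_sided_ideal R B \<longrightarrow>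
        ideal_prod R A B \<subseteq> P \<longrightarrow> A \<subseteq> P \<or> B \<subseteq> P)"

definition irreducible_ideal :: "('a, 'm) ring_scheme \<Rightarrow> 'a set \<Rightarrow> bool" where
  "irreducible_ideal R I \<longleftrightarrow>
     two_sided_ideal R I \<and>
     (\<forall>A B. two_sided_ideal R A \<longrightarrow> two_sided_ideal R B \<longrightarrow>
        A \<inter> B = I \<longrightarrow> A = I \<or> B = I)"

definition strongly_irreducible_ideal :: "('a, 'm) ring_scheme \<Rightarrow> 'a set \<Rightarrow> bool" where
  "strongly_irreducible_ideal R I \<longleftrightarrow>
     two_sided_ideal R I \<and>
     (\<forall>A B. two_sided_ideal R A \<longrightarrow> two_sided_ideal R B \<longrightarrow>
        A \<inter> B \<subseteq> I \<longrightarrow> A \<subseteq> I \<or> B \<subseteq> I)"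

text \<open>For \<open>m = 1\<close> the remaining (empty) intersection is the whole ring, not \<^term>\<open>UNIV\<close>.\<close>

definition irredundant_inter :: "('a, 'm) ring_scheme \<Rightarrow> nat \<Rightarrow> (nat \<Rightarrow> 'a set) \<Rightarrow> bool" where
  "irredundant_inter R m P \<longleftrightarrow>
     (\<forall>j\<in>{1..m}. \<not> (carrier R \<inter> (\<Inter>i\<in>{1..m} - {j}. P i) \<subseteq> P j))"


section \<open>Leavitt path algebras\<close>

definition regular_vertex :: "('v, 'e) pre_digraph \<Rightarrow> 'v \<Rightarrow> bool" where
  "regular_vertex E v \<longleftrightarrow> v \<in> verts E \<and> finite (out_arcs E v) \<and> out_arcs E v \<noteq> {}"

definition infinite_emitter :: "('v, 'e) pre_digraph \<Rightarrow> 'v \<Rightarrow> bool" where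
  "infinite_emitter E v \<longleftrightarrow> v \<in> verts E \<and> infinite (out_arcs E v)"

datatype ('v, 'e) gen = Vert 'v | Edge 'e | Ghost 'e

text \<open>
  Words form the free monoid, written additively because the convolution product on
  \<^typ>\<open>'w \<Rightarrow>\<^sub>0 'k\<close> expects an additive monoid of exponents.
\<close>

datatype 'g fmon = Word (letters: "'g list")

instantiation fmon :: (type) monoid_add
begin

definition zero_fmon :: "'a fmon" where "0 = Word []"

definition plus_fmon :: "'a fmon \<Rightarrow> 'a fmon \<Rightarrow> 'a fmon" where
  "u + w = Word (letters u @ letters w)"

instance by standard (simp_all add: zero_fmon_def plus_fmon_def)

end

type_synonym ('v, 'e, 'k) free_elem = "('v, 'e) gen fmon \<Rightarrow>\<^sub>0 'k"
type_synonym ('v, 'e, 'k) lpa_elem = "('v, 'e, 'k) free_elem set"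

definition scale :: "'k::field \<Rightarrow> ('v, 'e, 'k) free_elem \<Rightarrow> ('v, 'e, 'k) free_elem" where
  "scale k p = Poly_Mapping.map (\<lambda>a. k * a) p"

text \<open>
  The free non-unital algebra on the vertices, edges and ghost edges of \<open>E\<close>: only non-empty words
  occur, so it has no unit and the field \<open>one\<close> is irrelevant.
\<close>

definition free_alg :: "('v, 'e) pre_digraph \<Rightarrow> ('v, 'e, 'k::field) free_elem ring" where
  "free_alg E =
     \<lparr>carrier = {p. \<forall>w\<in>Poly_Mapping.keys p. letters w \<noteq> [] \<and>
                   set (letters w) \<subseteq> Vert ` verts E \<union> Edge ` arcs E \<union> Ghost ` arcs E},
      monoid.mult = (*), one = undefined, zero = 0, add = (+)\<rparr>"

definition gen_elem :: "('v, 'e) gen \<Rightarrow> ('v, 'e, 'k::field) free_elem" where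
  "gen_elem g = Poly_Mapping.single (Word [g]) 1"

text \<open>A relation \<open>x = y\<close> is encoded as the element \<open>x - y\<close>.\<close>

inductive_set lpa_rels :: "('v, 'e) pre_digraph \<Rightarrow> ('v, 'e, 'k::field) free_elem set"
  for E :: "('v, 'e) pre_digraph" where
  idem: "v \<in> verts E \<Longrightarrow> gen_elem (Vert v) * gen_elem (Vert v) - gen_elem (Vert v) \<in> lpa_rels E"
| orth: "v \<in> verts E \<Longrightarrow> w \<in> verts E \<Longrightarrow> v \<noteq> w \<Longrightarrow>
     gen_elem (Vert v) * gen_elem (Vert w) \<in> lpa_rels E"
| edge_source: "e \<in> arcs E \<Longrightarrow>
     gen_elem (Vert (tail E e)) * gen_elem (Edge e) - gen_elem (Edge e) \<in> lpa_rels E"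
| edge_range: "e \<in> arcs E \<Longrightarrow>
     gen_elem (Edge e) * gen_elem (Vert (head E e)) - gen_elem (Edge e) \<in> lpa_rels E"
| ghost_range: "e \<in> arcs E \<Longrightarrow>
     gen_elem (Vert (head E e)) * gen_elem (Ghost e) - gen_elem (Ghost e) \<in> lpa_rels E"
| ghost_source: "e \<in> arcs E \<Longrightarrow>
     gen_elem (Ghost e) * gen_elem (Vert (tail E e)) - gen_elem (Ghost e) \<in> lpa_rels E"
| CK1_same: "e \<in> arcs E \<Longrightarrow>
     gen_elem (Ghost e) * gen_elem (Edge e) - gen_elem (Vert (head E e)) \<in> lpa_rels E"
| CK1_distinct: "e \<in> arcs E \<Longrightarrow> f \<in> arcs E \<Longrightarrow> e \<noteq> f \<Longrightarrow>
     gen_elem (Ghost e) * gen_elem (Edge f) \<in> lpa_rels E"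
| CK2: "regular_vertex E v \<Longrightarrow>
     gen_elem (Vert v) - (\<Sum>e\<in>out_arcs E v. gen_elem (Edge e) * gen_elem (Ghost e)) \<in> lpa_rels E"

text \<open>
  Taking all scalar multiples of the relations makes the generated ring ideal an ideal of the
  \<open>K\<close>-algebra; without a unit this is not automatic.
\<close>

definition rel_ideal :: "('v, 'e) pre_digraph \<Rightarrow> ('v, 'e, 'k::field) free_elem set" where
  "rel_ideal E = ideal_gen (free_alg E) {scale k x |k x. x \<in> lpa_rels E}"

text \<open>
  The field \<open>one\<close> is again irrelevant. Ideals of \<open>lpa E\<close> are ring ideals; they are
  automatically \<open>K\<close>-subspaces because \<open>lpa E\<close> has local units.
\<close>

definition lpa :: "('v, 'e) pre_digraph \<Rightarrow> ('k::field, ('v, 'e, 'k) lpa_elem) module" where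
  "lpa E =
     (let Q = free_alg E Quot rel_ideal E in
      \<lparr>carrier = carrier Q, monoid.mult = monoid.mult Q, one = undefined, zero = zero Q, add = add Q,
       module.smult = (\<lambda>k A. \<Union>a\<in>A. rel_ideal E +>\<^bsub>free_alg E\<^esub> scale k a)\<rparr>)"

definition lpa_class :: "('v, 'e) pre_digraph \<Rightarrow> ('v, 'e, 'k::field) free_elem \<Rightarrow> ('v, 'e, 'k) lpa_elem"
  where "lpa_class E p = rel_ideal E +>\<^bsub>free_alg E\<^esub> p"

definition lpa_gen :: "('v, 'e) pre_digraph \<Rightarrow> ('v, 'e) gen \<Rightarrow> ('v, 'e, 'k::field) lpa_elem" where
  "lpa_gen E g = lpa_class E (gen_elem g)"

fun gen_deg :: "('v, 'e) gen \<Rightarrow> int" where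
  "gen_deg (Vert v) = 0"
| "gen_deg (Edge e) = 1"
| "gen_deg (Ghost e) = -1"

definition lpa_component :: "('v, 'e) pre_digraph \<Rightarrow> int \<Rightarrow> ('v, 'e, 'k::field) lpa_elem set" where
  "lpa_component E n =
     {lpa_class E p |p. p \<in> carrier (free_alg E) \<and>
        (\<forall>w\<in>Poly_Mapping.keys p. sum_list (map gen_deg (letters w)) = n)}"

definition graded_ideal :: "('v, 'e) pre_digraph \<Rightarrow> ('v, 'e, 'k::field) lpa_elem set \<Rightarrow> bool" where
  "graded_ideal E I \<longleftrightarrow>
     two_sided_ideal (lpa E) I \<and>
     (\<forall>a\<in>I. \<exists>N h. finite N \<and> (\<forall>n\<in>N. h n \<in> I \<inter> lpa_component E n) \<and>
        a = (\<Oplus>\<^bsub>lpa E\<^esub>n\<in>N. h n))"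

definition graded_prime_ideal :: "('v, 'e) pre_digraph \<Rightarrow> ('v, 'e, 'k::field) lpa_elem set \<Rightarrow> bool"
  where "graded_prime_ideal E P \<longleftrightarrow> graded_ideal E P \<and> prime_ideal (lpa E) P"


section \<open>Graded parts and quotient graphs\<close>

definition breaking_verts :: "('v, 'e) pre_digraph \<Rightarrow> 'v set \<Rightarrow> 'v set" where
  "breaking_verts E H =
     {w \<in> verts E - H. infinite_emitter E w \<and>
        finite {e \<in> out_arcs E w. head E e \<notin> H} \<and> {e \<in> out_arcs E w. head E e \<notin> H} \<noteq> {}}"

text \<open>The element \<open>v\<^sup>H\<close>.\<close>

definition breaking_elem :: "('v, 'e) pre_digraph \<Rightarrow> 'v set \<Rightarrow> 'v \<Rightarrow> ('v, 'e, 'k::field) lpa_elem" where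
  "breaking_elem E H v =
     lpa_gen E (Vert v) \<ominus>\<^bsub>lpa E\<^esub>
       (\<Oplus>\<^bsub>lpa E\<^esub>e\<in>{e \<in> out_arcs E v. head E e \<notin> H}.
          lpa_gen E (Edge e) \<otimes>\<^bsub>lpa E\<^esub> lpa_gen E (Ghost e))"

text \<open>The ideal \<open>I(H,S)\<close>.\<close>

definition pair_ideal :: "('v, 'e) pre_digraph \<Rightarrow> 'v set \<Rightarrow> 'v set \<Rightarrow> ('v, 'e, 'k::field) lpa_elem set"
  where "pair_ideal E H S =
     ideal_gen (lpa E) ((\<lambda>v. lpa_gen E (Vert v)) ` H \<union> breaking_elem E H ` S)"

definition gr_verts :: "('v, 'e) pre_digraph \<Rightarrow> ('v, 'e, 'k::field) lpa_elem set \<Rightarrow> 'v set" where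
  "gr_verts E I = {v \<in> verts E. lpa_gen E (Vert v) \<in> I}"

definition gr_breaking :: "('v, 'e) pre_digraph \<Rightarrow> ('v, 'e, 'k::field) lpa_elem set \<Rightarrow> 'v set" where
  "gr_breaking E I =
     {v \<in> breaking_verts E (gr_verts E I). breaking_elem E (gr_verts E I) v \<in> I}"

definition gr_part :: "('v, 'e) pre_digraph \<Rightarrow> ('v, 'e, 'k::field) lpa_elem set \<Rightarrow> ('v, 'e, 'k) lpa_elem set"
  where "gr_part E I = pair_ideal E (gr_verts E I) (gr_breaking E I)"

text \<open>
  The quotient graph: \<open>Inl\<close> marks the surviving vertices and edges of \<open>E\<close>, \<open>Inr\<close> the
  new copies \<open>v'\<close> and \<open>e'\<close>. Since the copies \<open>v'\<close> are sinks, cycles consist of \<open>Inl\<close>-edges only.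
\<close>

definition quotient_graph ::
    "('v, 'e) pre_digraph \<Rightarrow> 'v set \<Rightarrow> 'v set \<Rightarrow> ('v + 'v, 'e + 'e) pre_digraph" where
  "quotient_graph E H S =
     \<lparr>verts = Inl ` (verts E - H) \<union> Inr ` (breaking_verts E H - S),
      arcs = Inl ` {e \<in> arcs E. head E e \<notin> H} \<union>
             Inr ` {e \<in> arcs E. head E e \<in> breaking_verts E H - S},
      tail = (\<lambda>x. case x of Inl e \<Rightarrow> Inl (tail E e) | Inr e \<Rightarrow> Inl (tail E e)),
      head = (\<lambda>x. case x of Inl e \<Rightarrow> Inl (head E e) | Inr e \<Rightarrow> Inr (head E e))\<rparr>"

definition cycle_without_exits :: "('v, 'e) pre_digraph \<Rightarrow> 'e list \<Rightarrow> bool" where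
  "cycle_without_exits G c \<longleftrightarrow>
     pre_digraph.cycle G c \<and> \<not> (\<exists>d\<in>set c. \<exists>e\<in>arcs G. tail G e = tail G d \<and> e \<noteq> d)"

definition cycle_base :: "('v, 'e) pre_digraph \<Rightarrow> 'e list \<Rightarrow> 'v" where
  "cycle_base E c = tail E (hd c)"

definition cycle_elem :: "('v, 'e) pre_digraph \<Rightarrow> 'e list \<Rightarrow> ('v, 'e, 'k::field) lpa_elem" where
  "cycle_elem E c =
     foldl (\<lambda>x e. x \<otimes>\<^bsub>lpa E\<^esub> lpa_gen E (Edge e)) (lpa_gen E (Edge (hd c))) (tl c)"

text \<open>The powers of a cycle \<open>c\<close> based at \<open>v\<close>, with \<open>c\<^sup>0 = v\<close>.\<close>

definition cycle_power :: "('v, 'e) pre_digraph \<Rightarrow> 'e list \<Rightarrow> nat \<Rightarrow> ('v, 'e, 'k::field) lpa_elem" where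
  "cycle_power E c n =
     ((\<lambda>x. x \<otimes>\<^bsub>lpa E\<^esub> cycle_elem E c) ^^ n) (lpa_gen E (Vert (cycle_base E c)))"

definition poly_at_cycle ::
    "('v, 'e) pre_digraph \<Rightarrow> 'k::field poly \<Rightarrow> 'e list \<Rightarrow> ('v, 'e, 'k) lpa_elem" where
  "poly_at_cycle E f c =
     (\<Oplus>\<^bsub>lpa E\<^esub>i\<in>{..degree f}. poly.coeff f i \<odot>\<^bsub>lpa E\<^esub> cycle_power E c i)"

definition graded_prime_decomposition ::
    "('v, 'e) pre_digraph \<Rightarrow> ('v, 'e, 'k::field) lpa_elem set \<Rightarrow> nat \<Rightarrow>
     (nat \<Rightarrow> ('v, 'e, 'k) lpa_elem set) \<Rightarrow> bool" where
  "graded_prime_decomposition E J m P \<longleftrightarrow>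
     1 \<le> m \<and> (\<forall>i\<in>{1..m}. graded_prime_ideal E (P i)) \<and>
     J = (\<Inter>i\<in>{1..m}. P i) \<and> irredundant_inter (lpa E) m P"

end

theory Submission
  imports Defs "HOL-Library.Sublist" "HOL-Computational_Algebra.Polynomial_Factorial"
begin

text \<open>
  Modulo its graded part \<open>I(H,S)\<close>, an ideal is generated by polynomials \<open>f(c)\<close> with non-zero constant
  term in cycles \<open>c\<close> without exits, and the corner at the base of such a cycle is \<open>K[x,x\<inverse>]\<close>. The
  graded part of an irreducible ideal \<open>I\<close> is prime: if \<open>A\<close> and \<open>B\<close> are graded with \<open>A \<inter> B \<subseteq> I\<close>, then
  the local units of graded ideals make the ideal lattice distributive enough that
  \<open>(I + A) \<inter> (I + B) = I\<close>, so \<open>A \<subseteq> I\<close> or \<open>B \<subseteq> I\<close>; for other ideals a non-zero polynomial in a cycle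
  replaces a graded generator, and \<open>K[x,x\<inverse>]\<close> is a domain. So (1) implies (2), graded parts being
  compatible with finite intersections, and likewise for products.

  Conversely, let \<open>gr(I)\<close> be the irredundant intersection of graded primes \<open>P\<^sub>1, \<dots>, P\<^sub>m\<close>. Each cycle
  occurring in \<open>I\<close> is avoided by exactly one \<open>P\<^sub>j\<close>, and cycles that differ by more than a rotation are
  avoided by distinct ones, whence \<open>k \<le> m\<close>. If a graded prime \<open>P\<close> avoids the cycle \<open>c\<close>, an ideal
  containing \<open>P\<close> either contains the base of \<open>c\<close> or is \<open>P + \<langle>f(c)\<rangle>\<close>, so that the ideals
  \<open>P + \<langle>p\<^sup>n(c)\<rangle>\<close> with \<open>p\<close> irreducible are strongly irreducible. Factoring the polynomials into prime
  powers writes \<open>I\<close> both as an intersection and as a product of such ideals and of graded primes.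
\<close>

section \<open>Additive spans and ideals of type-class rings\<close>

text \<open>The algebra takes place in a type-class ring in which the Leavitt path algebra is an
  ideal \<open>C\<close>; a bijection \<theta> carries the result to the coset record at the end.
  Local units replace the missing unit: a graded ideal is generated by idempotents of the
  commutative diagonal spanned by the p p*, and conjugates and joins of these stay diagonal. If u in
  P is a left unit of the P-part of x = b + p, then x = (x - u x) + u x splits x inside any ideal
  containing it; this is all the distributivity that is used.

  Ideals are analysed by descent: edges multiplied on the right shorten ghost paths, ghost edges
  multiplied on the left shorten real paths, until a closed element with non-zero constant term
  remains, and compressing it by long paths exhibits a cycle without exits. Modulo the graded ideal
  such a cycle c is invertible, so every corner element becomes a polynomial in c after
  multiplication by a power of c; cancelling that power afterwards replaces an explicit isomorphism
  with the Laurent ring. Non-zero constant terms make divisibility in K[x] agree with that in the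
  Laurent ring.\<close>

inductive_set aspan :: "'a::ab_group_add set \<Rightarrow> 'a set" for B where
  aspan_zero: "0 \<in> aspan B"
| aspan_add: "b \<in> B \<Longrightarrow> x \<in> aspan B \<Longrightarrow> b + x \<in> aspan B"

lemma aspan_base: "b \<in> B \<Longrightarrow> b \<in> aspan B"
  using aspan_add[OF _ aspan_zero] by fastforce

lemma aspan_plus: "x \<in> aspan B \<Longrightarrow> y \<in> aspan B \<Longrightarrow> x + y \<in> aspan B"
  by (induction rule: aspan.induct) (auto simp: add.assoc intro: aspan.intros)

lemma aspan_sum: "(\<And>i. i \<in> F \<Longrightarrow> f i \<in> aspan B) \<Longrightarrow> sum f F \<in> aspan B"
  by (induction F rule: infinite_finite_induct) (auto intro: aspan_zero aspan_plus)

lemma aspan_image: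
  assumes "x \<in> aspan B" "f 0 = 0" "\<And>x y. f (x + y) = f x + f y" "\<And>b. b \<in> B \<Longrightarrow> f b \<in> aspan B'"
  shows "f x \<in> aspan B'"
  using assms(1) by induction (auto simp: assms(2-4) intro: aspan_zero aspan_plus)

lemma aspan_least:
  assumes "x \<in> aspan B" "B \<subseteq> J" "0 \<in> J" "\<And>x y. x \<in> J \<Longrightarrow> y \<in> J \<Longrightarrow> x + y \<in> J"
  shows "x \<in> J"
  using assms(1) by induction (use assms in auto)

lemma aspan_mult:
  fixes x y :: "'a::ring"
  assumes "x \<in> aspan A" "y \<in> aspan B" "\<And>a b. a \<in> A \<Longrightarrow> b \<in> B \<Longrightarrow> a * b \<in> aspan D"
  shows "x * y \<in> aspan D"
proof (rule aspan_image[OF assms(1), where f = "\<lambda>x. x * y"])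
  fix a assume "a \<in> A"
  then show "a * y \<in> aspan D"
    by (intro aspan_image[OF assms(2), where f = "\<lambda>y. a * y"]) (auto simp: algebra_simps assms(3))
qed (auto simp: algebra_simps)

text \<open>Words start from a letter because there is no empty product.\<close>

inductive_set gen_words :: "'a::times set \<Rightarrow> 'a set" for B where
  gen_words_base: "b \<in> B \<Longrightarrow> b \<in> gen_words B"
| gen_words_step: "w \<in> gen_words B \<Longrightarrow> b \<in> B \<Longrightarrow> w * b \<in> gen_words B"

text \<open>Closure is required under multiplication by the whole type, so these are ideals of the
  ambient ring that lie inside \<open>C\<close>. When \<open>C\<close> has local units they are
  exactly the ideals of \<open>C\<close>, since y x = (y u) x.\<close>

definition idl :: "'a::ring set \<Rightarrow> 'a set \<Rightarrow> bool" where
  "idl C J \<longleftrightarrow> J \<subseteq> C \<and> 0 \<in> J \<and> (\<forall>x\<in>J. \<forall>y\<in>J. x + y \<in> J) \<and> (\<forall>x\<in>J. - x \<in> J) \<and>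
     (\<forall>x\<in>J. \<forall>y. y * x \<in> J \<and> x * y \<in> J)"

definition gen :: "'a::ring set \<Rightarrow> 'a set \<Rightarrow> 'a set" where
  "gen C B = \<Inter>{J. idl C J \<and> B \<subseteq> J}"

definition locally_unital :: "'a::ring set \<Rightarrow> bool" where
  "locally_unital J \<longleftrightarrow> (\<forall>x\<in>J. \<exists>u\<in>J. u * x = x \<and> x * u = x)"

definition isum :: "'a::ring set \<Rightarrow> 'a set \<Rightarrow> 'a set" where
  "isum A B = {a + b |a b. a \<in> A \<and> b \<in> B}"

definition iprod :: "'a::ring set \<Rightarrow> 'a set \<Rightarrow> 'a set" where
  "iprod A B = aspan {a * b |a b. a \<in> A \<and> b \<in> B}"

lemma idlD:
  assumes "idl C J"
  shows idl_sub: "J \<subseteq> C" and idl_zero: "0 \<in> J"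
    and idl_add: "x \<in> J \<Longrightarrow> y \<in> J \<Longrightarrow> x + y \<in> J"
    and idl_neg: "x \<in> J \<Longrightarrow> - x \<in> J"
    and idl_lmult: "x \<in> J \<Longrightarrow> z * x \<in> J"
    and idl_rmult: "x \<in> J \<Longrightarrow> x * z \<in> J"
    and idl_diff: "x \<in> J \<Longrightarrow> y \<in> J \<Longrightarrow> x - y \<in> J"
proof -
  show "x \<in> J \<Longrightarrow> y \<in> J \<Longrightarrow> x - y \<in> J"
    using assms unfolding idl_def diff_conv_add_uminus by blast
qed (use assms in \<open>auto simp: idl_def\<close>)

lemma idl_sum: "idl C J \<Longrightarrow> (\<And>i. i \<in> F \<Longrightarrow> f i \<in> J) \<Longrightarrow> sum f F \<in> J"
  by (induction F rule: infinite_finite_induct) (auto intro: idl_zero idl_add)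

lemma idl_aspan: "idl C J \<Longrightarrow> B \<subseteq> J \<Longrightarrow> aspan B \<subseteq> J"
  by (intro subsetI, erule aspan_least) (auto intro: idl_zero idl_add)

lemma idl_add_iff: "idl C J \<Longrightarrow> y \<in> J \<Longrightarrow> x + y \<in> J \<longleftrightarrow> x \<in> J"
  using idl_add[of C J x y] idl_diff[of C J "x + y" y] by auto

lemma idl_diff_mem: "idl C J \<Longrightarrow> x - y \<in> J \<Longrightarrow> x \<in> J \<longleftrightarrow> y \<in> J"
  using idl_add[of C J "x - y" y] idl_diff[of C J x "x - y"] by auto

lemma idl_diff_trans: "idl C J \<Longrightarrow> x - y \<in> J \<Longrightarrow> y - z \<in> J \<Longrightarrow> x - z \<in> J"
  using idl_add[of C J "x - y" "y - z"] by simp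

lemma idl_Inter: "F \<noteq> {} \<Longrightarrow> (\<And>A. A \<in> F \<Longrightarrow> idl C A) \<Longrightarrow> idl C (\<Inter>F)"
  unfolding idl_def by blast

lemma idl_Int: "idl C A \<Longrightarrow> idl C B \<Longrightarrow> idl C (A \<inter> B)"
  unfolding idl_def by blast

lemma gen_least: "idl C J \<Longrightarrow> B \<subseteq> J \<Longrightarrow> gen C B \<subseteq> J"
  unfolding gen_def by blast

lemma gen_superset: "B \<subseteq> gen C B"
  unfolding gen_def by blast

lemma idl_isum:
  assumes "idl C A" "idl C B" "idl C C"
  shows "idl C (isum A B)"
  unfolding idl_def
proof (intro conjI ballI allI)
  show "0 \<in> isum A B"
    unfolding isum_def using idl_zero[OF assms(1)] idl_zero[OF assms(2)] by (fastforce intro: exI[of _ 0])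
  fix x assume "x \<in> isum A B"
  then obtain a b where x: "x = a + b" "a \<in> A" "b \<in> B" unfolding isum_def by blast
  have "- x = - a + - b" using x by simp
  then show "- x \<in> isum A B" unfolding isum_def using x assms idl_neg by blast
  { fix y
    have "y * x = y * a + y * b" "x * y = a * y + b * y" using x by (auto simp: algebra_simps)
    then show "y * x \<in> isum A B" "x * y \<in> isum A B"
      unfolding isum_def using x assms idl_lmult idl_rmult by blast+ }
  fix y assume "y \<in> isum A B"
  then obtain a' b' where y: "y = a' + b'" "a' \<in> A" "b' \<in> B" unfolding isum_def by blast
  have "x + y = (a + a') + (b + b')" using x y by (simp add: algebra_simps)
  then show "x + y \<in> isum A B" unfolding isum_def using x y assms idl_add by blast
next
  show "isum A B \<subseteq> C" unfolding isum_def using idl_sub[OF assms(1)] idl_sub[OF assms(2)] idl_add[OF assms(3)] by blast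
qed

section \<open>Leavitt path algebras in a type-class ring\<close>

text \<open>The data are the defining relations, a scalar action \<open>sc\<close>, the projections
  \<open>hc n\<close> onto the components of degree n, and the fact that words span
  \<open>C\<close>. Everything lives in a ring that may be larger than \<open>C\<close>;
  \<open>hc_mult_left\<close> and \<open>hc_mult_right\<close> say that a homogeneous factor only
  shifts degrees.\<close>

locale leavitt = wf_digraph E for E :: "('v, 'e) pre_digraph" +
  fixes V :: "'v \<Rightarrow> 'a::ring" and X Y :: "'e \<Rightarrow> 'a"
    and sc :: "'k::field \<Rightarrow> 'a \<Rightarrow> 'a" and hc :: "int \<Rightarrow> 'a \<Rightarrow> 'a" and C :: "'a set"
  assumes V_idem: "v \<in> verts E \<Longrightarrow> V v * V v = V v"
    and V_orth: "v \<in> verts E \<Longrightarrow> w \<in> verts E \<Longrightarrow> v \<noteq> w \<Longrightarrow> V v * V w = 0"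
    and VX: "e \<in> arcs E \<Longrightarrow> V (tail E e) * X e = X e"
    and XV: "e \<in> arcs E \<Longrightarrow> X e * V (head E e) = X e"
    and VY: "e \<in> arcs E \<Longrightarrow> V (head E e) * Y e = Y e"
    and YV: "e \<in> arcs E \<Longrightarrow> Y e * V (tail E e) = Y e"
    and YX: "e \<in> arcs E \<Longrightarrow> Y e * X e = V (head E e)"
    and YX_orth: "e \<in> arcs E \<Longrightarrow> f \<in> arcs E \<Longrightarrow> e \<noteq> f \<Longrightarrow> Y e * X f = 0"
    and CK2: "regular_vertex E v \<Longrightarrow> V v = (\<Sum>e\<in>out_arcs E v. X e * Y e)"
    and sc_add: "sc k (x + y) = sc k x + sc k y"
    and sc_add_left: "sc (k + l) x = sc k x + sc l x"
    and sc_sc: "sc k (sc l x) = sc (k * l) x"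
    and sc_one: "sc 1 x = x"
    and sc_mult_left: "sc k x * y = sc k (x * y)"
    and sc_mult_right: "x * sc k y = sc k (x * y)"
    and hc_add: "hc n (x + y) = hc n x + hc n y"
    and hc_sc: "hc n (sc k x) = sc k (hc n x)"
    and hc_V: "v \<in> verts E \<Longrightarrow> hc 0 (V v) = V v"
    and hc_X: "e \<in> arcs E \<Longrightarrow> hc 1 (X e) = X e"
    and hc_Y: "e \<in> arcs E \<Longrightarrow> hc (-1) (Y e) = Y e"
    and hc_hc: "hc n (hc d x) = (if n = d then hc d x else 0)"
    and hc_mult_left: "hc d x = x \<Longrightarrow> hc n (x * y) = x * hc (n - d) y"
    and hc_mult_right: "hc d y = y \<Longrightarrow> hc n (x * y) = hc (n - d) x * y"
    and idl_C: "idl C C"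
    and V_C: "v \<in> verts E \<Longrightarrow> V v \<in> C"
    and C_words: "C \<subseteq> aspan {sc k w |k w. w \<in> gen_words (V ` verts E \<union> X ` arcs E \<union> Y ` arcs E)}"
begin

lemma sc_zero [simp]: "sc k 0 = 0" "sc 0 x = 0"
  using sc_add[of k 0 0] sc_add_left[of 0 0 x] by auto

lemma sc_minus: "sc k (- x) = - sc k x" "sc (- k) x = - sc k x"
  using sc_add[of k x "- x"] sc_add_left[of k "- k" x] by (simp_all add: add_eq_0_iff)

lemma sc_inverse: "k \<noteq> 0 \<Longrightarrow> sc (inverse k) (sc k x) = x"
  by (simp add: sc_sc sc_one)

lemma hc_zero [simp]: "hc n 0 = 0"
  using hc_add[of n 0 0] by auto

lemma hc_sum: "hc n (sum f F) = (\<Sum>i\<in>F. hc n (f i))"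
  by (induction F rule: infinite_finite_induct) (auto simp: hc_add)

lemma hc_homogeneous: "hc d x = x \<Longrightarrow> hc n x = (if n = d then x else 0)"
  by (metis hc_hc)

lemma homogeneous_mult: "hc c x = x \<Longrightarrow> hc d y = y \<Longrightarrow> hc (c + d) (x * y) = x * y"
  using hc_mult_left[of c x "c + d" y] by simp

lemma X_in_C: "e \<in> arcs E \<Longrightarrow> X e \<in> C"
  by (metis VX V_C idl_C idl_rmult tail_in_verts)

lemma Y_in_C: "e \<in> arcs E \<Longrightarrow> Y e \<in> C"
  by (metis VY V_C idl_C idl_rmult head_in_verts)

subsection \<open>Monomials\<close>

text \<open>\<open>pe u p\<close> is the path p, and its companion \<open>pg u p\<close> is the
  ghost path p*. The vertex u is carried along for the empty path, which stands for u
  itself.\<close>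

primrec pe :: "'v \<Rightarrow> 'e list \<Rightarrow> 'a" where
  "pe u [] = V u"
| "pe u (e # p) = X e * pe (head E e) p"

primrec pg :: "'v \<Rightarrow> 'e list \<Rightarrow> 'a" where
  "pg u [] = V u"
| "pg u (e # p) = pg (head E e) p * Y e"

lemma awalk_verts_ends: "awalk u p w \<Longrightarrow> u \<in> verts E" "awalk u p w \<Longrightarrow> w \<in> verts E"
  by (auto simp: awalk_hd_in_verts awalk_last_in_verts)

lemma awalk_prefixD:
  assumes "awalk u (p @ q) z" "awalk u p w"
  shows "awalk w q z"
  using assms by (metis awalk_append_iff awalk_ends awalkE' awalk_def cas_ends)

lemma pe_left: "awalk u p w \<Longrightarrow> V u * pe u p = pe u p"
  by (cases p) (auto simp: awalk_Cons_iff awalk_Nil_iff V_idem VX mult.assoc[symmetric])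

lemma pg_right: "awalk u p w \<Longrightarrow> pg u p * V u = pg u p"
  by (cases p) (auto simp: awalk_Cons_iff awalk_Nil_iff V_idem YV mult.assoc)

lemma pe_right: "awalk u p w \<Longrightarrow> pe u p * V w = pe u p"
  by (induction p arbitrary: u) (auto simp: awalk_Cons_iff awalk_Nil_iff V_idem mult.assoc)

lemma pg_left: "awalk u p w \<Longrightarrow> V w * pg u p = pg u p"
  by (induction p arbitrary: u) (auto simp: awalk_Cons_iff awalk_Nil_iff V_idem mult.assoc[symmetric])

lemma pe_append: "awalk u p w \<Longrightarrow> awalk w q z \<Longrightarrow> pe u (p @ q) = pe u p * pe w q"
  by (induction p arbitrary: u) (auto simp: awalk_Cons_iff awalk_Nil_iff pe_left mult.assoc)

lemma pg_append: "awalk u p w \<Longrightarrow> awalk w q z \<Longrightarrow> pg u (p @ q) = pg w q * pg u p"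
  by (induction p arbitrary: u) (auto simp: awalk_Cons_iff awalk_Nil_iff pg_right mult.assoc)

lemma pg_pe: "awalk u p w \<Longrightarrow> pg u p * pe u p = V w"
proof (induction p arbitrary: u)
  case (Cons e p)
  then have e: "e \<in> arcs E" "awalk (head E e) p w" by (auto simp: awalk_Cons_iff)
  have "pg u (e # p) * pe u (e # p) = pg (head E e) p * ((Y e * X e) * pe (head E e) p)"
    by (simp add: mult.assoc)
  then show ?case using e Cons.IH pe_left by (simp add: YX)
qed (auto simp: awalk_Nil_iff V_idem)

lemma pg_pe_prefix: "awalk u p w \<Longrightarrow> awalk w q z \<Longrightarrow> pg u p * pe u (p @ q) = pe w q"
  by (simp add: pe_append[of u p w q z] mult.assoc[symmetric] pg_pe[of u p w] pe_left[of w q z])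

lemma pg_pe_prefix': "awalk u p w \<Longrightarrow> awalk w q z \<Longrightarrow> pg u (p @ q) * pe u p = pg w q"
  by (simp add: pg_append[of u p w q z] mult.assoc pg_pe[of u p w] pg_right[of w q z])

text \<open>Common initial edges cancel by e* e = r(e), until the first pair of distinct edges gives
  e* f = 0.\<close>

lemma pg_pe_incomparable:
  assumes "awalk u p w" "awalk u q z" "\<not> prefix p q" "\<not> prefix q p"
  shows "pg u p * pe u q = 0"
  using assms
proof (induction p arbitrary: u q)
  case (Cons e p)
  then obtain f q' where q: "q = f # q'" by (cases q) auto
  have ef: "e \<in> arcs E" "f \<in> arcs E" "awalk (head E e) p w" "awalk (head E f) q' z"
    using Cons.prems q by (auto simp: awalk_Cons_iff)
  have *: "pg u (e # p) * pe u q = pg (head E e) p * ((Y e * X f) * pe (head E f) q')"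
    by (simp add: q mult.assoc)
  show ?case
  proof (cases "e = f")
    case True
    then show ?thesis
      using * ef Cons.IH[of "head E e" q'] Cons.prems q pe_left by (simp add: YX)
  qed (use * ef in \<open>simp add: YX_orth\<close>)
qed simp

lemma pg_pe_distinct_base:
  assumes "awalk u p w" "awalk v q z" "u \<noteq> v"
  shows "pg u p * pe v q = 0"
proof -
  have "pg u p * pe v q = pg u p * (V u * V v) * pe v q"
    using assms pg_right pe_left by (metis mult.assoc)
  then show ?thesis using assms awalk_verts_ends V_orth by (metis mult_zero_left mult_zero_right)
qed

text \<open>The multiplication rule behind all computations with monomials: unless the product
  vanishes, the shorter path cancels against the longer one. Asking for a non-empty r in the last
  case keeps p = q on one side.\<close>

lemma pg_pe_cases:
  assumes "awalk u p w" "awalk v q z"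
  obtains (zero) "pg u p * pe v q = 0"
  | (left) r where "u = v" "q = p @ r" "awalk w r z" "pg u p * pe v q = pe w r"
  | (right) r where "u = v" "p = q @ r" "r \<noteq> []" "awalk z r w" "pg u p * pe v q = pg z r"
proof (cases "u = v \<and> (prefix p q \<or> prefix q p)")
  case True
  then consider r where "q = p @ r" | r where "p = q @ r" "r \<noteq> []"
    by (metis append_Nil2 prefixE)
  then show ?thesis
  proof cases
    case 1
    then have "awalk w r z" using assms True awalk_prefixD by blast
    then show ?thesis using left 1 True assms pg_pe_prefix by blast
  next
    case 2
    then have "awalk z r w" using assms True awalk_prefixD by blast
    then show ?thesis using right 2 True assms pg_pe_prefix' by blast
  qed
qed (use assms zero pg_pe_incomparable pg_pe_distinct_base in blast)

lemma hc_pe: "awalk u p w \<Longrightarrow> hc (int (length p)) (pe u p) = pe u p"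
proof (induction p arbitrary: u)
  case (Cons e p)
  then show ?case
    using homogeneous_mult[of 1 "X e" "int (length p)"] by (auto simp: awalk_Cons_iff hc_X algebra_simps)
qed (auto simp: awalk_Nil_iff hc_V)

lemma hc_pg: "awalk u p w \<Longrightarrow> hc (- int (length p)) (pg u p) = pg u p"
proof (induction p arbitrary: u)
  case (Cons e p)
  then show ?case
    using homogeneous_mult[of "- int (length p)" "pg (head E e) p" "-1" "Y e"]
    by (auto simp: awalk_Cons_iff hc_Y algebra_simps)
qed (auto simp: awalk_Nil_iff hc_V)

definition mons :: "'a set" where
  "mons = {pe u p * pg v q |u p v q w. awalk u p w \<and> awalk v q w}"

definition mon_span :: "'a set" where
  "mon_span = aspan {sc k m |k m. m \<in> mons}"

lemma mons_homogeneous: "m \<in> mons \<Longrightarrow> \<exists>d. hc d m = m"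
  unfolding mons_def using homogeneous_mult hc_pe hc_pg by blast

lemma monsI: "awalk u p w \<Longrightarrow> awalk v q w \<Longrightarrow> pe u p * pg v q \<in> mons"
  unfolding mons_def by blast

lemma pe_mons: "awalk u p w \<Longrightarrow> pe u p \<in> mons"
  using monsI[of u p w w "[]"] pe_right awalk_verts_ends by (auto simp: awalk_Nil_iff)

lemma pg_mons: "awalk u p w \<Longrightarrow> pg u p \<in> mons"
  using monsI[of w "[]" w u p] pg_left awalk_verts_ends by (auto simp: awalk_Nil_iff)

lemma awalk_arc: "e \<in> arcs E \<Longrightarrow> awalk (tail E e) [e] (head E e)"
  by (simp add: awalk_Cons_iff awalk_Nil_iff)

lemma mons_mult:
  assumes "m \<in> mons" "n \<in> mons"
  shows "m * n = 0 \<or> m * n \<in> mons"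
proof -
  obtain u p v q w where m: "m = pe u p * pg v q" "awalk u p w" "awalk v q w"
    using assms unfolding mons_def by blast
  obtain u' p' v' q' w' where n: "n = pe u' p' * pg v' q'" "awalk u' p' w'" "awalk v' q' w'"
    using assms unfolding mons_def by blast
  have *: "m * n = pe u p * (pg v q * pe u' p') * pg v' q'" by (simp add: m n mult.assoc)
  from m(3) n(2) show ?thesis
  proof (cases rule: pg_pe_cases)
    case (left r)
    then have "m * n = pe u (p @ r) * pg v' q'" using * m pe_append by simp
    moreover have "awalk u (p @ r) w'" using left m awalk_appendI by blast
    ultimately show ?thesis using monsI n by metis
  next
    case (right r)
    then have "m * n = pe u p * pg v' (q' @ r)" using * n pg_append by (simp add: mult.assoc)
    moreover have "awalk v' (q' @ r) w" using right n awalk_appendI by blast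
    ultimately show ?thesis using monsI m by metis
  qed (use * in simp)
qed

lemma gens_mons: "V ` verts E \<union> X ` arcs E \<union> Y ` arcs E \<subseteq> mons"
proof -
  have "V v \<in> mons" if "v \<in> verts E" for v
    using pe_mons[of v "[]" v] that by (simp add: awalk_Nil_iff)
  moreover have "X e \<in> mons" if "e \<in> arcs E" for e
    using pe_mons[OF awalk_arc[OF that]] XV[OF that] by simp
  moreover have "Y e \<in> mons" if "e \<in> arcs E" for e
    using pg_mons[OF awalk_arc[OF that]] VY[OF that] by simp
  ultimately show ?thesis by blast
qed

text \<open>A product of monomials is a monomial or zero, so every word reduces to one of
  these.\<close>

lemma C_mons: "C \<subseteq> mon_span"
proof
  fix x assume "x \<in> C"
  then have "x \<in> aspan {sc k w |k w. w \<in> gen_words (V ` verts E \<union> X ` arcs E \<union> Y ` arcs E)}"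
    using C_words by blast
  then show "x \<in> mon_span" unfolding mon_span_def
  proof (rule aspan_image[where f = "\<lambda>x. x"])
    fix b assume "b \<in> {sc k w |k w. w \<in> gen_words (V ` verts E \<union> X ` arcs E \<union> Y ` arcs E)}"
    then obtain k w where b: "b = sc k w" "w \<in> gen_words (V ` verts E \<union> X ` arcs E \<union> Y ` arcs E)"
      by blast
    from b(2) have "w = 0 \<or> w \<in> mons"
    proof induction
      case (gen_words_step w b)
      then have "b \<in> mons" using gens_mons by blast
      then show ?case using gen_words_step.IH mons_mult[of w b] by auto
    qed (use gens_mons in blast)
    then show "b \<in> aspan {sc k m |k m. m \<in> mons}"
      unfolding b using aspan_base[of "sc k w" "{sc k m |k m. m \<in> mons}"] aspan_zero by auto
  qed auto
qed

end

context leavitt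
begin

subsection \<open>Local units\<close>

text \<open>The projections p p*. Two of them are nested or orthogonal, so they commute, and their
  span \<open>diag\<close> is a commutative algebra in degree 0 from which all local units are
  taken.\<close>

definition diag_gens :: "'a set" where
  "diag_gens = {pe u p * pg u p |u p w. awalk u p w}"

definition diag :: "'a set" where
  "diag = aspan {sc k d |k d. d \<in> diag_gens}"

lemma diag_gens_nested:
  assumes "awalk u p w" "awalk u (p @ r) z"
  shows "(pe u p * pg u p) * (pe u (p @ r) * pg u (p @ r)) = pe u (p @ r) * pg u (p @ r)"
    and "(pe u (p @ r) * pg u (p @ r)) * (pe u p * pg u p) = pe u (p @ r) * pg u (p @ r)"
proof -
  have r: "awalk w r z" using assms awalk_prefixD by blast
  have "(pe u p * pg u p) * (pe u (p @ r) * pg u (p @ r)) = pe u p * (pg u p * pe u (p @ r)) * pg u (p @ r)"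
    by (simp add: mult.assoc)
  then show "(pe u p * pg u p) * (pe u (p @ r) * pg u (p @ r)) = pe u (p @ r) * pg u (p @ r)"
    using pg_pe_prefix[OF assms(1) r] pe_append[OF assms(1) r] by simp
  have "(pe u (p @ r) * pg u (p @ r)) * (pe u p * pg u p) = pe u (p @ r) * ((pg u (p @ r) * pe u p) * pg u p)"
    by (simp add: mult.assoc)
  then show "(pe u (p @ r) * pg u (p @ r)) * (pe u p * pg u p) = pe u (p @ r) * pg u (p @ r)"
    using pg_pe_prefix'[OF assms(1) r] pg_append[OF assms(1) r] by simp
qed

lemma diag_gens_mult:
  assumes "d \<in> diag_gens" "d' \<in> diag_gens"
  shows "d * d' = d' * d" "d * d' = 0 \<or> d * d' \<in> diag_gens"
proof -
  obtain u p w where d: "d = pe u p * pg u p" "awalk u p w" using assms unfolding diag_gens_def by blast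
  obtain v q z where d': "d' = pe v q * pg v q" "awalk v q z" using assms unfolding diag_gens_def by blast
  have "d * d' = d' * d \<and> (d * d' = 0 \<or> d * d' \<in> diag_gens)"
  proof (cases "u = v \<and> (prefix p q \<or> prefix q p)")
    case True
    then consider r where "q = p @ r" "u = v" | r where "p = q @ r" "u = v" by (metis prefixE)
    then show ?thesis
      by cases (use d d' diag_gens_nested assms in metis)+
  next
    case False
    then have "pg u p * pe v q = 0" "pg v q * pe u p = 0"
      using d d' pg_pe_incomparable pg_pe_distinct_base by blast+
    then have "pe u p * (pg u p * pe v q) * pg v q = 0" "pe v q * (pg v q * pe u p) * pg u p = 0" by simp_all
    then have "d * d' = 0" "d' * d = 0" unfolding d d' by (simp_all only: mult.assoc)
    then show ?thesis by simp
  qed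
  then show "d * d' = d' * d" "d * d' = 0 \<or> d * d' \<in> diag_gens" by blast+
qed

lemma diag_gen_in: "d \<in> diag_gens \<Longrightarrow> sc k d \<in> diag"
  unfolding diag_def by (rule aspan_base) blast

lemma diag_gen_in_diag: "d \<in> diag_gens \<Longrightarrow> d \<in> diag"
  using diag_gen_in[of d 1] sc_one by simp

lemma diag_zero: "0 \<in> diag"
  unfolding diag_def by (rule aspan_zero)

lemma diag_plus: "d \<in> diag \<Longrightarrow> d' \<in> diag \<Longrightarrow> d + d' \<in> diag"
  unfolding diag_def by (rule aspan_plus)

lemma diag_sum: "(\<And>i. i \<in> F \<Longrightarrow> f i \<in> diag) \<Longrightarrow> sum f F \<in> diag"
  unfolding diag_def by (rule aspan_sum)

lemma diag_induct [consumes 1, case_names zero add]: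
  assumes "d \<in> diag" "P 0" "\<And>k g d. g \<in> diag_gens \<Longrightarrow> d \<in> diag \<Longrightarrow> P d \<Longrightarrow> P (sc k g + d)"
  shows "P d"
  using assms(1) unfolding diag_def by induction (use assms(2,3) diag_def in auto)

lemma diag_sc: "d \<in> diag \<Longrightarrow> sc k d \<in> diag"
  by (induction rule: diag_induct) (auto simp: diag_zero sc_add sc_sc intro: diag_plus diag_gen_in)

lemma diag_diff: "d \<in> diag \<Longrightarrow> d' \<in> diag \<Longrightarrow> d - d' \<in> diag"
  using diag_plus[of d "sc (-1) d'"] diag_sc[of d' "-1"] by (simp add: sc_minus sc_one)

lemma diag_commute:
  assumes "d \<in> diag" "d' \<in> diag"
  shows "d * d' = d' * d"
  using assms(1)
proof (induction rule: diag_induct)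
  case (add k g d)
  have "g * d' = d' * g"
    using assms(2)
  proof (induction rule: diag_induct)
    case (add l h d')
    then show ?case
      using diag_gens_mult(1)[OF \<open>g \<in> diag_gens\<close> \<open>h \<in> diag_gens\<close>]
      by (simp add: algebra_simps sc_mult_left sc_mult_right)
  qed simp
  then show ?case using add by (simp add: algebra_simps sc_mult_left sc_mult_right)
qed simp

lemma diag_mult:
  assumes "d \<in> diag" "d' \<in> diag"
  shows "d * d' \<in> diag"
  unfolding diag_def
proof (rule aspan_mult[OF assms[unfolded diag_def]])
  fix a b assume "a \<in> {sc k d |k d. d \<in> diag_gens}" "b \<in> {sc k d |k d. d \<in> diag_gens}"
  then obtain k d l d' where "a = sc k d" "b = sc l d'" "d \<in> diag_gens" "d' \<in> diag_gens" by blast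
  then have "a * b = sc (l * k) (d * d')" "d * d' = 0 \<or> d * d' \<in> diag_gens"
    using diag_gens_mult by (auto simp: sc_mult_left sc_mult_right sc_sc mult.commute)
  then have "a * b \<in> diag" using diag_zero diag_gen_in by force
  then show "a * b \<in> aspan {sc k d |k d. d \<in> diag_gens}" unfolding diag_def .
qed

text \<open>With m = p q* and d = r r*, the product m d m* is zero or again a projection: along p s
  if r = q s, and along p if r is a proper prefix of q.\<close>

lemma diag_conj:
  assumes "awalk u p w" "awalk v q w" "d \<in> diag"
  shows "(pe u p * pg v q) * d * (pe v q * pg u p) \<in> diag"
  using assms(3)
proof (induction rule: diag_induct)
  case (add k g d)
  obtain y r z where g: "g = pe y r * pg y r" "awalk y r z" using add unfolding diag_gens_def by blast
  have *: "(pe u p * pg v q) * g * (pe v q * pg u p) = pe u p * (pg v q * pe y r) * (pg y r * pe v q) * pg u p"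
    unfolding g by (simp add: mult.assoc)
  have "(pe u p * pg v q) * g * (pe v q * pg u p) \<in> diag_gens \<union> {0}"
    using assms(2) g(2)
  proof (cases rule: pg_pe_cases)
    case (left s)
    have "pg y r * pe v q = pg w s"
      using left pg_pe_prefix'[OF assms(2), of s z] by simp
    then have "(pe u p * pg v q) * g * (pe v q * pg u p) = pe u (p @ s) * pg u (p @ s)"
      unfolding * left(4) \<open>pg y r * pe v q = pg w s\<close> pe_append[OF assms(1) left(3)]
        pg_append[OF assms(1) left(3)] by (simp add: mult.assoc)
    moreover have "awalk u (p @ s) z" using assms left by auto
    ultimately show ?thesis unfolding diag_gens_def by blast
  next
    case (right s)
    have "pg y r * pe v q = pe z s"
      using right pg_pe_prefix[OF g(2), of s w] by simp
    moreover have "(pe u p * pg z s) * (pe z s * pg u p) = pe u p * pg u p"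
      using pg_pe[OF right(4)] pg_left[OF assms(1)] by (metis mult.assoc)
    ultimately have "(pe u p * pg v q) * g * (pe v q * pg u p) = pe u p * pg u p"
      unfolding * right(5) \<open>pg y r * pe v q = pe z s\<close> by (simp add: mult.assoc)
    then show ?thesis using assms unfolding diag_gens_def by blast
  qed (use * in simp)
  then have "sc k ((pe u p * pg v q) * g * (pe v q * pg u p)) \<in> diag"
    using diag_gen_in diag_zero by force
  then show ?case
    using diag_plus[OF _ add.IH]
    by (simp add: distrib_left distrib_right mult.assoc sc_mult_left sc_mult_right)
qed (simp add: diag_zero)

lemma hc_diag: "d \<in> diag \<Longrightarrow> hc 0 d = d"
proof (induction rule: diag_induct)
  case (add k g d)
  then obtain u p w where "g = pe u p * pg u p" "awalk u p w" unfolding diag_gens_def by blast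
  then have "hc 0 g = g" using homogeneous_mult[OF hc_pe[of u p w] hc_pg[of u p w]] by simp
  then show ?case using add by (simp add: hc_add hc_sc)
qed simp

lemma V_diag: "v \<in> verts E \<Longrightarrow> V v \<in> diag"
proof (rule diag_gen_in_diag)
  assume "v \<in> verts E"
  then have "V v = pe v [] * pg v []" "awalk v [] v" by (auto simp: V_idem awalk_Nil_iff)
  then show "V v \<in> diag_gens" unfolding diag_gens_def by blast
qed

lemma XY_diag: "e \<in> arcs E \<Longrightarrow> X e * Y e \<in> diag"
proof (rule diag_gen_in_diag)
  assume e: "e \<in> arcs E"
  have "X e * V (head E e) * (V (head E e) * Y e) = X e * Y e" using e XV VY by metis
  then have "X e * Y e = pe (tail E e) [e] * pg (tail E e) [e]" by simp
  then show "X e * Y e \<in> diag_gens" unfolding diag_gens_def using awalk_arc[OF e] by blast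
qed

lemma idl_gen:
  assumes "B \<subseteq> C" shows "idl C (gen C B)"
  unfolding gen_def by (rule idl_Inter) (use assms idl_C in auto)

text \<open>Without a unit, g need not have the form x g y; the unit u of g supplied by the second
  assumption gives g = u g u.\<close>

lemma gen_span:
  assumes "B \<subseteq> C" "\<And>g. g \<in> B \<Longrightarrow> \<exists>u\<in>C. u * g = g \<and> g * u = g"
  shows "gen C B \<subseteq> aspan {x * g * y |x g y. x \<in> C \<and> g \<in> B \<and> y \<in> C}" (is "_ \<subseteq> aspan ?S")
proof (rule gen_least)
  have S: "?S \<subseteq> C" using idl_rmult[OF idl_C] by blast
  show "idl C (aspan ?S)"
    unfolding idl_def
  proof (intro conjI ballI allI)
    show "aspan ?S \<subseteq> C" using idl_aspan[OF idl_C S] .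
    fix x assume x: "x \<in> aspan ?S"
    show "- x \<in> aspan ?S"
    proof (rule aspan_image[OF x, where f = uminus])
      fix b assume "b \<in> ?S"
      then obtain x g y where b: "b = x * g * y" "x \<in> C" "g \<in> B" "y \<in> C" by blast
      then have "- b = (- x) * g * y" "- x \<in> C" using idl_neg[OF idl_C] by auto
      then show "- b \<in> aspan ?S" using b by (blast intro: aspan_base)
    qed auto
    fix z
    show "z * x \<in> aspan ?S"
    proof (rule aspan_image[OF x, where f = "\<lambda>x. z * x"])
      fix b assume "b \<in> ?S"
      then obtain x g y where b: "b = x * g * y" "x \<in> C" "g \<in> B" "y \<in> C" by blast
      then have "z * b = (z * x) * g * y" "z * x \<in> C" using idl_lmult[OF idl_C] by (auto simp: mult.assoc)
      then show "z * b \<in> aspan ?S" using b by (blast intro: aspan_base)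
    qed (auto simp: algebra_simps)
    show "x * z \<in> aspan ?S"
    proof (rule aspan_image[OF x, where f = "\<lambda>x. x * z"])
      fix b assume "b \<in> ?S"
      then obtain x g y where b: "b = x * g * y" "x \<in> C" "g \<in> B" "y \<in> C" by blast
      then have "b * z = x * g * (y * z)" "y * z \<in> C" using idl_rmult[OF idl_C] by (auto simp: mult.assoc)
      then show "b * z \<in> aspan ?S" using b by (blast intro: aspan_base)
    qed (auto simp: algebra_simps)
  qed (auto intro: aspan_zero aspan_plus)
  show "B \<subseteq> aspan ?S"
  proof
    fix g assume g: "g \<in> B"
    then obtain u where "u \<in> C" "u * g = g" "g * u = g" using assms by blast
    then have "g = u * g * u" by simp
    then show "g \<in> aspan ?S" using g \<open>u \<in> C\<close> by (blast intro: aspan_base)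
  qed
qed

text \<open>The common unit of two elements is the join \<open>u + d - u d\<close> of commuting idempotents; for
  \<open>x = m g n\<close> the idempotents \<open>m g m\<^sup>*\<close> and \<open>n\<^sup>* g n\<close> of the diagonal are units for \<open>x\<close> on
  either side.\<close>

lemma join_unit:
  fixes u d :: 'a
  assumes "u * d = d * u"
  shows "u * y = y \<Longrightarrow> (u + d - u * d) * y = y" "d * y = y \<Longrightarrow> (u + d - u * d) * y = y"
    "y * u = y \<Longrightarrow> y * (u + d - u * d) = y" "y * d = y \<Longrightarrow> y * (u + d - u * d) = y"
proof -
  have 1: "(u + d - u * d) * y = u * y + d * y - u * (d * y)" by (simp add: algebra_simps mult.assoc)
  have 2: "(u + d - u * d) * y = u * y + d * y - d * (u * y)"
    unfolding assms by (simp add: algebra_simps mult.assoc)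
  have 3: "y * (u + d - u * d) = y * u + y * d - (y * u) * d" by (simp add: algebra_simps mult.assoc)
  have 4: "y * (u + d - u * d) = y * u + y * d - (y * d) * u"
    unfolding assms by (simp add: algebra_simps mult.assoc)
  show "u * y = y \<Longrightarrow> (u + d - u * d) * y = y" using 2 by simp
  show "d * y = y \<Longrightarrow> (u + d - u * d) * y = y" using 1 by simp
  show "y * u = y \<Longrightarrow> y * (u + d - u * d) = y" using 3 by simp
  show "y * d = y \<Longrightarrow> y * (u + d - u * d) = y" using 4 by simp
qed

lemma mon_unit:
  assumes "m \<in> mons" "g \<in> diag" "g * g = g" "idl C J" "g \<in> J"
  obtains d d' where "d \<in> diag" "d \<in> J" "d * (m * g) = m * g" "d' \<in> diag" "d' \<in> J" "(g * m) * d' = g * m"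
proof -
  obtain u p v q w where m: "m = pe u p * pg v q" "awalk u p w" "awalk v q w"
    using assms unfolding mons_def by blast
  \<comment> \<open>This n is m*: it satisfies m n m = m, and both n m and m n are diagonal, so g
    can be moved past them.\<close>
  define n where "n = pe v q * pg u p"
  have dg: "n * m \<in> diag" "m * n \<in> diag"
  proof -
    have "m * n = pe u p * pg u p" "n * m = pe v q * pg v q"
      unfolding m n_def using pg_pe[OF m(2)] pg_pe[OF m(3)] pg_left[OF m(2)] pg_left[OF m(3)] by (metis mult.assoc)+
    then show "n * m \<in> diag" "m * n \<in> diag"
      using m diag_gen_in_diag unfolding diag_gens_def by auto
  qed
  have mnm: "m * n * m = m"
    unfolding m n_def using pg_pe[OF m(2)] pg_pe[OF m(3)] pg_left[OF m(2)] pg_left[OF m(3)] by (metis mult.assoc)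
  have "(m * g * n) * (m * g) = m * (g * (n * m)) * g" by (simp add: mult.assoc)
  also have "\<dots> = m * ((n * m) * g) * g" using diag_commute[OF assms(2) dg(1)] by (simp only:)
  also have "\<dots> = (m * n * m) * (g * g)" by (simp add: mult.assoc)
  finally have 1: "(m * g * n) * (m * g) = m * g" using mnm assms(3) by simp
  have "(g * m) * (n * g * m) = g * ((m * n) * g) * m" by (simp add: mult.assoc)
  also have "\<dots> = g * (g * (m * n)) * m" using diag_commute[OF assms(2) dg(2)] by (simp only:)
  also have "\<dots> = (g * g) * (m * n * m)" by (simp add: mult.assoc)
  finally have 2: "(g * m) * (n * g * m) = g * m" using mnm assms(3) by simp
  have "m * g * n \<in> diag" "n * g * m \<in> diag"
    using diag_conj[OF m(2,3) assms(2)] diag_conj[OF m(3,2) assms(2)] m n_def by auto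
  moreover have "m * g * n \<in> J" "n * g * m \<in> J" using assms idl_lmult idl_rmult by metis+
  ultimately show thesis using that 1 2 by blast
qed

lemma mon_span_triple:
  assumes "x \<in> C" "y \<in> C" "g \<in> B"
  shows "x * g * y \<in> aspan {sc k (m * g * n) |k m g n. m \<in> mons \<and> g \<in> B \<and> n \<in> mons}" (is "_ \<in> aspan ?T")
proof (rule aspan_mult[where A = "{sc k (m * g) |k m. m \<in> mons}" and B = "{sc k m |k m. m \<in> mons}"])
  show "x * g \<in> aspan {sc k (m * g) |k m. m \<in> mons}"
  proof (rule aspan_image[where f = "\<lambda>x. x * g" and B = "{sc k m |k m. m \<in> mons}"])
    show "x \<in> aspan {sc k m |k m. m \<in> mons}" using assms C_mons mon_span_def by blast
    fix b assume "b \<in> {sc k m |k m. m \<in> mons}"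
    then obtain k m where "b * g = sc k (m * g)" "m \<in> mons" by (auto simp: sc_mult_left)
    then show "b * g \<in> aspan {sc k (m * g) |k m. m \<in> mons}" by (blast intro: aspan_base)
  qed (auto simp: algebra_simps)
  show "y \<in> aspan {sc k m |k m. m \<in> mons}" using assms C_mons mon_span_def by blast
  fix a b assume "a \<in> {sc k (m * g) |k m. m \<in> mons}" "b \<in> {sc k m |k m. m \<in> mons}"
  then obtain k m l n where "a = sc k (m * g)" "m \<in> mons" "b = sc l n" "n \<in> mons" by blast
  then have "a * b = sc (l * k) (m * g * n)" by (simp add: sc_mult_left sc_mult_right sc_sc)
  then show "a * b \<in> aspan ?T" using \<open>m \<in> mons\<close> \<open>n \<in> mons\<close> assms(3) by (blast intro: aspan_base)
qed

lemma gen_mon_span: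
  assumes "B \<subseteq> C" "\<And>g. g \<in> B \<Longrightarrow> g * g = g"
  shows "gen C B \<subseteq> aspan {sc k (m * g * n) |k m g n. m \<in> mons \<and> g \<in> B \<and> n \<in> mons}" (is "_ \<subseteq> aspan ?T")
proof
  fix x assume "x \<in> gen C B"
  then have "x \<in> aspan {x * g * y |x g y. x \<in> C \<and> g \<in> B \<and> y \<in> C}"
    using gen_span[OF assms(1)] assms by blast
  then show "x \<in> aspan ?T"
    by (rule aspan_image[where f = "\<lambda>x. x"]) (use mon_span_triple in auto)
qed

lemma diag_gen_units:
  assumes "B \<subseteq> C" "B \<subseteq> diag" "\<And>g. g \<in> B \<Longrightarrow> g * g = g" "x \<in> gen C B"
  shows "\<exists>u\<in>gen C B. u \<in> diag \<and> u * x = x \<and> x * u = x"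
proof -
  let ?J = "gen C B"
  have J: "idl C ?J" using idl_gen assms(1) .
  have "x \<in> aspan {sc k (m * g * n) |k m g n. m \<in> mons \<and> g \<in> B \<and> n \<in> mons}"
    using gen_mon_span[OF assms(1,3)] assms(4) by blast
  then show ?thesis
  proof induction
    case aspan_zero
    show ?case using idl_zero[OF J] diag_zero by auto
  next
    case (aspan_add b x)
    then obtain k m g n where b: "b = sc k (m * g * n)" "m \<in> mons" "g \<in> B" "n \<in> mons" by blast
    have g: "g \<in> diag" "g * g = g" "g \<in> ?J" using b assms gen_superset by blast+
    obtain d where d: "d \<in> diag" "d \<in> ?J" "d * (m * g) = m * g" using mon_unit[OF b(2) g(1,2) J g(3)] .
    obtain d' where d': "d' \<in> diag" "d' \<in> ?J" "(g * n) * d' = g * n" using mon_unit[OF b(4) g(1,2) J g(3)] .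
    obtain u where u: "u \<in> ?J" "u \<in> diag" "u * x = x" "x * u = x" using aspan_add by blast
    have db: "d * b = b"
      using d(3) by (simp add: b sc_mult_right) (metis mult.assoc)
    have bd: "b * d' = b"
      using d'(3) by (simp add: b sc_mult_left) (metis mult.assoc)
    \<comment> \<open>Two joins are made because d is a unit of b on the left only and d' on the
      right only: u1 adds d to the old unit, and u2 then adds d'.\<close>
    define u1 where "u1 = u + d - u * d"
    have cu: "u * d = d * u" using u d diag_commute by blast
    have u1: "u1 \<in> ?J" "u1 \<in> diag" "u1 * x = x" "x * u1 = x" "u1 * b = b"
      using join_unit[OF cu] u d db diag_plus diag_diff diag_mult idl_add[OF J] idl_diff[OF J] idl_lmult[OF J]
      unfolding u1_def by simp_all
    define u2 where "u2 = u1 + d' - u1 * d'"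
    have cu2: "u1 * d' = d' * u1" using u1 d' diag_commute by blast
    have "u2 \<in> ?J" "u2 \<in> diag" "u2 * x = x" "x * u2 = x" "u2 * b = b" "b * u2 = b"
      using join_unit[OF cu2] u1 d' bd diag_plus diag_diff diag_mult idl_add[OF J] idl_diff[OF J] idl_lmult[OF J]
      unfolding u2_def by simp_all
    then show ?case by (metis distrib_left distrib_right)
  qed
qed

lemma diag_gen_locally_unital:
  assumes "B \<subseteq> C" "B \<subseteq> diag" "\<And>g. g \<in> B \<Longrightarrow> g * g = g"
  shows "locally_unital (gen C B)"
  unfolding locally_unital_def using diag_gen_units[OF assms] by blast

text \<open>Exhibits \<open>C\<close> as an ideal generated by diagonal idempotents, so that local
  units and gradedness hold for the whole algebra as well.\<close>

lemma V_gen_C: "gen C (V ` verts E) = C"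
proof
  have sub: "V ` verts E \<subseteq> C" using V_C by blast
  show "gen C (V ` verts E) \<subseteq> C" using idl_sub[OF idl_gen[OF sub]] .
  note J = idl_gen[OF sub]
  have "sc k m \<in> gen C (V ` verts E)" if m: "m \<in> mons" for k m
  proof -
    obtain u p v q w where m: "m = pe u p * pg v q" "awalk u p w" using m unfolding mons_def by blast
    have "sc k m = V u * sc k m"
      unfolding m using pe_left[OF m(2)] by (simp add: sc_mult_right mult.assoc[symmetric])
    moreover have "V u \<in> gen C (V ` verts E)"
      using gen_superset awalk_verts_ends(1)[OF m(2)] by blast
    ultimately show ?thesis using idl_rmult[OF J, of "V u" "sc k m"] by simp
  qed
  then have "mon_span \<subseteq> gen C (V ` verts E)"
    unfolding mon_span_def by (intro idl_aspan[OF J]) blast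
  then show "C \<subseteq> gen C (V ` verts E)" using C_mons by blast
qed

lemma C_units: "x \<in> C \<Longrightarrow> \<exists>u\<in>C. u * x = x \<and> x * u = x"
proof -
  assume "x \<in> C"
  moreover have "V ` verts E \<subseteq> C" "V ` verts E \<subseteq> diag" "\<And>g. g \<in> V ` verts E \<Longrightarrow> g * g = g"
    using V_C V_diag V_idem by auto
  ultimately show ?thesis using diag_gen_units[of "V ` verts E" x] V_gen_C by auto
qed

text \<open>A local unit u turns the scalar into a ring element: k x = (k u) x.\<close>

lemma idl_sc: "idl C J \<Longrightarrow> x \<in> J \<Longrightarrow> sc k x \<in> J"
  using C_units idl_sub idl_lmult by (metis sc_mult_left subsetD)

lemma gen_span':
  assumes "B \<subseteq> C"
  shows "gen C B \<subseteq> aspan {x * g * y |x g y. x \<in> C \<and> g \<in> B \<and> y \<in> C}"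
  using gen_span[OF assms] C_units assms by blast

subsection \<open>Graded ideals\<close>

definition graded :: "'a set \<Rightarrow> bool" where
  "graded J \<longleftrightarrow> idl C J \<and> (\<forall>x\<in>J. \<forall>n. hc n x \<in> J)"

text \<open>Diagonal elements have degree 0, so the ideal is spanned by homogeneous elements m g
  n.\<close>

lemma diag_gen_graded:
  assumes "B \<subseteq> C" "B \<subseteq> diag" "\<And>g. g \<in> B \<Longrightarrow> g * g = g"
  shows "graded (gen C B)"
  unfolding graded_def
proof (intro conjI ballI allI)
  show J: "idl C (gen C B)" using idl_gen assms(1) .
  fix x n assume "x \<in> gen C B"
  then have "x \<in> aspan {sc k (m * g * n) |k m g n. m \<in> mons \<and> g \<in> B \<and> n \<in> mons}"
    using gen_mon_span[OF assms(1,3)] by blast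
  then show "hc n x \<in> gen C B"
  proof induction
    case (aspan_add b x)
    then obtain k m g l where b: "b = sc k (m * g * l)" "m \<in> mons" "g \<in> B" "l \<in> mons" by blast
    have "\<exists>d. hc d (m * g * l) = m * g * l"
      using mons_homogeneous[OF b(2)] mons_homogeneous[OF b(4)] hc_diag b(3) assms(2) homogeneous_mult
      by (metis subsetD)
    then have "hc n (m * g * l) = 0 \<or> hc n (m * g * l) = m * g * l" using hc_homogeneous by metis
    moreover have "m * g * l \<in> gen C B"
      using b(3) gen_superset idl_lmult[OF J] idl_rmult[OF J] by (metis subsetD)
    ultimately have "hc n b \<in> gen C B" using idl_sc[OF J] idl_zero[OF J] b by (metis hc_sc sc_zero(1))
    then show ?case using aspan_add idl_add[OF J] by (simp add: hc_add)
  qed (use idl_zero[OF J] in simp)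
qed

end

context leavitt
begin

lemma isumI: "a \<in> A \<Longrightarrow> b \<in> B \<Longrightarrow> a + b \<in> isum A B"
  unfolding isum_def by blast

lemma isumE:
  assumes "x \<in> isum A B"
  obtains a b where "x = a + b" "a \<in> A" "b \<in> B"
  using assms unfolding isum_def by blast

subsection \<open>Intersections with locally unital ideals\<close>

text \<open>For x = b + p and a left unit u of p in P, the difference x - u x equals b - u b and
  hence lies in A and in B, while u x lies in A and in P.\<close>

lemma modular_split:
  assumes "idl C A" "idl C B" "idl C P" "locally_unital P" "x \<in> A" "x \<in> isum B P"
  shows "x \<in> isum (A \<inter> B) (A \<inter> P)"
proof -
  obtain b p where x: "x = b + p" "b \<in> B" "p \<in> P" using assms(6) unfolding isum_def by blast
  obtain u where u: "u \<in> P" "u * p = p" using assms(4) x unfolding locally_unital_def by blast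
  have "x - u * x = b - u * b" using x u by (simp add: algebra_simps)
  moreover have "x - u * x \<in> A" using assms idl_diff idl_lmult by metis
  moreover have "b - u * b \<in> B" using assms x idl_diff idl_lmult by metis
  moreover have "u * x \<in> A" "u * x \<in> P" using assms u idl_lmult idl_rmult by metis+
  moreover have "x = (x - u * x) + u * x" by simp
  ultimately show ?thesis using isumI[of "x - u * x" "A \<inter> B" "u * x" "A \<inter> P"] by simp
qed

lemma aspan_sandwich:
  assumes J: "idl C J" and u: "u \<in> aspan S" and bc: "\<And>b c. b \<in> S \<Longrightarrow> c \<in> S \<Longrightarrow> b * x * c \<in> J"
  shows "u * x * u \<in> J"
proof -
  have *: "u * x * c \<in> J" if c: "c \<in> S" for c
    using u bc[OF _ c]
    by (induction rule: aspan.induct) (auto simp: distrib_right idl_zero[OF J] intro: idl_add[OF J])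
  show ?thesis
    using aspan_image[OF u, where f = "\<lambda>c. u * x * c" and B' = J] * idl_aspan[OF J, of J] aspan_base
    by (auto simp: distrib_left)
qed

definition vert_ideal :: "'v \<Rightarrow> 'a set" where
  "vert_ideal v = gen C {V v}"

lemma vert_ideal:
  assumes "v \<in> verts E"
  shows "idl C (vert_ideal v)" "graded (vert_ideal v)" "locally_unital (vert_ideal v)" "V v \<in> vert_ideal v"
proof -
  have 1: "{V v} \<subseteq> C" and 2: "{V v} \<subseteq> diag" and 3: "\<And>g. g \<in> {V v} \<Longrightarrow> g * g = g"
    using assms V_C V_diag V_idem by auto
  show "idl C (vert_ideal v)" "graded (vert_ideal v)" "locally_unital (vert_ideal v)"
    unfolding vert_ideal_def
    by (rule idl_gen[OF 1] diag_gen_graded[OF 1 2 3] diag_gen_locally_unital[OF 1 2 3]; assumption)+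
  show "V v \<in> vert_ideal v" unfolding vert_ideal_def using gen_superset by blast
qed

text \<open>The part of an ideal inside \<open>\<langle>v\<rangle>\<close> is determined by the corner at \<open>v\<close>.\<close>

lemma corner_subset:
  assumes v: "v \<in> verts E" and A: "idl C A" and J: "idl C J"
    and corner: "\<And>y. y \<in> A \<Longrightarrow> y \<in> vert_ideal v \<Longrightarrow> V v * y * V v \<in> J"
  shows "A \<inter> vert_ideal v \<subseteq> J"
proof
  fix x assume x: "x \<in> A \<inter> vert_ideal v"
  let ?S = "{x * g * y |x g y. x \<in> C \<and> g \<in> {V v} \<and> y \<in> C}"
  obtain u where u: "u \<in> vert_ideal v" "u * x = x" "x * u = x"
    using vert_ideal(3)[OF v] x unfolding locally_unital_def by blast
  have uS: "u \<in> aspan ?S" using u gen_span'[of "{V v}"] V_C[OF v] unfolding vert_ideal_def by auto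
  have "b * x * c \<in> J" if bc: "b \<in> ?S" "c \<in> ?S" for b c
  proof -
    obtain a a' where b: "b = a * V v * a'" using bc by blast
    obtain d d' where c: "c = d * V v * d'" using bc by blast
    have "b * x * c = a * (V v * (a' * x * d) * V v) * d'" by (simp add: b c mult.assoc)
    moreover have "a' * x * d \<in> A" "a' * x * d \<in> vert_ideal v"
      using x A vert_ideal(1)[OF v] idl_lmult idl_rmult by (metis IntE)+
    ultimately show ?thesis using corner J idl_lmult idl_rmult by metis
  qed
  from aspan_sandwich[OF J uS this] show "x \<in> J" using u by simp
qed

subsection \<open>The graded part of an ideal\<close>

text \<open>For F the set of edges from v that end outside H this is v^H. Other finite F occur when
  finitely many ghost edges have to be cut off.\<close>

definition cut :: "'v \<Rightarrow> 'e set \<Rightarrow> 'a" where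
  "cut v F = V v - (\<Sum>e\<in>F. X e * Y e)"

definition brk :: "'v set \<Rightarrow> 'v \<Rightarrow> 'e set" where
  "brk H v = {e \<in> out_arcs E v. head E e \<notin> H}"

text \<open>\<open>gv J\<close>, \<open>gs J\<close> and \<open>gr J\<close> are H, S and I(H,S) for
  the graded part of J.\<close>

definition gv :: "'a set \<Rightarrow> 'v set" where
  "gv J = {v \<in> verts E. V v \<in> J}"

definition gs :: "'a set \<Rightarrow> 'v set" where
  "gs J = {v \<in> breaking_verts E (gv J). cut v (brk (gv J) v) \<in> J}"

definition gr :: "'a set \<Rightarrow> 'a set" where
  "gr J = gen C (V ` gv J \<union> (\<lambda>v. cut v (brk (gv J) v)) ` gs J)"

lemma XY_sum:
  assumes "finite F" "F \<subseteq> arcs E" "e \<in> arcs E"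
  shows "(\<Sum>f\<in>F. X f * Y f) * X e = (if e \<in> F then X e else 0)"
    and "Y e * (\<Sum>f\<in>F. X f * Y f) = (if e \<in> F then Y e else 0)"
proof -
  have "(\<Sum>f\<in>F. X f * Y f) * X e = (\<Sum>f\<in>F. X f * (Y f * X e))"
    by (simp add: sum_distrib_right mult.assoc)
  also have "\<dots> = (\<Sum>f\<in>F. if f = e then X e else 0)"
    using assms by (intro sum.cong) (auto simp: YX YX_orth XV)
  finally show "(\<Sum>f\<in>F. X f * Y f) * X e = (if e \<in> F then X e else 0)" using assms by simp
  have "Y e * (\<Sum>f\<in>F. X f * Y f) = (\<Sum>f\<in>F. (Y e * X f) * Y f)"
    by (simp add: sum_distrib_left mult.assoc)
  also have "\<dots> = (\<Sum>f\<in>F. if f = e then Y e else 0)"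
    using assms by (intro sum.cong) (auto simp: YX YX_orth VY)
  finally show "Y e * (\<Sum>f\<in>F. X f * Y f) = (if e \<in> F then Y e else 0)" using assms by simp
qed

lemma cut_mult:
  assumes "finite F" "F \<subseteq> out_arcs E v" "e \<in> out_arcs E v"
  shows "cut v F * X e = (if e \<in> F then 0 else X e)" "Y e * cut v F = (if e \<in> F then 0 else Y e)"
proof -
  have F: "F \<subseteq> arcs E" "e \<in> arcs E" "tail E e = v" using assms by auto
  show "cut v F * X e = (if e \<in> F then 0 else X e)" "Y e * cut v F = (if e \<in> F then 0 else Y e)"
    using XY_sum[OF assms(1) F(1,2)] VX[OF F(2)] YV[OF F(2)] F(3)
    unfolding cut_def by (simp_all add: left_diff_distrib right_diff_distrib)
qed

lemma cut_V:
  assumes "finite F" "F \<subseteq> out_arcs E v" "v \<in> verts E"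
  shows "V v * cut v F = cut v F" "cut v F * V v = cut v F" "cut v F * cut v F = cut v F"
proof -
  have "V v * (X e * Y e) = X e * Y e" "(X e * Y e) * V v = X e * Y e" if "e \<in> F" for e
    using that assms VX[of e] YV[of e] by (auto simp: mult.assoc[symmetric]) (auto simp: mult.assoc)
  then show 1: "V v * cut v F = cut v F" "cut v F * V v = cut v F"
    unfolding cut_def using V_idem[OF assms(3)]
    by (simp_all add: right_diff_distrib left_diff_distrib sum_distrib_left sum_distrib_right)
  have "cut v F * (X e * Y e) = 0" if "e \<in> F" for e
    using that assms cut_mult(1)[of F v e] by (auto simp: mult.assoc[symmetric])
  then have "cut v F * (\<Sum>e\<in>F. X e * Y e) = 0" by (simp add: sum_distrib_left)
  then show "cut v F * cut v F = cut v F"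
    using 1 unfolding cut_def[of v F] by (simp add: right_diff_distrib)
qed

lemma cut_diag: "F \<subseteq> arcs E \<Longrightarrow> v \<in> verts E \<Longrightarrow> cut v F \<in> diag"
  unfolding cut_def by (intro diag_diff diag_sum V_diag XY_diag) auto

lemma cut_C: "finite F \<Longrightarrow> F \<subseteq> out_arcs E v \<Longrightarrow> v \<in> verts E \<Longrightarrow> cut v F \<in> C"
  using cut_V(1) V_C idl_rmult[OF idl_C] by metis

lemma out_arcs_arcs: "e \<in> out_arcs E v \<Longrightarrow> e \<in> arcs E"
  by simp

lemma gs_props:
  assumes "v \<in> gs J"
  shows "v \<in> verts E" "finite (brk (gv J) v)" "brk (gv J) v \<subseteq> out_arcs E v"
  using assms unfolding gs_def breaking_verts_def brk_def by auto

lemma gr_gens: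
  "V ` gv J \<union> (\<lambda>v. cut v (brk (gv J) v)) ` gs J \<subseteq> C"
  "V ` gv J \<union> (\<lambda>v. cut v (brk (gv J) v)) ` gs J \<subseteq> diag"
  "g \<in> V ` gv J \<union> (\<lambda>v. cut v (brk (gv J) v)) ` gs J \<Longrightarrow> g * g = g"
proof -
  show "V ` gv J \<union> (\<lambda>v. cut v (brk (gv J) v)) ` gs J \<subseteq> C"
    using V_C cut_C gs_props unfolding gv_def by auto
  have "cut v (brk (gv J) v) \<in> diag" if "v \<in> gs J" for v
    using gs_props[OF that] out_arcs_arcs by (intro cut_diag) auto
  then show "V ` gv J \<union> (\<lambda>v. cut v (brk (gv J) v)) ` gs J \<subseteq> diag"
    using V_diag unfolding gv_def by auto
  show "g \<in> V ` gv J \<union> (\<lambda>v. cut v (brk (gv J) v)) ` gs J \<Longrightarrow> g * g = g"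
    using V_idem cut_V(3) gs_props unfolding gv_def by auto
qed

lemma idl_gr: "idl C (gr J)"
  unfolding gr_def by (rule idl_gen[OF gr_gens(1)])

lemma gr_graded: "graded (gr J)"
  unfolding gr_def by (rule diag_gen_graded[OF gr_gens])

lemma gr_locally_unital: "locally_unital (gr J)"
  unfolding gr_def by (rule diag_gen_locally_unital[OF gr_gens])

lemma gr_subset: "idl C J \<Longrightarrow> gr J \<subseteq> J"
  unfolding gr_def by (rule gen_least) (auto simp: gv_def gs_def)

lemma V_gr: "v \<in> gv J \<Longrightarrow> V v \<in> gr J"
  unfolding gr_def by (rule subsetD[OF gen_superset]) blast

lemma cut_gr: "v \<in> gs J \<Longrightarrow> cut v (brk (gv J) v) \<in> gr J"
  unfolding gr_def by (rule subsetD[OF gen_superset]) blast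

text \<open>H is hereditary because r(e) = e* s(e) e.\<close>

lemma gv_head:
  assumes "idl C J" "e \<in> arcs E" "tail E e \<in> gv J"
  shows "head E e \<in> gv J"
proof -
  have "V (head E e) = Y e * V (tail E e) * X e" using assms by (simp add: YV YX)
  moreover have "V (tail E e) \<in> J" using assms unfolding gv_def by blast
  ultimately have "V (head E e) \<in> J" using idl_rmult[OF assms(1) idl_lmult[OF assms(1)]] by simp
  then show ?thesis using assms unfolding gv_def by simp
qed

lemma gv_awalk: "idl C J \<Longrightarrow> awalk u p w \<Longrightarrow> u \<in> gv J \<Longrightarrow> w \<in> gv J"
  by (induction p arbitrary: u) (auto simp: awalk_Cons_iff awalk_Nil_iff gv_head)

lemma XY_gr:
  assumes "e \<in> arcs E" "head E e \<in> gv J"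
  shows "X e \<in> gr J" "Y e \<in> gr J"
  using assms XV[of e] VY[of e] V_gr[of "head E e" J] idl_lmult[OF idl_gr] idl_rmult[OF idl_gr] by metis+

text \<open>Since f* e = 0, left multiplication by w - f f* fixes e; so e and then e* e = r(e) lie
  in J. This is how edges that leave an exitless cycle are seen to end in H.\<close>

lemma mem_out_arcs_head:
  assumes "idl C J" "e \<in> out_arcs E w" "V w - X f * Y f \<in> J" "f \<in> out_arcs E w" "e \<noteq> f"
  shows "head E e \<in> gv J"
proof -
  have "X e = (V w - X f * Y f) * X e"
    using assms VX[of e] YX_orth[of f e] by (auto simp: left_diff_distrib mult.assoc)
  then have "Y e * X e \<in> J" using assms idl_lmult idl_rmult by metis
  then show ?thesis using assms YX unfolding gv_def by auto
qed

subsection \<open>Elements with bounded ghost length\<close>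

definition Real_span :: "'v \<Rightarrow> 'v \<Rightarrow> nat \<Rightarrow> 'a set" where
  "Real_span v w n = aspan {sc k (pe v p) |k p. awalk v p w \<and> length p \<le> n}"

definition Reals :: "'v \<Rightarrow> 'v \<Rightarrow> 'a set" where
  "Reals v w = (\<Union>n. Real_span v w n)"

text \<open>Elements of the corner between v and w whose ghost paths have length at most q, sorted
  by the last ghost edge. Multiplying by e on the right recovers the coefficient of e*, up to a term
  without ghost edges, and so lowers q by one.\<close>

primrec Ghosts :: "'v \<Rightarrow> nat \<Rightarrow> 'v \<Rightarrow> 'a set" where
  "Ghosts v 0 w = Reals v w"
| "Ghosts v (Suc q) w = {a + (\<Sum>e\<in>F. b e * Y e) |a F b.
     a \<in> Reals v w \<and> finite F \<and> F \<subseteq> out_arcs E w \<and> (\<forall>e\<in>F. b e \<in> Ghosts v q (head E e))}"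

lemma Real_span_mono: "m \<le> n \<Longrightarrow> Real_span v w m \<subseteq> Real_span v w n"
  unfolding Real_span_def
  by (intro subsetI, erule aspan_image[where f = "\<lambda>x. x"]) (force intro: aspan_base)+

lemma Reals_add: "a \<in> Reals v w \<Longrightarrow> b \<in> Reals v w \<Longrightarrow> a + b \<in> Reals v w"
proof -
  assume "a \<in> Reals v w" "b \<in> Reals v w"
  then obtain m n where "a \<in> Real_span v w m" "b \<in> Real_span v w n" unfolding Reals_def by blast
  then have "a \<in> Real_span v w (max m n)" "b \<in> Real_span v w (max m n)"
    using Real_span_mono by (metis max.cobounded1 max.cobounded2 subsetD)+
  then show ?thesis unfolding Reals_def Real_span_def using aspan_plus by blast
qed

lemma Reals_zero: "0 \<in> Reals v w"
  unfolding Reals_def Real_span_def using aspan_zero by blast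

lemma Reals_base: "awalk v p w \<Longrightarrow> sc k (pe v p) \<in> Reals v w"
  unfolding Reals_def Real_span_def by (auto intro!: aspan_base)

lemma Reals_X:
  assumes "a \<in> Reals v (tail E e)" "e \<in> arcs E"
  shows "a * X e \<in> Reals v (head E e)"
proof -
  obtain n where "a \<in> Real_span v (tail E e) n" using assms unfolding Reals_def by blast
  then have "a * X e \<in> Real_span v (head E e) (Suc n)"
    unfolding Real_span_def
  proof (rule aspan_image[where f = "\<lambda>a. a * X e"])
    fix b assume "b \<in> {sc k (pe v p) |k p. awalk v p (tail E e) \<and> length p \<le> n}"
    then obtain k p where b: "b = sc k (pe v p)" "awalk v p (tail E e)" "length p \<le> n" by blast
    have "b * X e = sc k (pe v (p @ [e]))"
      using b(1) pe_append[OF b(2) awalk_arc[OF assms(2)]] XV[OF assms(2)] by (simp add: sc_mult_left)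
    moreover have "awalk v (p @ [e]) (head E e)" using b(2) awalk_arc[OF assms(2)] by auto
    ultimately show "b * X e \<in> aspan {sc k (pe v p) |k p. awalk v p (head E e) \<and> length p \<le> Suc n}"
      using b(3) by (intro aspan_base CollectI exI[of _ k] exI[of _ "p @ [e]"]) auto
  qed (auto simp: distrib_right)
  then show ?thesis unfolding Reals_def by blast
qed

lemma Real_span_normal_form:
  assumes "a \<in> Real_span v w n"
  obtains A k where "finite A" "\<And>p. p \<in> A \<Longrightarrow> awalk v p w \<and> length p \<le> n \<and> k p \<noteq> 0"
    "a = (\<Sum>p\<in>A. sc (k p) (pe v p))"
proof -
  have "\<exists>A k. finite A \<and> (\<forall>p\<in>A. awalk v p w \<and> length p \<le> n) \<and> a = (\<Sum>p\<in>A. sc (k p) (pe v p))"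
    using assms unfolding Real_span_def
  proof induction
    case (aspan_add b x)
    then obtain A k where A: "finite A" "\<forall>p\<in>A. awalk v p w \<and> length p \<le> n" "x = (\<Sum>p\<in>A. sc (k p) (pe v p))"
      by blast
    obtain l q where b: "b = sc l (pe v q)" "awalk v q w" "length q \<le> n" using aspan_add by blast
    \<comment> \<open>The path q may already be in A, in which case the two coefficients are added;
      vanishing ones are removed at the end.\<close>
    define k' where "k' = (\<lambda>p. (if p \<in> A then k p else 0) + (if p = q then l else 0))"
    have "(\<Sum>p\<in>insert q A. sc (k' p) (pe v p)) =
        (\<Sum>p\<in>insert q A. if p \<in> A then sc (k p) (pe v p) else 0) + (\<Sum>p\<in>insert q A. if p = q then sc l (pe v q) else 0)"
      unfolding k'_def by (auto simp: sc_add_left sum.distrib[symmetric] intro!: sum.cong)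
    also have "\<dots> = x + b"
    proof -
      have "(\<Sum>p\<in>insert q A. if p \<in> A then sc (k p) (pe v p) else 0) = x"
        unfolding A(3) using A(1) by (intro sum.mono_neutral_cong_right) auto
      then show ?thesis using A(1) b by simp
    qed
    finally have "b + x = (\<Sum>p\<in>insert q A. sc (k' p) (pe v p))" by (simp add: add.commute)
    then show ?case using A b by (intro exI[of _ "insert q A"] exI[of _ k']) auto
  qed (rule exI[of _ "{}"], simp)
  then obtain A k where A: "finite A" "\<forall>p\<in>A. awalk v p w \<and> length p \<le> n" "a = (\<Sum>p\<in>A. sc (k p) (pe v p))"
    by blast
  have "a = (\<Sum>p\<in>{p\<in>A. k p \<noteq> 0}. sc (k p) (pe v p))"
    unfolding A(3) using A(1) by (intro sum.mono_neutral_right) auto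
  then show thesis using A(1,2) by (intro that[of "{p\<in>A. k p \<noteq> 0}" k]) auto
qed

lemma Reals_normal_form:
  assumes "a \<in> Reals v w"
  obtains A k where "finite A" "\<And>p. p \<in> A \<Longrightarrow> awalk v p w \<and> k p \<noteq> 0" "a = (\<Sum>p\<in>A. sc (k p) (pe v p))"
proof -
  obtain n where "a \<in> Real_span v w n" using assms unfolding Reals_def by blast
  then show thesis by (rule Real_span_normal_form) (rule that, auto)
qed

lemma Ghosts_zero: "0 \<in> Ghosts v q w"
  using Reals_zero by (induction q) (auto intro!: exI[of _ 0] exI[of _ "{}"])

lemma Reals_Ghosts: "Reals v w \<subseteq> Ghosts v q w"
  by (cases q) (auto intro!: exI[of _ "{}"])

lemma Ghosts_add: "a \<in> Ghosts v q w \<Longrightarrow> b \<in> Ghosts v q w \<Longrightarrow> a + b \<in> Ghosts v q w"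
proof (induction q arbitrary: w a b)
  case (Suc q)
  obtain a' F c where a: "a = a' + (\<Sum>e\<in>F. c e * Y e)" "a' \<in> Reals v w" "finite F" "F \<subseteq> out_arcs E w"
    "\<forall>e\<in>F. c e \<in> Ghosts v q (head E e)" using Suc.prems by auto
  obtain b' G d where b: "b = b' + (\<Sum>e\<in>G. d e * Y e)" "b' \<in> Reals v w" "finite G" "G \<subseteq> out_arcs E w"
    "\<forall>e\<in>G. d e \<in> Ghosts v q (head E e)" using Suc.prems by auto
  define h where "h = (\<lambda>e. (if e \<in> F then c e else 0) + (if e \<in> G then d e else 0))"
  have "(\<Sum>e\<in>F \<union> G. h e * Y e) =
      (\<Sum>e\<in>F \<union> G. if e \<in> F then c e * Y e else 0) + (\<Sum>e\<in>F \<union> G. if e \<in> G then d e * Y e else 0)"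
    unfolding h_def sum.distrib[symmetric] by (rule sum.cong) (auto simp: distrib_right)
  also have "(\<Sum>e\<in>F \<union> G. if e \<in> F then c e * Y e else 0) = (\<Sum>e\<in>F. c e * Y e)"
    using a(3) b(3) by (intro sum.mono_neutral_cong_right) auto
  also have "(\<Sum>e\<in>F \<union> G. if e \<in> G then d e * Y e else 0) = (\<Sum>e\<in>G. d e * Y e)"
    using a(3) b(3) by (intro sum.mono_neutral_cong_right) auto
  finally have "a + b = (a' + b') + (\<Sum>e\<in>F \<union> G. h e * Y e)"
    using a(1) b(1) by (simp add: algebra_simps)
  moreover have "\<forall>e\<in>F \<union> G. h e \<in> Ghosts v q (head E e)"
    unfolding h_def using a(5) b(5) Ghosts_zero Suc.IH by auto
  moreover have "a' + b' \<in> Reals v w" using Reals_add a b by blast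
  moreover have "finite (F \<union> G)" "F \<union> G \<subseteq> out_arcs E w" using a b by auto
  ultimately show ?case unfolding Ghosts.simps by blast
qed (auto intro: Reals_add)

lemma Ghosts_mono: "Ghosts v q w \<subseteq> Ghosts v (Suc q) w"
proof (induction q arbitrary: w)
  case 0
  then show ?case using Reals_Ghosts[of v w "Suc 0"] by (simp only: Ghosts.simps(1))
next
  case (Suc q)
  show ?case
  proof
    fix x assume "x \<in> Ghosts v (Suc q) w"
    then obtain a F b where "x = a + (\<Sum>e\<in>F. b e * Y e)" "a \<in> Reals v w" "finite F" "F \<subseteq> out_arcs E w"
      "\<forall>e\<in>F. b e \<in> Ghosts v q (head E e)" by auto
    moreover from this have "\<forall>e\<in>F. b e \<in> Ghosts v (Suc q) (head E e)" using Suc.IH by blast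
    ultimately show "x \<in> Ghosts v (Suc (Suc q)) w"
      unfolding Ghosts.simps(2)[of v "Suc q" w] by blast
  qed
qed

lemma Ghosts_mono': "m \<le> n \<Longrightarrow> Ghosts v m w \<subseteq> Ghosts v n w"
  by (rule lift_Suc_mono_le[of "\<lambda>q. Ghosts v q w"]) (use Ghosts_mono in auto)

lemma Ghosts_base:
  "awalk v p z \<Longrightarrow> awalk w r z \<Longrightarrow> sc k (pe v p * pg w r) \<in> Ghosts v (length r) w"
proof (induction r arbitrary: w)
  case Nil
  then have "w = z" by (auto simp: awalk_Nil_iff)
  then show ?case using Nil pe_right[OF Nil(1)] Reals_base by simp
next
  case (Cons e r)
  then have e: "e \<in> out_arcs E w" "awalk (head E e) r z" by (auto simp: awalk_Cons_iff)
  have "sc k (pe v p * pg w (e # r)) = 0 + (\<Sum>f\<in>{e}. sc k (pe v p * pg (head E e) r) * Y f)"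
    by (simp add: sc_mult_left mult.assoc)
  moreover have "sc k (pe v p * pg (head E e) r) \<in> Ghosts v (length r) (head E e)"
    using Cons e by blast
  ultimately show ?case
    using e Reals_zero unfolding length_Cons Ghosts.simps
    by (intro CollectI exI[of _ 0] exI[of _ "{e}"] exI[of _ "\<lambda>_. sc k (pe v p * pg (head E e) r)"]) auto
qed

lemma Ghosts_exhaust:
  assumes "x \<in> C" "v \<in> verts E" "w \<in> verts E"
  obtains q where "V v * x * V w \<in> Ghosts v q w"
proof -
  have "x \<in> aspan {sc k m |k m. m \<in> mons}" using assms C_mons unfolding mon_span_def by blast
  then have "\<exists>q. V v * x * V w \<in> Ghosts v q w"
  proof induction
    case aspan_zero
    then show ?case using Ghosts_zero by simp
  next
    case (aspan_add b x)
    then obtain q where q: "V v * x * V w \<in> Ghosts v q w" by blast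
    obtain k u p u' p' z where b: "b = sc k (pe u p * pg u' p')" "awalk u p z" "awalk u' p' z"
      using aspan_add unfolding mons_def by blast
    have *: "V v * b * V w = sc k ((V v * V u) * pe u p * pg u' p' * (V u' * V w))"
      using pe_left[OF b(2)] pg_right[OF b(3)] by (simp add: b(1) sc_mult_left sc_mult_right mult.assoc) (metis mult.assoc)
    have "\<exists>q'. V v * b * V w \<in> Ghosts v q' w"
    proof (cases "u = v \<and> u' = w")
      case True
      then have "V v * b * V w = sc k (pe v p * pg w p')"
        using * V_idem[OF assms(2)] V_idem[OF assms(3)] pe_left[OF b(2)] pg_right[OF b(3)]
        by (simp add: mult.assoc) (metis mult.assoc)
      then show ?thesis using Ghosts_base b True by metis
    next
      case False
      then have "V v * b * V w = 0" unfolding * using V_orth[of v u] V_orth[of u' w] assms awalk_verts_ends b(2,3) by auto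
      then show ?thesis using Ghosts_zero by auto
    qed
    then obtain q' where "V v * b * V w \<in> Ghosts v q' w" by blast
    then have "V v * b * V w + V v * x * V w \<in> Ghosts v (max q q') w"
      using q Ghosts_mono' by (intro Ghosts_add) (meson max.cobounded1 max.cobounded2 subsetD)+
    then show ?case by (auto simp: algebra_simps)
  qed
  then show thesis using that by blast
qed

end

context leavitt
begin

subsection \<open>Polynomials in a closed path\<close>

definition base :: "'e list \<Rightarrow> 'v" where
  "base c = tail E (hd c)"

definition closed_path :: "'e list \<Rightarrow> bool" where
  "closed_path c \<longleftrightarrow> c \<noteq> [] \<and> awalk (base c) c (base c)"

definition power_path :: "'e list \<Rightarrow> nat \<Rightarrow> 'e list" where
  "power_path c n = concat (replicate n c)"

text \<open>Horner form, which suits induction over \<open>pCons\<close>. The constant term stands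
  at the base vertex, the unit of the corner.\<close>

definition pc :: "'e list \<Rightarrow> 'k poly \<Rightarrow> 'a" where
  "pc c p = fold_coeffs (\<lambda>k x. sc k (V (base c)) + pe (base c) c * x) p 0"

lemma closed_path_awalk: "c \<noteq> [] \<Longrightarrow> awalk v c v \<Longrightarrow> closed_path c \<and> base c = v"
  unfolding closed_path_def base_def by (cases c) (auto simp: awalk_Cons_iff)

lemma closed_pathD: "closed_path c \<Longrightarrow> awalk (base c) c (base c)" "closed_path c \<Longrightarrow> base c \<in> verts E"
  "closed_path c \<Longrightarrow> c \<noteq> []"
  unfolding closed_path_def using awalk_verts_ends by auto

lemma power_path_simps [simp]:
  "power_path c 0 = []" "power_path c (Suc n) = c @ power_path c n"
  "length (power_path c n) = n * length c"
  unfolding power_path_def by (auto simp: length_concat sum_list_replicate)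

lemma nth_power_path: "j < n * length c \<Longrightarrow> power_path c n ! j = c ! (j mod length c)"
proof (induction n arbitrary: j)
  case (Suc n)
  show ?case
  proof (cases "j < length c")
    case False
    then have "j - length c < n * length c" "(j - length c) mod length c = j mod length c"
      using Suc.prems by (auto simp: le_mod_geq)
    then show ?thesis using False Suc.IH by (simp add: nth_append)
  qed (simp add: nth_append)
qed simp

lemma awalk_power_path: "closed_path c \<Longrightarrow> awalk (base c) (power_path c n) (base c)"
proof (induction n)
  case (Suc n)
  then show ?case using awalk_appendI[OF closed_pathD(1)] by simp
qed (simp add: awalk_Nil_iff closed_pathD)

lemma pc_0 [simp]: "pc c 0 = 0"
  unfolding pc_def by simp

lemma pc_pCons: "pc c (pCons k p) = sc k (V (base c)) + pe (base c) c * pc c p"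
proof (cases "k = 0 \<and> p = 0")
  case False
  then show ?thesis unfolding pc_def by (auto simp: fold_coeffs_def)
qed simp

lemma pc_add: "pc c (p + q) = pc c p + pc c q"
proof (induction p arbitrary: q)
  case (pCons k p)
  then show ?case by (cases q) (simp add: pc_pCons algebra_simps sc_add_left)
qed simp

lemma pc_smult: "pc c (smult k p) = sc k (pc c p)"
  by (induction p) (simp_all add: pc_pCons sc_add sc_sc sc_mult_right)

lemma pc_diff: "pc c (p - q) = pc c p - pc c q"
  using pc_add[of c "p - q" q] by simp

lemma pc_sum: "pc c (sum f A) = (\<Sum>i\<in>A. pc c (f i))"
  by (induction A rule: infinite_finite_induct) (auto simp: pc_add)

lemma V_pc: "closed_path c \<Longrightarrow> V (base c) * pc c p = pc c p"
proof (induction p)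
  case (pCons k p)
  then show ?case
    using V_idem[OF closed_pathD(2)] pe_left[OF closed_pathD(1)]
    by (simp add: pc_pCons distrib_left sc_mult_right mult.assoc[symmetric])
qed simp

lemma pc_mult: "closed_path c \<Longrightarrow> pc c (p * q) = pc c p * pc c q"
proof (induction p)
  case (pCons k p)
  then show ?case
    using V_pc[of c q]
    by (simp add: pc_pCons pc_add pc_smult distrib_right sc_mult_left mult.assoc mult_pCons_left)
qed simp

lemma pc_monom: "closed_path c \<Longrightarrow> pc c (monom k n) = sc k (pe (base c) (power_path c n))"
proof (induction n)
  case 0
  then show ?case by (simp add: monom_0 pc_pCons)
next
  case (Suc n)
  then show ?case
    by (simp add: monom_Suc pc_pCons sc_mult_right pe_append[OF closed_pathD(1) awalk_power_path])
qed

lemma pc_const: "pc c [:k:] = sc k (V (base c))"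
  by (simp add: pc_pCons)

lemma pc_commute: "closed_path c \<Longrightarrow> pc c p * pc c q = pc c q * pc c p"
  by (metis pc_mult mult.commute)

lemma pc_V: "closed_path c \<Longrightarrow> pc c p * V (base c) = pc c p"
  using pc_commute[of c p 1] V_pc[of c p] pc_const[of c 1] by (simp add: sc_one one_pCons)

lemma pc_power: "closed_path c \<Longrightarrow> pe (base c) (power_path c n) = pc c (monom 1 n)"
  by (simp add: pc_monom sc_one)

lemma pc_altdef:
  assumes "closed_path c" "degree p \<le> n"
  shows "pc c p = (\<Sum>i\<le>n. sc (coeff p i) (pe (base c) (power_path c i)))"
proof -
  have "pc c p = pc c (\<Sum>i\<le>n. monom (coeff p i) i)"
    using poly_as_sum_of_monoms'[OF assms(2)] by simp
  then show ?thesis by (simp add: pc_sum pc_monom[OF assms(1)])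
qed

lemma pc_C: "closed_path c \<Longrightarrow> pc c p \<in> C"
  using V_pc V_C closed_pathD(2) idl_rmult[OF idl_C] by metis

subsection \<open>Exitless cycles\<close>

text \<open>A cycle is exitless modulo the graded ideal \<open>I(H,S)\<close> iff it is a cycle without exits of
  \<open>E\<setminus>(H,S)\<close>; this form only mentions the ideal and is monotone in it.\<close>

definition exitless :: "'a set \<Rightarrow> 'e list \<Rightarrow> bool" where
  "exitless J c \<longleftrightarrow> closed_path c \<and> distinct (map (tail E) c) \<and> V (base c) \<notin> J \<and>
     (\<forall>e\<in>set c. V (tail E e) - X e * Y e \<in> J)"

lemma exitless_mono: "exitless J c \<Longrightarrow> J \<subseteq> J' \<Longrightarrow> V (base c) \<notin> J' \<Longrightarrow> exitless J' c"
  unfolding exitless_def by blast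

lemma sc_cancel: "idl C J \<Longrightarrow> k \<noteq> 0 \<Longrightarrow> sc k x \<in> J \<Longrightarrow> x \<in> J"
  using idl_sc sc_inverse by metis

text \<open>Multiply from the left by z' p1* for a shortest path p1 in A. A term p survives only if
  p = p1 r; for p other than p1 the path r starts with an edge at w, which z' annihilates. What is
  left is a non-zero multiple of z' w z.\<close>

lemma Reals_kill:
  assumes A: "finite A" "A \<noteq> {}" "\<And>p. p \<in> A \<Longrightarrow> awalk v p w \<and> k p \<noteq> 0" and N: "idl C N"
    and a: "(\<Sum>p\<in>A. sc (k p) (pe v p)) * z \<in> N"
    and kill: "\<And>p e. p \<in> A \<Longrightarrow> e \<in> set p \<Longrightarrow> tail E e = w \<Longrightarrow> z' * X e = 0"
  shows "z' * V w * z \<in> N"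
proof -
  obtain p1 where p1: "p1 \<in> A" "\<And>p. p \<in> A \<Longrightarrow> length p1 \<le> length p"
    using ex_has_least_nat[of "\<lambda>p. p \<in> A" _ length] A(2) by blast
  have w1: "awalk v p1 w" using A p1 by blast
  have 0: "z' * (pg v p1 * pe v p) = 0" if p: "p \<in> A" "p \<noteq> p1" for p
  proof -
    have wp: "awalk v p w" using A p by blast
    from w1 wp show ?thesis
    proof (cases rule: pg_pe_cases)
      case (left r)
      then obtain e r' where r: "r = e # r'" using p by (cases r) auto
      then have "tail E e = w" "e \<in> set p" using left by (auto simp: awalk_Cons_iff)
      then show ?thesis using kill[OF p(1)] left r by (simp add: mult.assoc[symmetric])
    next
      case (right r)
      then show ?thesis using p1(2)[OF p(1)] by simp
    qed simp
  qed
  have "z' * pg v p1 * (\<Sum>p\<in>A. sc (k p) (pe v p)) = (\<Sum>p\<in>A. sc (k p) (z' * (pg v p1 * pe v p)))"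
    by (simp add: sum_distrib_left sc_mult_right mult.assoc)
  also have "\<dots> = (\<Sum>p\<in>A. if p = p1 then sc (k p1) (z' * V w) else 0)"
    using 0 pg_pe[OF w1] by (intro sum.cong) auto
  also have "\<dots> = sc (k p1) (z' * V w)" using A(1) p1(1) by simp
  finally have "z' * pg v p1 * ((\<Sum>p\<in>A. sc (k p) (pe v p)) * z) = sc (k p1) (z' * V w * z)"
    by (metis mult.assoc sc_mult_left)
  then have "sc (k p1) (z' * V w * z) \<in> N" using idl_lmult[OF N a] by metis
  then show ?thesis using sc_cancel[OF N] A(3)[OF p1(1)] by blast
qed

lemma Reals_V: "a \<in> Reals v w \<Longrightarrow> V v * a = a" "a \<in> Reals v w \<Longrightarrow> a * V w = a"
proof -
  assume a: "a \<in> Reals v w"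
  obtain A k where "finite A" "\<And>p. p \<in> A \<Longrightarrow> awalk v p w \<and> k p \<noteq> 0" "a = (\<Sum>p\<in>A. sc (k p) (pe v p))"
    using Reals_normal_form[OF a] by blast
  then show "V v * a = a" "a * V w = a"
    by (auto simp: sum_distrib_left sum_distrib_right sc_mult_left sc_mult_right
        pe_left[of v _ w] pe_right[of v _ w] intro!: sum.cong)
qed

lemma Ghosts_V: "a \<in> Ghosts v q w \<Longrightarrow> a * V w = a"
proof (cases q)
  case (Suc q')
  assume "a \<in> Ghosts v q w"
  then obtain a' F b where a: "a = a' + (\<Sum>e\<in>F. b e * Y e)" "a' \<in> Reals v w" "F \<subseteq> out_arcs E w"
    unfolding Suc by auto
  have "b e * Y e * V w = b e * Y e" if "e \<in> F" for e
    using that a(3) YV[of e] by (auto simp: mult.assoc)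
  then show ?thesis using Reals_V(2)[OF a(2)] by (simp add: a(1) distrib_right sum_distrib_right)
qed (use Reals_V in auto)

text \<open>Right multiplication by the edges e at w lowers the ghost length, so a e is in J for all
  of them. The main cases then look for a finite set G of such edges for which the product of a and
  \<open>cut w G\<close> is in J.\<close>

lemma Ghosts_step:
  assumes N: "idl C N" and J: "idl C J" and grJ: "gr N \<subseteq> J"
    and IH: "\<And>w. w \<in> verts E \<Longrightarrow> Ghosts v q w \<inter> N \<subseteq> J"
    and a: "a \<in> Ghosts v (Suc q) w" "a \<in> N" and w: "w \<in> verts E"
  shows "a \<in> J"
proof -
  obtain a' F b where a': "a = a' + (\<Sum>e\<in>F. b e * Y e)" "a' \<in> Reals v w" "finite F" "F \<subseteq> out_arcs E w"
    "\<forall>e\<in>F. b e \<in> Ghosts v q (head E e)" using a by auto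
  have aV: "a * V w = a" using Ghosts_V a by blast
  have aX: "a * X e \<in> J" if e: "e \<in> out_arcs E w" for e
  proof -
    have "(\<Sum>f\<in>F. b f * Y f) * X e = (\<Sum>f\<in>F. b f * (Y f * X e))" by (simp add: sum_distrib_right mult.assoc)
    also have "\<dots> = (\<Sum>f\<in>F. if f = e then b e * V (head E e) else 0)"
      using e a'(4) by (intro sum.cong) (auto simp: YX YX_orth)
    also have "\<dots> = (if e \<in> F then b e else 0)"
      using a'(3,5) Ghosts_V by auto
    finally have "a * X e = a' * X e + (if e \<in> F then b e else 0)" by (simp add: a'(1) distrib_right)
    moreover have "a' * X e \<in> Ghosts v q (head E e)"
      using Reals_X[of a' v e] a'(2) e Reals_Ghosts by auto
    ultimately have "a * X e \<in> Ghosts v q (head E e)"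
      using a'(5) Ghosts_zero Ghosts_add by simp
    then show ?thesis using IH[of "head E e"] e idl_rmult[OF N a(2)] by auto
  qed
  have cutJ: "a \<in> J" if G: "finite G" "G \<subseteq> out_arcs E w" "a * cut w G \<in> J" for G
  proof -
    have "a = a * cut w G + (\<Sum>e\<in>G. a * X e * Y e)"
      using aV by (simp add: cut_def right_diff_distrib sum_distrib_left mult.assoc)
    moreover have "(\<Sum>e\<in>G. a * X e * Y e) \<in> J"
    proof (rule idl_sum[OF J])
      fix e assume "e \<in> G"
      then show "a * X e * Y e \<in> J" using idl_rmult[OF J aX] G(2) by blast
    qed
    ultimately show ?thesis using idl_add[OF J G(3)] by metis
  qed
  show ?thesis
  proof (cases "w \<in> gv N")
    case True
    then show ?thesis using aV V_gr grJ idl_lmult[OF J] by (metis subsetD)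
  next
    case wN: False
    then have VwN: "V w \<notin> N" using w unfolding gv_def by blast
    show ?thesis
    proof (cases "finite (out_arcs E w)")
      case fin: True
      show ?thesis
      proof (cases "out_arcs E w = {}")
        case True
        then have "a \<in> Reals v w" using a' by auto
        then have "a \<in> Ghosts v q w" using Reals_Ghosts by blast
        then show ?thesis using IH[OF w] a(2) by blast
      next
        case False
        then have "cut w (out_arcs E w) = 0" using CK2[of w] fin w unfolding cut_def regular_vertex_def by simp
        then show ?thesis using cutJ[OF fin] idl_zero[OF J] by simp
      qed
    next
      case inf: False
      let ?B = "brk (gv N) w"
      obtain A k where A: "finite A" "\<And>p. p \<in> A \<Longrightarrow> awalk v p w \<and> k p \<noteq> 0" "a' = (\<Sum>p\<in>A. sc (k p) (pe v p))"
        using Reals_normal_form[OF a'(2)] by blast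
      \<comment> \<open>The rest of p leads from r(e) to w, which is outside H; so by heredity e
        ends outside H.\<close>
      have edges: "e \<in> ?B" if "p \<in> A" "e \<in> set p" "tail E e = w" for p e
      proof -
        have p: "awalk v p w" using A that by blast
        obtain p1 p2 where "p = p1 @ e # p2" using split_list[OF \<open>e \<in> set p\<close>] by blast
        then have e: "e \<in> arcs E" "awalk (head E e) p2 w" using p by (auto simp: awalk_append_iff awalk_Cons_iff)
        then show ?thesis unfolding brk_def using gv_awalk[OF N e(2)] wN that by auto
      qed
      have cutF: "a * cut w G = a' * cut w G" if "F \<subseteq> G" "finite G" "G \<subseteq> out_arcs E w" for G
      proof -
        have "b e * Y e * cut w G = 0" if "e \<in> F" for e
        proof -
          have "e \<in> G" "e \<in> out_arcs E w" using that \<open>F \<subseteq> G\<close> \<open>G \<subseteq> out_arcs E w\<close> by blast+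
          then have "Y e * cut w G = 0"
            using cut_mult(2)[OF \<open>finite G\<close> \<open>G \<subseteq> out_arcs E w\<close>] by simp
          then show ?thesis by (simp add: mult.assoc)
        qed
        then show ?thesis by (simp add: a'(1) distrib_right sum_distrib_right)
      qed
      \<comment> \<open>The edges of w that end outside H decide: infinitely many allow the choice
        of one that avoids all given paths, none puts the ghost part into \<open>gr N\<close>, and
        finitely many make w a breaking vertex.\<close>
      consider "infinite ?B" | "?B = {}" | "finite ?B" "?B \<noteq> {}" by blast
      then show ?thesis
      proof cases
        case 1
        have "A = {}"
        proof (rule ccontr)
          assume "A \<noteq> {}"
          \<comment> \<open>The edge f is chosen off F and off all paths of A. Then f* annihilates
            every edge of these paths that starts at w, and \<open>Reals_kill\<close> would put r(f)
            into N.\<close>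
          have "infinite (?B - (F \<union> (\<Union>p\<in>A. set p)))" using 1 a'(3) A(1) by simp
          then obtain f where f: "f \<in> ?B" "f \<notin> F" "f \<notin> (\<Union>p\<in>A. set p)"
            using infinite_imp_nonempty by blast
          have f': "f \<in> arcs E" "tail E f = w" "f \<in> out_arcs E w" using f unfolding brk_def by auto
          have "a * cut w F * X f \<in> N" using a(2) idl_rmult[OF N] by blast
          moreover have "a * cut w F * X f = a' * X f"
            using cutF[OF _ a'(3,4)] cut_mult(1)[OF a'(3,4) f'(3)] f(2) by (simp add: mult.assoc)
          ultimately have "a' * X f \<in> N" by simp
          have kill: "Y f * X e = 0" if "p \<in> A" "e \<in> set p" "tail E e = w" for p e
          proof -
            have "e \<in> arcs E" "e \<noteq> f" using edges[OF that] that f(3) unfolding brk_def by auto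
            then show ?thesis using YX_orth f'(1) by auto
          qed
          have "Y f * V w * X f \<in> N"
            by (rule Reals_kill[OF A(1) \<open>A \<noteq> {}\<close> A(2) N \<open>a' * X f \<in> N\<close>[unfolded A(3)] kill])
          then have "head E f \<in> gv N" using f' YV[of f] YX[of f] unfolding gv_def by auto
          then show False using f unfolding brk_def by blast
        qed
        then have "a * cut w F = 0" using cutF[OF _ a'(3,4)] A(3) by simp
        then show ?thesis using cutJ[OF a'(3,4)] idl_zero[OF J] by simp
      next
        case 2
        have "b e * Y e \<in> gr N" if "e \<in> F" for e
          using that a'(4) 2 XY_gr(2)[of e N] idl_lmult[OF idl_gr] unfolding brk_def by auto
        then have *: "(\<Sum>e\<in>F. b e * Y e) \<in> gr N" by (rule idl_sum[OF idl_gr])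
        then have "a' \<in> N" using idl_add_iff[OF N, of _ a'] gr_subset[OF N] a(2) a'(1) by blast
        then have "a' \<in> J" using IH[OF w] a'(2) Reals_Ghosts by blast
        then show ?thesis using * grJ a'(1) idl_add[OF J] by blast
      next
        case 3
        have B: "?B \<subseteq> out_arcs E w" unfolding brk_def by blast
        have wb: "w \<in> breaking_verts E (gv N)"
          using 3 inf w wN unfolding breaking_verts_def brk_def infinite_emitter_def by auto
        show ?thesis
        proof (cases "w \<in> gs N")
          case True
          then show ?thesis using cutJ[OF 3(1) B] cut_gr grJ idl_lmult[OF J] by blast
        next
          case False
          then have notN: "cut w ?B \<notin> N" using wb unfolding gs_def by blast
          have "b e * Y e * cut w ?B \<in> gr N" if "e \<in> F" for e
          proof (cases "e \<in> ?B")
            case True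
            then have "Y e * cut w ?B = 0" using cut_mult(2)[OF 3(1) B] B by auto
            then show ?thesis using idl_zero[OF idl_gr] by (simp add: mult.assoc)
          next
            case False
            then have "Y e \<in> gr N" using that a'(4) XY_gr(2)[of e N] unfolding brk_def by auto
            then show ?thesis using idl_lmult[OF idl_gr] idl_rmult[OF idl_gr] by blast
          qed
          then have *: "(\<Sum>e\<in>F. b e * Y e) * cut w ?B \<in> gr N"
            unfolding sum_distrib_right by (rule idl_sum[OF idl_gr])
          have eq: "a * cut w ?B = a' * cut w ?B + (\<Sum>e\<in>F. b e * Y e) * cut w ?B"
            by (simp add: a'(1) distrib_right)
          have "a * cut w ?B \<in> N" using idl_rmult[OF N a(2)] .
          then have "a' * cut w ?B \<in> N"
            unfolding eq using idl_add_iff[OF N subsetD[OF gr_subset[OF N] *]] by blast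
          note a'N = this[unfolded A(3)]
          \<comment> \<open>The breaking element at w annihilates all edges at w that occur in paths
            of A, so a non-zero real part would put it into N, although w is not in S.\<close>
          have kill: "cut w ?B * X e = 0" if "p \<in> A" "e \<in> set p" "tail E e = w" for p e
            using cut_mult(1)[OF 3(1) B, of e] edges[OF that] B by auto
          have "cut w ?B * V w * cut w ?B \<in> N" if "A \<noteq> {}"
            by (rule Reals_kill[OF A(1) that A(2) N a'N kill])
          then have "A = {}" using notN cut_V[OF 3(1) B w] by auto
          then have "a * cut w ?B \<in> J" using eq * grJ A(3) by auto
          then show ?thesis using cutJ[OF 3(1) B] by blast
        qed
      qed
    qed
  qed
qed

end

context leavitt
begin

subsection \<open>The structure of ideals\<close>

lemma awalk_split:
  assumes "awalk u p w" "i < length p"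
  shows "awalk u (take i p) (tail E (p ! i))" "awalk (head E (p ! i)) (drop (Suc i) p) w"
    "p ! i \<in> arcs E" "awalk (tail E (p ! i)) (drop i p) w"
proof -
  have p: "p = take i p @ p ! i # drop (Suc i) p" using assms id_take_nth_drop by blast
  have "awalk u (take i p @ p ! i # drop (Suc i) p) w" using assms(1) p by simp
  then have *: "awalk u (take i p) (tail E (p ! i))" "awalk (tail E (p ! i)) (p ! i # drop (Suc i) p) w"
    by (auto simp: awalk_append_iff awalk_Cons_iff)
  then show "awalk u (take i p) (tail E (p ! i))" "awalk (head E (p ! i)) (drop (Suc i) p) w"
    "p ! i \<in> arcs E" by (auto simp: awalk_Cons_iff)
  show "awalk (tail E (p ! i)) (drop i p) w"
    using *(2) Cons_nth_drop_Suc[OF assms(2)] by simp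
qed

lemma awalk_head_nth:
  assumes "awalk u p w" "i < length p"
  shows "head E (p ! i) = (if Suc i < length p then tail E (p ! Suc i) else w)"
proof (cases "Suc i < length p")
  case True
  then have "drop (Suc i) p = p ! Suc i # drop (Suc (Suc i)) p" by (rule Cons_nth_drop_Suc[symmetric])
  then show ?thesis using awalk_split(2)[OF assms] True by (auto simp: awalk_Cons_iff)
next
  case False
  then show ?thesis using awalk_split(2)[OF assms] by (auto simp: awalk_Nil_iff)
qed

lemma closed_path_head_nth:
  assumes "closed_path c"
  shows "head E (c ! (i mod length c)) = tail E (c ! (Suc i mod length c))"
proof -
  have c: "c \<noteq> []" "awalk (base c) c (base c)" using closed_pathD assms by auto
  then have i: "i mod length c < length c" by simp
  have "base c = tail E (c ! 0)" using c unfolding base_def by (simp add: hd_conv_nth)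
  moreover have "Suc (i mod length c) < length c \<or> Suc (i mod length c) = length c" using i by linarith
  ultimately show ?thesis using awalk_head_nth[OF c(2) i] by (auto simp: mod_Suc)
qed

lemma exitless_closed_path: "exitless J c \<Longrightarrow> closed_path c"
  unfolding exitless_def by simp

text \<open>If the endpoint is outside J, then by heredity so is every vertex on the way, while an
  edge leaving c would end in J. Hence each step is forced to follow c.\<close>

lemma exitless_nth:
  assumes J: "idl C J" and c: "exitless J c" and p: "awalk (base c) p w" "V w \<notin> J" and j: "j < length p"
  shows "p ! j = c ! (j mod length c)"
  using p j
proof (induction p arbitrary: w j rule: rev_induct)
  case (snoc e p)
  have cp: "closed_path c" "c \<noteq> []" using c closed_pathD exitless_closed_path by auto
  have e: "awalk (base c) p (tail E e)" "e \<in> arcs E" "head E e = w"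
    using snoc.prems by (auto simp: awalk_append_iff awalk_Cons_iff awalk_Nil_iff)
  have tJ: "V (tail E e) \<notin> J"
    using gv_head[OF J e(2)] e snoc.prems(2) unfolding gv_def by auto
  have IH: "p ! i = c ! (i mod length c)" if "i < length p" for i
    using snoc.IH[OF e(1) tJ that] .
  show ?case
  proof (cases "j < length p")
    case True
    then show ?thesis using IH by (simp add: nth_append)
  next
    case False
    then have j: "j = length p" using snoc.prems by simp
    let ?f = "c ! (length p mod length c)"
    have f: "?f \<in> set c" using cp by simp
    have "tail E e = tail E ?f"
    proof (cases "p = []")
      case True
      then show ?thesis using e(1) cp unfolding base_def by (auto simp: awalk_Nil_iff hd_conv_nth)
    next
      case False
      then have l: "length p - 1 < length p" by simp
      then have "tail E e = head E (p ! (length p - 1))" using awalk_head_nth[OF e(1) l] by auto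
      also have "\<dots> = tail E ?f"
        using closed_path_head_nth[OF cp(1), of "length p - 1"] IH[OF l] False by simp
      finally show ?thesis .
    qed
    moreover have "V (tail E ?f) - X ?f * Y ?f \<in> J" using c f unfolding exitless_def by blast
    moreover have "?f \<in> arcs E" using closed_pathD(1)[OF cp(1)] f by auto
    ultimately have "e = ?f"
      using mem_out_arcs_head[OF J, of e "tail E e" ?f] e snoc.prems(2) unfolding gv_def by auto
    then show ?thesis using j by simp
  qed
qed simp

text \<open>The vertices of c are distinct, so a path that follows c is back at the base only after
  a whole number of turns.\<close>

lemma exitless_closed:
  assumes J: "idl C J" and c: "exitless J c" and p: "awalk (base c) p (base c)"
  shows "p = power_path c (length p div length c)"
proof -
  have cp: "closed_path c" "c \<noteq> []" "V (base c) \<notin> J" "distinct (map (tail E) c)"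
    using c closed_pathD unfolding exitless_def by auto
  note nth = exitless_nth[OF J c p cp(3)]
  have "length p mod length c = 0"
  proof (cases "p = []")
    case False
    then have l: "length p - 1 < length p" by simp
    have "base c = head E (p ! (length p - 1))" using awalk_head_nth[OF p l] by auto
    also have "\<dots> = tail E (c ! (length p mod length c))"
      using closed_path_head_nth[OF cp(1), of "length p - 1"] nth[OF l] False by simp
    finally have "map (tail E) c ! 0 = map (tail E) c ! (length p mod length c)"
      using cp(2) unfolding base_def by (simp add: hd_conv_nth)
    then show ?thesis using cp(2,4) by (subst (asm) nth_eq_iff_index_eq) auto
  qed simp
  then have "length p = (length p div length c) * length c" by (metis add.right_neutral div_mult_mod_eq)
  then show ?thesis using nth nth_power_path by (intro nth_equalityI) auto
qed

text \<open>Beyond its first |p| letters, \<open>p @ d\<close> is d shifted by |p|; comparing it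
  with its prefix d gives one shift, which is then iterated t times.\<close>

lemma prefix_period:
  assumes "prefix d (p @ d)" "j < length d" "t * length p \<le> j"
  shows "d ! (j - t * length p) = d ! j"
  using assms(3)
proof (induction t)
  case (Suc t)
  let ?i = "j - t * length p"
  have i: "length p \<le> ?i" "?i < length d" using Suc.prems assms(2) by auto
  have "d ! ?i = (p @ d) ! ?i" using assms(1) i by (metis prefixE nth_append)
  also have "\<dots> = d ! (?i - length p)" using i by (simp add: nth_append)
  also have "?i - length p = j - Suc t * length p" by simp
  finally show ?case using Suc by simp
qed simp

text \<open>The common setting is an element of N in the corner at v with non-zero constant term
  \<open>k []\<close>, although v itself is not in N. Such an element forces a cycle at v without
  exits modulo \<open>gr N\<close>.\<close>

context
  fixes N J :: "'a set" and v :: 'v and A :: "'e list set" and k :: "'e list \<Rightarrow> 'k"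
  assumes N: "idl C N" and vN: "v \<in> verts E" "v \<notin> gv N"
    and A: "finite A" "\<And>p. p \<in> A \<Longrightarrow> awalk v p v" "[] \<in> A" "k [] \<noteq> 0"
    and aN: "(\<Sum>p\<in>A. sc (k p) (pe v p)) \<in> N"
begin

text \<open>Compression by factors that annihilate every non-constant term isolates the constant
  term, whose coefficient is invertible in K.\<close>

lemma closed_kill:
  assumes "\<And>p. p \<in> A \<Longrightarrow> p \<noteq> [] \<Longrightarrow> z' * pe v p * z = 0"
  shows "z' * V v * z \<in> N"
proof -
  have "z' * (\<Sum>p\<in>A. sc (k p) (pe v p)) * z = (\<Sum>p\<in>A. sc (k p) (z' * pe v p * z))"
    by (simp add: sum_distrib_left sum_distrib_right sc_mult_left sc_mult_right)
  also have "\<dots> = (\<Sum>p\<in>A. if p = [] then sc (k []) (z' * V v * z) else 0)"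
    using assms by (intro sum.cong) auto
  also have "\<dots> = sc (k []) (z' * V v * z)" using A by simp
  finally have "sc (k []) (z' * V v * z) \<in> N" using aN idl_lmult[OF N] idl_rmult[OF N] by metis
  then show ?thesis using sc_cancel[OF N A(4)] by blast
qed

text \<open>For an exit \<open>f\<close> of \<open>c\<close> leaving \<open>H\<close>, compress by \<open>\<delta> = c\<^sup>n \<gamma> f\<close> with \<open>n\<close> large: a term
  \<open>p\<close> survives only if \<open>\<delta>\<close> has period \<open>|p|\<close>, hence period \<open>|p| |c|\<close>, which contradicts that
  \<open>f\<close> differs from the corresponding edge of \<open>c\<close>.\<close>

lemma no_exit:
  assumes c: "closed_path c" "base c = v" and i: "i < length c"
    and f: "f \<in> arcs E" "tail E f = tail E (c ! i)" "f \<noteq> c ! i"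
  shows "head E f \<in> gv N"
proof -
  \<comment> \<open>Any common bound for the lengths |p| would do: a shift by |p| |c| then does not
    lead beyond the n turns of c.\<close>
  define n where "n = (\<Sum>p\<in>A. length p)"
  define d where "d = power_path c n @ take i c @ [f]"
  have len: "length d = n * length c + i + 1" unfolding d_def using i by simp
  have w: "awalk v (take i c) (tail E f)" using awalk_split(1)[OF closed_pathD(1)[OF c(1)] i] c(2) f(2) by simp
  have "awalk v (power_path c n) v" using awalk_power_path[OF c(1), of n] c(2) by simp
  then have dw: "awalk v d (head E f)"
    unfolding d_def using w awalk_arc[OF f(1)] by (intro awalk_appendI)
  have dnth: "d ! j = c ! (j mod length c)" if "j < n * length c + i" for j
  proof (cases "j < n * length c")
    case True
    then show ?thesis unfolding d_def by (simp add: nth_append nth_power_path)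
  next
    case False
    then have "j - n * length c < i" using that by simp
    moreover have "j mod length c = j - n * length c"
      using False i \<open>j - n * length c < i\<close> by (metis add_diff_inverse_nat mod_less mod_mult_self3 order.strict_trans)
    ultimately show ?thesis unfolding d_def using False i by (simp add: nth_append)
  qed
  have dlast: "d ! (n * length c + i) = f" unfolding d_def using i by (simp add: nth_append)
  have "pg v d * pe v p * pe v d = 0" if p: "p \<in> A" "p \<noteq> []" for p
  proof -
    have np: "length p \<le> n" unfolding n_def using A(1) p member_le_sum[of p A length] by simp
    have "\<not> prefix d (p @ d)"
    proof
      assume pr: "prefix d (p @ d)"
      let ?j = "n * length c + i"
      have le: "length c * length p \<le> ?j" using np by (simp add: mult.commute trans_le_add1)
      have "d ! (?j - length c * length p) = f"
        using prefix_period[OF pr _ le] len dlast by simp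
      moreover have "?j - length c * length p < n * length c + i"
      proof (rule diff_less)
        have "0 < length p" "0 < length c" using p(2) i by auto
        then show "0 < length c * length p" by simp
        then show "0 < ?j" using le by linarith
      qed
      moreover have "(?j - length c * length p) mod length c = i"
      proof -
        have "?j - length c * length p = (n - length p) * length c + i"
          using le_Suc_ex[OF np] by (auto simp: algebra_simps)
        then show ?thesis using i by simp
      qed
      ultimately show False using dnth f(3) by metis
    qed
    moreover have "\<not> prefix (p @ d) d"
      using p(2) by (metis append_Nil length_append less_add_same_cancel2 length_greater_0_conv not_less prefix_length_le)
    moreover have "awalk v (p @ d) (head E f)" using A(2)[OF p(1)] dw by auto
    ultimately have "pg v d * pe v (p @ d) = 0" using pg_pe_incomparable dw by blast
    then show ?thesis using pe_append[OF A(2)[OF p(1)] dw] by (simp add: mult.assoc)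
  qed
  then have "pg v d * V v * pe v d \<in> N" by (rule closed_kill)
  then have "V (head E f) \<in> N" using pe_left[OF dw] pg_pe[OF dw] by (simp add: mult.assoc)
  then show ?thesis unfolding gv_def using f(1) by simp
qed

text \<open>A shortest closed path c at v works. Exits end in H by \<open>no_exit\<close>. At a
  regular vertex w this gives w - e e* in \<open>gr N\<close> through the relation at w; at an
  infinite emitter, e is the only edge that ends outside H, and w - e e* is the breaking element,
  which still has to be shown to lie in N.\<close>

lemma exists_exitless:
  assumes p1: "p1 \<in> A" "p1 \<noteq> []"
  shows "\<exists>c. exitless (gr N) c \<and> base c = v"
proof -
  obtain c where c: "c \<noteq> [] \<and> awalk v c v" "\<And>q. q \<noteq> [] \<and> awalk v q v \<Longrightarrow> length c \<le> length q"
    using ex_has_least_nat[of "\<lambda>c. c \<noteq> [] \<and> awalk v c v" p1 length] A(2) p1 by blast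
  have cp: "closed_path c" "base c = v" using closed_path_awalk c(1) by auto
  have "distinct (map (tail E) c)"
    unfolding distinct_conv_nth
  proof (intro allI impI)
    \<comment> \<open>Removing the part between two visits to the same vertex would give a shorter
      closed path.\<close>
    have ne: "tail E (c ! i) \<noteq> tail E (c ! j)" if "i < j" "j < length c" for i j
    proof
      assume "tail E (c ! i) = tail E (c ! j)"
      then have "awalk v (take i c @ drop j c) v"
        using awalk_split(1)[of v c v i] awalk_split(4)[of v c v j] c(1) that by auto
      then show False using c(2)[of "take i c @ drop j c"] that by auto
    qed
    fix i j assume "i < length (map (tail E) c)" "j < length (map (tail E) c)" "i \<noteq> j"
    then show "map (tail E) c ! i \<noteq> map (tail E) c ! j" using ne[of i j] ne[of j i] by (cases "i < j") auto
  qed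
  moreover have "V v \<notin> gr N" using vN gr_subset[OF N] unfolding gv_def by blast
  moreover have "V (tail E e) - X e * Y e \<in> gr N" if ec: "e \<in> set c" for e
  proof -
    obtain i where i: "i < length c" "c ! i = e" using ec unfolding in_set_conv_nth by blast
    let ?w = "tail E e"
    have w: "awalk v (take i c) ?w" "awalk ?w (drop i c) v" "awalk (head E e) (drop (Suc i) c) v" "e \<in> arcs E"
      using awalk_split[of v c v i] c(1) i by auto
    have wN: "?w \<notin> gv N" "head E e \<notin> gv N" using gv_awalk[OF N] w vN by blast+
    have wv: "?w \<in> verts E" using w(4) by simp
    have exit: "head E f \<in> gv N" if "f \<in> out_arcs E ?w" "f \<noteq> e" for f
      using no_exit[OF cp i(1), of f] that i(2) by auto
    have brk: "brk (gv N) ?w = {e}" unfolding brk_def using exit wN w(4) by auto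
    show ?thesis
    proof (cases "finite (out_arcs E ?w)")
      case True
      then have "regular_vertex E ?w" unfolding regular_vertex_def using wv w(4) by auto
      then have "V ?w = X e * Y e + (\<Sum>f\<in>out_arcs E ?w - {e}. X f * Y f)"
        using CK2 True w(4) by (simp add: sum.remove[of "out_arcs E ?w" e])
      moreover have "(\<Sum>f\<in>out_arcs E ?w - {e}. X f * Y f) \<in> gr N"
      proof (rule idl_sum[OF idl_gr])
        fix f assume "f \<in> out_arcs E ?w - {e}"
        then show "X f * Y f \<in> gr N" using XY_gr(1)[of f N] exit idl_rmult[OF idl_gr] by auto
      qed
      ultimately show ?thesis by simp
    next
      case False
      have wb: "?w \<in> breaking_verts E (gv N)"
        unfolding breaking_verts_def infinite_emitter_def using brk wN wv False by (auto simp: brk_def)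
      have cut: "cut ?w {e} = V ?w - X e * Y e" unfolding cut_def by simp
      have e1: "finite {e}" "{e} \<subseteq> out_arcs E ?w" using w(4) by auto
      have "cut ?w {e} \<in> N"
      proof -
        \<comment> \<open>Every non-trivial p in A is at least as long as c. If it begins with
          \<open>take i c\<close>, its next edge leads on to v and is therefore e, which the cut
          annihilates.\<close>
        have "(cut ?w {e} * pg v (take i c)) * pe v p * (pe v (take i c) * cut ?w {e}) = 0"
          if p: "p \<in> A" "p \<noteq> []" for p
        proof -
          have "cut ?w {e} * (pg v (take i c) * pe v p) = 0"
            using w(1) A(2)[OF p(1)]
          proof (cases rule: pg_pe_cases)
            case (left r)
            have "length c \<le> length p" using c(2) A(2) p by blast
            then obtain e' r' where r: "r = e' # r'" using left(2) i by (cases r) auto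
            have e': "e' \<in> out_arcs E ?w" "awalk (head E e') r' v" using left(3) r by (auto simp: awalk_Cons_iff)
            then have "e' = e" using exit[OF e'(1)] gv_awalk[OF N e'(2)] vN by blast
            then show ?thesis using left(4) r cut_mult(1)[OF e1, of e] w(4) by (simp add: mult.assoc[symmetric])
          next
            case (right r)
            have "length c \<le> length p" using c(2) A(2) p by blast
            then show ?thesis using right(2) i by (metis add_lessD1 length_append length_take min.absorb4 not_less)
          qed simp
          then show ?thesis by (metis mult.assoc mult_zero_left)
        qed
        then have "(cut ?w {e} * pg v (take i c)) * V v * (pe v (take i c) * cut ?w {e}) \<in> N"
          by (rule closed_kill)
        moreover have "(cut ?w {e} * pg v (take i c)) * V v * (pe v (take i c) * cut ?w {e})
            = cut ?w {e} * ((pg v (take i c) * V v) * pe v (take i c)) * cut ?w {e}" by (simp add: mult.assoc)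
        ultimately show ?thesis
          using pg_right[OF w(1)] pg_pe[OF w(1)] cut_V[OF e1 wv] by simp
      qed
      then have "?w \<in> gs N" unfolding gs_def using wb brk by simp
      then show ?thesis using cut_gr[of ?w N] brk cut by simp
    qed
  qed
  ultimately show ?thesis using cp unfolding exitless_def by blast
qed

text \<open>All closed paths at v are powers of c, so the whole sum is a polynomial in c.\<close>

lemma closed_case:
  assumes gr: "gr N \<subseteq> J" and cyc: "\<And>c p. exitless (gr N) c \<Longrightarrow> pc c p \<in> N \<Longrightarrow> pc c p \<in> J"
    and p1: "p1 \<in> A" "p1 \<noteq> []"
  shows "(\<Sum>p\<in>A. sc (k p) (pe v p)) \<in> J"
proof -
  obtain c where c: "exitless (gr N) c" "base c = v" using exists_exitless[OF p1] by blast
  have cp: "closed_path c" using exitless_closed_path c by blast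
  have "(\<Sum>p\<in>A. sc (k p) (pe v p)) = (\<Sum>p\<in>A. pc c (monom (k p) (length p div length c)))"
    using exitless_closed[OF idl_gr c(1)] A(2) c(2) by (intro sum.cong) (auto simp: pc_monom[OF cp])
  then have "(\<Sum>p\<in>A. sc (k p) (pe v p)) = pc c (\<Sum>p\<in>A. monom (k p) (length p div length c))"
    by (simp add: pc_sum)
  then show ?thesis using cyc[OF c(1)] aN by simp
qed

end

text \<open>Descent on the length bound. Without a constant term, a is the sum of e (e* a) over the
  first edges e, and e* a is shorter; with one, w = v and the closed case applies.\<close>

lemma Real_span_step:
  assumes N: "idl C N" and J: "idl C J" and grJ: "gr N \<subseteq> J"
    and cyc: "\<And>c p. exitless (gr N) c \<Longrightarrow> pc c p \<in> N \<Longrightarrow> pc c p \<in> J"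
    and "a \<in> Real_span v w n" "a \<in> N" "v \<in> verts E"
  shows "a \<in> J"
  using assms(5-7)
proof (induction n arbitrary: a v rule: less_induct)
  case (less n)
  obtain A k where A: "finite A" "\<And>p. p \<in> A \<Longrightarrow> awalk v p w \<and> length p \<le> n \<and> k p \<noteq> 0"
    "a = (\<Sum>p\<in>A. sc (k p) (pe v p))"
    using Real_span_normal_form[OF less.prems(1)] by blast
  have Va: "V v * a = a" using Reals_V(1) less.prems(1) unfolding Reals_def by blast
  show ?case
  proof (cases "v \<in> gv N")
    case True
    then show ?thesis using Va V_gr grJ idl_rmult[OF J] by (metis subsetD)
  next
    case vN: False
    show ?thesis
    proof (cases "[] \<in> A")
      case False
      define F where "F = hd ` A"
      have F: "finite F" "F \<subseteq> arcs E"
      proof -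
        show "finite F" unfolding F_def using A(1) by simp
        have "hd p \<in> arcs E" if "p \<in> A" for p
          using A(2)[OF that] False that by (cases p) (auto simp: awalk_Cons_iff)
        then show "F \<subseteq> arcs E" unfolding F_def by blast
      qed
      have "(\<Sum>e\<in>F. X e * Y e) * pe v p = pe v p" if pA: "p \<in> A" for p
      proof -
        obtain e p' where p: "p = e # p'" using False pA by (cases p) auto
        then have "e \<in> F" unfolding F_def using pA by force
        then show ?thesis using XY_sum(1)[OF F, of e] F p by (auto simp: mult.assoc[symmetric])
      qed
      then have "a = (\<Sum>e\<in>F. X e * Y e) * a"
        unfolding A(3) by (simp add: sum_distrib_left sc_mult_right)
      also have "\<dots> = (\<Sum>e\<in>F. X e * (Y e * a))" by (simp add: sum_distrib_right mult.assoc)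
      finally have a: "a = (\<Sum>e\<in>F. X e * (Y e * a))" .
      have "X e * (Y e * a) \<in> J" if e: "e \<in> F" for e
      proof -
        obtain q where "q \<in> A" using e unfolding F_def by blast
        then have "length q \<le> n" "q \<noteq> []" using A(2) False by metis+
        then have "n \<noteq> 0" by (cases q) auto
        have eA: "e \<in> arcs E" using e F by blast
        have "Y e * a = (\<Sum>p\<in>A. sc (k p) (Y e * pe v p))" unfolding A(3) by (simp add: sum_distrib_left sc_mult_right)
        also have "\<dots> \<in> Real_span (head E e) w (n - 1)"
          unfolding Real_span_def
        proof (rule aspan_sum)
          fix p assume p: "p \<in> A"
          then obtain g p' where g: "p = g # p'" using False by (cases p) auto
          then have gp: "g \<in> arcs E" "awalk (head E g) p' w" "length p' \<le> n - 1"
            using A(2)[OF p] by (auto simp: awalk_Cons_iff)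
          show "sc (k p) (Y e * pe v p) \<in> aspan {sc k (pe (head E e) p) |k p. awalk (head E e) p w \<and> length p \<le> n - 1}"
          proof (cases "e = g")
            case True
            then have "Y e * pe v p = pe (head E e) p'"
              using g YX[OF gp(1)] pe_left[OF gp(2)] by (simp add: mult.assoc[symmetric])
            then show ?thesis using gp True by (intro aspan_base) auto
          next
            case False
            then have "Y e * pe v p = 0" using g YX_orth[OF eA gp(1)] by (simp add: mult.assoc[symmetric])
            then show ?thesis using aspan_zero by simp
          qed
        qed
        finally have "Y e * a \<in> J"
          using less.IH[of "n - 1"] \<open>n \<noteq> 0\<close> idl_lmult[OF N less.prems(2)] eA by simp
        then show ?thesis using idl_lmult[OF J] by blast
      qed
      then have "(\<Sum>e\<in>F. X e * (Y e * a)) \<in> J" by (rule idl_sum[OF J])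
      then show ?thesis using a by simp
    next
      case True
      then have wv: "w = v" using A(2)[OF True] by (simp add: awalk_Nil_iff)
      have A': "\<And>p. p \<in> A \<Longrightarrow> awalk v p v" "k [] \<noteq> 0" using A(2) True wv by auto
      have aN: "(\<Sum>p\<in>A. sc (k p) (pe v p)) \<in> N" using less.prems(2) A(3) by simp
      show ?thesis
      proof (cases "\<exists>p1\<in>A. p1 \<noteq> []")
        case True
        then show ?thesis
          using closed_case[OF N less.prems(3) vN A(1) A'(1) \<open>[] \<in> A\<close> A'(2) aN grJ cyc] A(3) by blast
      next
        case False
        then have "A = {[]}" using True by auto
        then have "sc (k []) (V v) \<in> N" using aN by simp
        then have "V v \<in> N" using sc_cancel[OF N A'(2)] by blast
        then show ?thesis using vN less.prems(3) unfolding gv_def by blast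
      qed
    qed
  qed
qed

text \<open>The description of an ideal by its graded part and its polynomials is phrased as an
  induction principle: later proofs choose J to suit and never handle a generating set.\<close>

theorem ideal_structure:
  assumes N: "idl C N" and J: "idl C J" and grJ: "gr N \<subseteq> J"
    and cyc: "\<And>c p. exitless (gr N) c \<Longrightarrow> pc c p \<in> N \<Longrightarrow> pc c p \<in> J"
  shows "N \<subseteq> J"
proof
  have G: "Ghosts v q w \<inter> N \<subseteq> J" if "v \<in> verts E" "w \<in> verts E" for v q w
    using that(2)
  proof (induction q arbitrary: w)
    case 0
    then show ?case using Real_span_step[OF N J grJ cyc _ _ that(1)] unfolding Ghosts.simps Reals_def by blast
  next
    case (Suc q)
    then show ?case using Ghosts_step[OF N J grJ] by blast
  qed
  fix x assume x: "x \<in> N"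
  then obtain u where u: "u \<in> C" "u * x = x" "x * u = x" using C_units idl_sub[OF N] by blast
  have "u \<in> aspan {sc k m |k m. m \<in> mons}" using u C_mons unfolding mon_span_def by blast
  then have "u * x * u \<in> J"
  proof (rule aspan_sandwich[OF J])
    fix b c assume "b \<in> {sc k m |k m. m \<in> mons}" "c \<in> {sc k m |k m. m \<in> mons}"
    then obtain k u p v q w l u' p' v' q' w' where b: "b = sc k (pe u p * pg v q)" "awalk v q w"
      and c: "c = sc l (pe u' p' * pg v' q')" "awalk u' p' w'" unfolding mons_def by blast
    have vs: "v \<in> verts E" "u' \<in> verts E" using b c awalk_verts_ends by blast+
    have "b * V v = b" "V u' * c = c"
      using b c pg_right[OF b(2)] pe_left[OF c(2)]
      by (simp_all add: sc_mult_left sc_mult_right mult.assoc) (simp add: mult.assoc[symmetric])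
    then have "b * x * c = b * (V v * x * V u') * c" by (metis mult.assoc)
    moreover obtain r where "V v * x * V u' \<in> Ghosts v r u'"
      using Ghosts_exhaust[OF _ vs] x idl_sub[OF N] by blast
    then have "V v * x * V u' \<in> J" using G[OF vs] x idl_lmult[OF N] idl_rmult[OF N] by blast
    ultimately show "b * x * c \<in> J" using idl_lmult[OF J] idl_rmult[OF J] by metis
  qed
  then show "x \<in> J" using u by simp
qed

end

context leavitt
begin

subsection \<open>Graded ideals and corners\<close>

lemma graded_idl: "graded J \<Longrightarrow> idl C J"
  unfolding graded_def by simp

text \<open>The component of degree n |c| of p(c) is a scalar multiple of c^n. Were the scalar
  non-zero, c^n and hence the base of c would lie in J.\<close>

lemma graded_pc:
  assumes J: "graded J" and c: "closed_path c" "V (base c) \<notin> J" and p: "pc c p \<in> J"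
  shows "p = 0"
proof -
  have "coeff p n = 0" if n: "n \<le> degree p" for n
  proof (rule ccontr)
    assume k: "coeff p n \<noteq> 0"
    let ?m = "\<lambda>i. pe (base c) (power_path c i)"
    have w: "awalk (base c) (power_path c i) (base c)" for i using awalk_power_path c by blast
    have hm: "hc (int (n * length c)) (?m i) = (if i = n then ?m i else 0)" for i
      using hc_homogeneous[OF hc_pe[OF w[of i]], of "int (n * length c)"] closed_pathD(3)[OF c(1)]
      by (auto simp: of_nat_mult[symmetric] simp del: of_nat_mult)
    have "hc (int (n * length c)) (pc c p) = (\<Sum>i\<le>degree p. if i = n then sc (coeff p n) (?m n) else 0)"
      unfolding pc_altdef[OF c(1) order_refl] hc_sum hc_sc hm by (rule sum.cong) auto
    also have "\<dots> = sc (coeff p n) (?m n)" using n by simp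
    finally have "sc (coeff p n) (?m n) \<in> J" using J p unfolding graded_def by metis
    then have "?m n \<in> J" using sc_cancel[OF graded_idl[OF J] k] by blast
    then have "pg (base c) (power_path c n) * ?m n \<in> J" using idl_lmult[OF graded_idl[OF J]] by blast
    then show False using pg_pe[OF w] c(2) by simp
  qed
  then show ?thesis by (metis leading_coeff_0_iff order_refl)
qed

text \<open>A graded ideal contains no non-zero polynomial in an exitless cycle, so by
  \<open>ideal_structure\<close> nothing is left beyond the graded part. This gives local units to
  every graded ideal.\<close>

lemma graded_gr_eq:
  assumes J: "graded J"
  shows "gr J = J"
proof
  show "gr J \<subseteq> J" using gr_subset graded_idl J by blast
  show "J \<subseteq> gr J"
  proof (rule ideal_structure[OF graded_idl[OF J] idl_gr order_refl])
    fix c p assume c: "exitless (gr J) c" "pc c p \<in> J"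
    have cp: "closed_path c" using c exitless_closed_path by blast
    have "V (base c) \<notin> J"
    proof
      assume "V (base c) \<in> J"
      then have "base c \<in> gv J" unfolding gv_def using closed_pathD(2)[OF cp] by simp
      then show False using V_gr c(1) unfolding exitless_def by blast
    qed
    then have "p = 0" using graded_pc[OF J cp] c by blast
    then show "pc c p \<in> gr J" using idl_zero[OF idl_gr] by simp
  qed
qed

lemma graded_locally_unital: "graded J \<Longrightarrow> locally_unital J"
  using gr_locally_unital graded_gr_eq by metis

text \<open>Makes \<open>gr A\<close> the largest graded ideal inside A. The delicate generators are
  the breaking elements of G: as H grows on passing to A, either v falls into H, or v^H changes by
  the sum of e e* over the edges that now end in H.\<close>

lemma graded_subset_gr:
  assumes G: "graded G" and A: "idl C A" and GA: "G \<subseteq> A"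
  shows "G \<subseteq> gr A"
proof -
  have H: "gv G \<subseteq> gv A" using GA unfolding gv_def by blast
  have "cut v (brk (gv G) v) \<in> gr A" if v: "v \<in> gs G" for v
  proof -
    note vp = gs_props[OF v]
    have cutA: "cut v (brk (gv G) v) \<in> A" using v GA unfolding gs_def by blast
    show ?thesis
    proof (cases "v \<in> gv A")
      case True
      then show ?thesis using V_gr cut_V(1)[OF vp(2,3,1)] idl_rmult[OF idl_gr] by metis
    next
      case False
      have sub: "brk (gv A) v \<subseteq> brk (gv G) v" unfolding brk_def using H by blast
      then have fin: "finite (brk (gv A) v)" using vp finite_subset by blast
      have "(\<Sum>e\<in>brk (gv G) v - brk (gv A) v. X e * Y e) \<in> gr A"
      proof (rule idl_sum[OF idl_gr])
        fix e assume "e \<in> brk (gv G) v - brk (gv A) v"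
        then show "X e * Y e \<in> gr A" using XY_gr(1)[of e A] idl_rmult[OF idl_gr] unfolding brk_def by auto
      qed
      moreover have eq: "cut v (brk (gv A) v) = cut v (brk (gv G) v) + (\<Sum>e\<in>brk (gv G) v - brk (gv A) v. X e * Y e)"
        unfolding cut_def using sum.subset_diff[OF sub vp(2), of "\<lambda>e. X e * Y e"] by simp
      ultimately have "cut v (brk (gv A) v) \<in> A" using cutA idl_add[OF A] gr_subset[OF A] by auto
      moreover have "brk (gv A) v \<noteq> {}" using calculation False vp(1) unfolding gv_def cut_def by auto
      moreover have "infinite_emitter E v" using v unfolding gs_def breaking_verts_def by blast
      ultimately have "v \<in> gs A"
        unfolding gs_def breaking_verts_def using fin False vp(1) by (auto simp: brk_def)
      then have "cut v (brk (gv A) v) \<in> gr A" using cut_gr by blast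
      then show ?thesis
        using idl_add_iff[OF idl_gr \<open>(\<Sum>e\<in>brk (gv G) v - brk (gv A) v. X e * Y e) \<in> gr A\<close>] eq by simp
    qed
  qed
  then have "gr G \<subseteq> gr A"
    unfolding gr_def[of G] using H V_gr by (intro gen_least[OF idl_gr]) blast
  then show ?thesis using graded_gr_eq[OF G] by simp
qed

text \<open>Replacing s(e) by e e* modulo J, edge after edge, turns the initial vertex into p
  p*.\<close>

lemma path_units:
  assumes J: "idl C J"
  shows "awalk u p w \<Longrightarrow> (\<And>e. e \<in> set p \<Longrightarrow> V (tail E e) - X e * Y e \<in> J) \<Longrightarrow> V u - pe u p * pg u p \<in> J"
proof (induction p arbitrary: u)
  case Nil
  then show ?case using idl_zero[OF J] by (auto simp: awalk_Nil_iff V_idem)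
next
  case (Cons e p)
  then have e: "e \<in> arcs E" "tail E e = u" "awalk (head E e) p w" by (auto simp: awalk_Cons_iff)
  have "V u - pe u (e # p) * pg u (e # p)
      = (V u - X e * Y e) + X e * (V (head E e) - pe (head E e) p * pg (head E e) p) * Y e"
    using XV[OF e(1)] by (simp add: right_diff_distrib left_diff_distrib mult.assoc[symmetric])
  moreover have "V (head E e) - pe (head E e) p * pg (head E e) p \<in> J" using Cons e by simp
  moreover have "V u - X e * Y e \<in> J" using Cons.prems(2)[of e] e by simp
  ultimately show ?case using idl_add[OF J] idl_rmult[OF J idl_lmult[OF J]] by metis
qed

text \<open>Modulo J the power c^n has the inverse \<open>pg (base c) (power_path c n)\<close> in
  the corner, so it can be cancelled on the right.\<close>

lemma exitless_cancel:
  assumes J: "idl C J" and J': "idl C J'" "J \<subseteq> J'" and c: "exitless J c"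
    and y: "y * V (base c) = y" "y * pc c (monom 1 n) \<in> J'"
  shows "y \<in> J'"
proof -
  have cp: "closed_path c" using c exitless_closed_path by blast
  let ?p = "power_path c n"
  have "set ?p \<subseteq> set c" unfolding power_path_def by auto
  then have "V (base c) - pe (base c) ?p * pg (base c) ?p \<in> J"
    using c awalk_power_path[OF cp] unfolding exitless_def by (intro path_units[OF J]) auto
  then have "y * (V (base c) - pe (base c) ?p * pg (base c) ?p) \<in> J'"
    using idl_lmult[OF J'(1)] J'(2) by blast
  then have "y * V (base c) - y * (pe (base c) ?p * pg (base c) ?p) \<in> J'"
    by (simp add: right_diff_distrib)
  moreover have "y * (pe (base c) ?p * pg (base c) ?p) \<in> J'"
    using idl_rmult[OF J'(1) y(2)] pc_power[OF cp] by (simp add: mult.assoc)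
  ultimately show ?thesis using y(1) idl_diff_mem[OF J'(1)] by metis
qed

text \<open>Modulo J the corner consists of Laurent polynomials in c; a high power of c clears the
  negative exponents.\<close>

lemma corner_poly:
  assumes J: "idl C J" and c: "exitless J c" and x: "x \<in> C"
  shows "\<exists>n p. V (base c) * x * V (base c) * pc c (monom 1 n) - pc c p \<in> J"
proof -
  have cp: "closed_path c" "V (base c) \<notin> J" using c unfolding exitless_def by auto
  let ?v = "base c"
  have vv: "?v \<in> verts E" using closed_pathD cp by blast
  have "x \<in> aspan {sc k m |k m. m \<in> mons}" using x C_mons unfolding mon_span_def by blast
  then show ?thesis
  proof induction
    case aspan_zero
    show ?case using idl_zero[OF J] by (intro exI[of _ 0]) simp
  next
    case (aspan_add b x)
    then obtain n p where np: "V ?v * x * V ?v * pc c (monom 1 n) - pc c p \<in> J" by blast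
    obtain k u r u' q z where b: "b = sc k (pe u r * pg u' q)" "awalk u r z" "awalk u' q z"
      using aspan_add unfolding mons_def by blast
    have *: "V ?v * b * V ?v = sc k ((V ?v * V u) * pe u r * pg u' q * (V u' * V ?v))"
      using pe_left[OF b(2)] pg_right[OF b(3)]
      by (simp add: b(1) sc_mult_left sc_mult_right mult.assoc) (metis mult.assoc)
    have "\<exists>m s. V ?v * b * V ?v * pc c (monom 1 m) - pc c s \<in> J"
    proof (cases "u = ?v \<and> u' = ?v")
      case False
      then have "V ?v * b * V ?v = 0" unfolding *
        using V_orth[of ?v u] V_orth[of u' ?v] vv awalk_verts_ends b(2,3) by auto
      then show ?thesis using idl_zero[OF J] by (intro exI[of _ 0]) simp
    next
      case True
      then have w: "awalk ?v r z" "awalk ?v q z" using b by auto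
      have bb: "V ?v * b * V ?v = sc k (pe ?v r * pg ?v q)"
        using True pe_left[OF w(1)] pg_right[OF w(2)]
        by (simp add: b(1) sc_mult_left sc_mult_right mult.assoc) (metis mult.assoc)
      show ?thesis
      proof (cases "V z \<in> J")
        case zJ: True
        then have "pe ?v r \<in> J" using pe_right[OF w(1)] idl_lmult[OF J] by metis
        then have "V ?v * b * V ?v * pc c (monom 1 0) \<in> J"
          unfolding bb using idl_rmult[OF J] idl_sc[OF J] by metis
        then show ?thesis by (metis pc_0 diff_zero)
      next
        case False
        have len: "length q \<le> length q * length c"
          using closed_pathD(3)[OF cp(1)] by (cases c) auto
        \<comment> \<open>The path q follows c and is no longer than |q| turns of it, so this power
          of c absorbs the ghost path of q.\<close>
        have "q = take (length q) (power_path c (length q))"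
          using exitless_nth[OF J c w(2) False] len nth_power_path[OF less_le_trans[OF _ len]]
          by (intro nth_equalityI) auto
        then obtain q' where q': "power_path c (length q) = q @ q'" by (metis append_take_drop_id)
        have wq: "awalk z q' ?v" using awalk_power_path[OF cp(1), of "length q"] w(2) awalk_prefixD unfolding q' by blast
        then have rq: "awalk ?v (r @ q') ?v" using w by auto
        have "V ?v * b * V ?v * pc c (monom 1 (length q)) = sc k (pe ?v r * (pg ?v q * pe ?v (q @ q')))"
          unfolding bb pc_power[OF cp(1), symmetric] q' by (simp add: sc_mult_left mult.assoc)
        also have "\<dots> = sc k (pe ?v (r @ q'))"
          using pg_pe_prefix[OF w(2) wq] pe_append[OF w(1) wq] by simp
        also have "\<dots> = pc c (monom k (length (r @ q') div length c))"
          using exitless_closed[OF J c rq] by (simp only: pc_monom[OF cp(1)])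
        finally show ?thesis using idl_zero[OF J] by (metis diff_self)
      qed
    qed
    then obtain m s where ms: "V ?v * b * V ?v * pc c (monom 1 m) - pc c s \<in> J" by blast
    have mn: "pc c (monom 1 (m + n)) = pc c (monom 1 m) * pc c (monom 1 n)"
      "pc c (monom 1 (m + n)) = pc c (monom 1 n) * pc c (monom 1 m)"
      using pc_mult[OF cp(1)] by (metis mult_monom mult_1, metis mult_monom mult_1 add.commute)
    have "V ?v * (b + x) * V ?v * pc c (monom 1 (m + n)) - pc c (s * monom 1 n + p * monom 1 m)
        = (V ?v * b * V ?v * pc c (monom 1 m) - pc c s) * pc c (monom 1 n)
          + (V ?v * x * V ?v * pc c (monom 1 n) - pc c p) * pc c (monom 1 m)"
      unfolding pc_add pc_mult[OF cp(1)]
      by (simp add: distrib_left distrib_right left_diff_distrib mn(1)[symmetric] mn(2)[symmetric] mult.assoc)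
    moreover have "\<dots> \<in> J" using ms np idl_add[OF J] idl_rmult[OF J] by blast
    ultimately show ?case by metis
  qed
qed

text \<open>A corner element of A outside J is multiplied by a power of c. The result y stays in A,
  whereas p(c) is only congruent to it, since A need not contain J.\<close>

lemma corner_element:
  assumes J: "idl C J" and c: "exitless J c" and A: "idl C A" and AJ: "\<not> A \<inter> vert_ideal (base c) \<subseteq> J"
  obtains y p where "y \<in> A" "y \<in> vert_ideal (base c)" "y - pc c p \<in> J" "pc c p \<notin> J" "p \<noteq> 0"
proof -
  have cp: "closed_path c" using c exitless_closed_path by blast
  let ?v = "base c"
  have v: "?v \<in> verts E" using closed_pathD cp by blast
  obtain x where x: "x \<in> A" "x \<in> vert_ideal ?v" "V ?v * x * V ?v \<notin> J"
    using corner_subset[OF v A J] AJ by blast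
  obtain n p where np: "V ?v * x * V ?v * pc c (monom 1 n) - pc c p \<in> J"
    using corner_poly[OF J c] x(1) idl_sub[OF A] by blast
  let ?y = "V ?v * x * V ?v * pc c (monom 1 n)"
  have y: "?y \<in> A" "?y \<in> vert_ideal ?v"
    using x A vert_ideal(1)[OF v] idl_lmult idl_rmult by metis+
  have "?y \<notin> J"
    using exitless_cancel[OF J J order_refl c, of "V ?v * x * V ?v" n] x(3) V_idem[OF v] by (auto simp: mult.assoc)
  then have "pc c p \<notin> J" using idl_diff_mem[OF J np] by blast
  moreover have "p \<noteq> 0" using calculation idl_zero[OF J] by auto
  ultimately show thesis using that y np by blast
qed

subsection \<open>Prime, irreducible and strongly irreducible ideals\<close>

definition prime_idl :: "'a set \<Rightarrow> bool" where
  "prime_idl P \<longleftrightarrow> idl C P \<and> P \<noteq> C \<and>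
     (\<forall>A B. idl C A \<longrightarrow> idl C B \<longrightarrow> iprod A B \<subseteq> P \<longrightarrow> A \<subseteq> P \<or> B \<subseteq> P)"

definition irred_idl :: "'a set \<Rightarrow> bool" where
  "irred_idl I \<longleftrightarrow> idl C I \<and> (\<forall>A B. idl C A \<longrightarrow> idl C B \<longrightarrow> A \<inter> B = I \<longrightarrow> A = I \<or> B = I)"

definition sirred_idl :: "'a set \<Rightarrow> bool" where
  "sirred_idl I \<longleftrightarrow> idl C I \<and> (\<forall>A B. idl C A \<longrightarrow> idl C B \<longrightarrow> A \<inter> B \<subseteq> I \<longrightarrow> A \<subseteq> I \<or> B \<subseteq> I)"

lemma sirred_irred: "sirred_idl I \<Longrightarrow> irred_idl I"
  unfolding sirred_idl_def irred_idl_def by blast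

lemma iprod_base: "a \<in> A \<Longrightarrow> b \<in> B \<Longrightarrow> a * b \<in> iprod A B"
  unfolding iprod_def by (rule aspan_base) blast

lemma iprod_subset:
  assumes "idl C A" "idl C B"
  shows "iprod A B \<subseteq> A" "iprod A B \<subseteq> B"
  unfolding iprod_def
  by (rule idl_aspan[OF assms(1)], use assms idl_rmult in blast)
     (rule idl_aspan[OF assms(2)], use assms idl_lmult in blast)

lemma isum_subset: "idl C A \<Longrightarrow> idl C B \<Longrightarrow> A \<subseteq> isum A B" "idl C A \<Longrightarrow> idl C B \<Longrightarrow> B \<subseteq> isum A B"
  unfolding isum_def using idl_zero by force+

lemma isum_least: "idl C J \<Longrightarrow> A \<subseteq> J \<Longrightarrow> B \<subseteq> J \<Longrightarrow> isum A B \<subseteq> J"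
  unfolding isum_def using idl_add by blast

lemma idl_isum': "idl C A \<Longrightarrow> idl C B \<Longrightarrow> idl C (isum A B)"
  using idl_isum idl_C by blast

lemma irred_graded:
  assumes A: "irred_idl A" and G: "graded G" "graded G'" "G \<inter> G' \<subseteq> A"
  shows "G \<subseteq> gr A \<or> G' \<subseteq> gr A"
proof -
  have iA: "idl C A" using A unfolding irred_idl_def by blast
  note iG = graded_idl[OF G(1)] graded_idl[OF G(2)]
  note S = idl_isum'[OF iA iG(1)] idl_isum'[OF iA iG(2)]
  have "isum A G \<inter> isum A G' \<subseteq> A"
  proof
    fix x assume x: "x \<in> isum A G \<inter> isum A G'"
    \<comment> \<open>Split x along G' and then its G'-part along G; the last piece lies in both
      graded ideals and hence in A.\<close>
    then have "x \<in> isum (isum A G \<inter> A) (isum A G \<inter> G')"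
      using modular_split[OF S(1) iA iG(2) graded_locally_unital[OF G(2)]] by blast
    then obtain y z where yz: "x = y + z" "y \<in> A" "z \<in> isum A G" "z \<in> G'" by (auto elim: isumE)
    have "z \<in> isum (G' \<inter> A) (G' \<inter> G)"
      using modular_split[OF iG(2) iA iG(1) graded_locally_unital[OF G(1)]] yz by blast
    then have "z \<in> A" using G(3) idl_add[OF iA] by (auto elim!: isumE)
    then show "x \<in> A" using yz idl_add[OF iA] by blast
  qed
  then have "isum A G \<inter> isum A G' = A" using isum_subset[OF iA] iG by blast
  then have "isum A G = A \<or> isum A G' = A" using A S unfolding irred_idl_def by blast
  then have "G \<subseteq> A \<or> G' \<subseteq> A" using isum_subset(2)[OF iA] iG by blast
  then show ?thesis using graded_subset_gr[OF _ iA] G by blast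
qed

text \<open>Here \<open>gr A\<close> equals J, so whatever A has beyond J must show up as a
  polynomial in an exitless cycle.\<close>

lemma nongraded_poly:
  assumes J: "graded J" and A: "idl C A" "J \<subseteq> A" "\<not> A \<subseteq> J" "gr A \<subseteq> J"
  obtains c p where "exitless J c" "pc c p \<in> A" "pc c p \<notin> J"
proof -
  have "gr A = J" using graded_subset_gr[OF J A(1,2)] A(4) by blast
  then show thesis using ideal_structure[OF A(1) graded_idl[OF J]] A(3) that by blast
qed

lemma exitless_vert_ideal: "exitless J c \<Longrightarrow> \<not> vert_ideal (base c) \<subseteq> J"
  using vert_ideal(4) closed_pathD(2) unfolding exitless_def by blast

lemma exitless_graded_poly:
  assumes "graded J" "exitless J c" "pc c p \<in> J"
  shows "p = 0"
  using graded_pc assms unfolding exitless_def by blast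

text \<open>If B has no graded excess over \<open>gr A\<close>, a polynomial p(c) of B stands in for
  it: G meets the ideal of the base of c in some y congruent to q(c) with q non-zero, and p(c) y is
  congruent to (p q)(c), which is not in \<open>gr A\<close>.\<close>

lemma irred_inter_graded:
  assumes A: "irred_idl A" and B: "idl C B" "gr A \<subseteq> B" "\<not> B \<subseteq> gr A"
    and G: "graded G" "\<not> G \<subseteq> gr A"
  shows "\<not> B \<inter> G \<subseteq> gr A"
proof -
  have iA: "idl C A" using A unfolding irred_idl_def by blast
  have grA: "gr A \<subseteq> A" using gr_subset iA by blast
  show ?thesis
  proof (cases "gr B \<subseteq> gr A")
    case False
    then have "\<not> gr B \<inter> G \<subseteq> A" using irred_graded[OF A gr_graded G(1)] G(2) by blast
    then show ?thesis using gr_subset[OF B(1)] grA by blast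
  next
    case True
    then obtain c p where c: "exitless (gr A) c" "pc c p \<in> B" "pc c p \<notin> gr A"
      using nongraded_poly[OF gr_graded B] by blast
    have cp: "closed_path c" using exitless_closed_path c by blast
    let ?M = "vert_ideal (base c)"
    have M: "graded ?M" "idl C ?M" using vert_ideal closed_pathD(2)[OF cp] by blast+
    have "\<not> ?M \<inter> G \<subseteq> A" using irred_graded[OF A M(1) G(1)] exitless_vert_ideal[OF c(1)] G(2) by blast
    then have "\<not> (?M \<inter> G) \<inter> ?M \<subseteq> gr A" using grA by blast
    then obtain y q where y: "y \<in> ?M \<inter> G" "y - pc c q \<in> gr A" "q \<noteq> 0"
      using corner_element[OF idl_gr c(1) idl_Int[OF M(2) graded_idl[OF G(1)]]] by blast
    have "pc c p * y \<in> B" "pc c p * y \<in> G"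
      using y c idl_lmult[OF graded_idl[OF G(1)]] idl_rmult[OF B(1)] by blast+
    moreover have "pc c p * y \<notin> gr A"
    proof
      assume "pc c p * y \<in> gr A"
      moreover have "pc c p * y - pc c (p * q) \<in> gr A"
        using idl_lmult[OF idl_gr y(2)] pc_mult[OF cp] by (simp add: right_diff_distrib)
      ultimately have "pc c (p * q) \<in> gr A" using idl_diff_mem[OF idl_gr] by blast
      then have "p * q = 0" using exitless_graded_poly[OF gr_graded c(1)] by blast
      then show False using y(3) c(3) idl_zero[OF idl_gr] by auto
    qed
    ultimately show ?thesis by blast
  qed
qed

theorem irred_gr_prime:
  assumes A: "irred_idl A" "A \<noteq> C"
  shows "prime_idl (gr A)"
  unfolding prime_idl_def
proof (intro conjI allI impI idl_gr)
  have iA: "idl C A" using A unfolding irred_idl_def by blast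
  show "gr A \<noteq> C" using gr_subset[OF iA] A(2) idl_sub[OF iA] by blast
  fix X0 Y0 assume X0: "idl C X0" and Y0: "idl C Y0" and XY: "iprod X0 Y0 \<subseteq> gr A"
  \<comment> \<open>Both ideals are enlarged by \<open>gr A\<close> so that they can be compared
    with it; products of their elements still lie in \<open>gr A\<close>.\<close>
  define X1 Y1 where "X1 = isum X0 (gr A)" and "Y1 = isum Y0 (gr A)"
  have X1: "idl C X1" "gr A \<subseteq> X1" and Y1: "idl C Y1" "gr A \<subseteq> Y1"
    unfolding X1_def Y1_def using X0 Y0 idl_gr idl_isum' isum_subset(2) by blast+
  have XY1: "x * y \<in> gr A" if xy: "x \<in> X1" "y \<in> Y1" for x y
  proof -
    obtain a j where x: "x = a + j" "a \<in> X0" "j \<in> gr A" using xy(1) unfolding X1_def by (rule isumE)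
    obtain b i where y: "y = b + i" "b \<in> Y0" "i \<in> gr A" using xy(2) unfolding Y1_def by (rule isumE)
    have "a * b \<in> gr A" using iprod_base[OF x(2) y(2)] XY by blast
    moreover have "x * y = a * b + (a * i + j * y)" by (simp add: x y algebra_simps)
    ultimately show ?thesis using x y idl_add[OF idl_gr] idl_lmult[OF idl_gr] idl_rmult[OF idl_gr] by simp
  qed
  have "X1 \<subseteq> gr A \<or> Y1 \<subseteq> gr A"
  proof (rule ccontr)
    assume n: "\<not> (X1 \<subseteq> gr A \<or> Y1 \<subseteq> gr A)"
    show False
    proof (cases "gr X1 \<subseteq> gr A")
      case False
      then obtain y where y: "y \<in> Y1" "y \<in> gr X1" "y \<notin> gr A"
        using irred_inter_graded[OF A(1) Y1 _ gr_graded] n by blast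
      \<comment> \<open>The equation y = u y presents y itself as a product of an element of X1 and
        one of Y1.\<close>
      then obtain u where u: "u \<in> gr X1" "u * y = y"
        using gr_locally_unital unfolding locally_unital_def by blast
      then show False using XY1[of u y] y gr_subset[OF X1(1)] by auto
    next
      case True
      then obtain c p where c: "exitless (gr A) c" "pc c p \<in> X1" "pc c p \<notin> gr A"
        using nongraded_poly[OF gr_graded X1] n by blast
      have cp: "closed_path c" using exitless_closed_path c by blast
      have M: "graded (vert_ideal (base c))" using vert_ideal closed_pathD(2)[OF cp] by blast
      have "\<not> Y1 \<inter> vert_ideal (base c) \<subseteq> gr A"
        using irred_inter_graded[OF A(1) Y1 _ M exitless_vert_ideal[OF c(1)]] n by blast
      then obtain y q where y: "y \<in> Y1" "y - pc c q \<in> gr A" "q \<noteq> 0"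
        using corner_element[OF idl_gr c(1) Y1(1)] by blast
      have "pc c p * y \<in> gr A" using XY1 c y by blast
      moreover have "pc c p * y - pc c (p * q) \<in> gr A"
        using idl_lmult[OF idl_gr y(2)] pc_mult[OF cp] by (simp add: right_diff_distrib)
      ultimately have "pc c (p * q) \<in> gr A" using idl_diff_mem[OF idl_gr] by blast
      then have "p * q = 0" using exitless_graded_poly[OF gr_graded c(1)] by blast
      then show False using y(3) c(3) idl_zero[OF idl_gr] by auto
    qed
  qed
  then show "X0 \<subseteq> gr A \<or> Y0 \<subseteq> gr A"
    unfolding X1_def Y1_def using isum_subset(1)[OF X0 idl_gr] isum_subset(1)[OF Y0 idl_gr] by blast
qed

end

section \<open>Primary factorisation of polynomials with non-zero constant term\<close>

text \<open>Primality in the lattice of ideals of \<open>K[x]\<close>; equivalently, being associated to a power of an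
  irreducible polynomial.\<close>

definition lattice_prime :: "'k::field poly \<Rightarrow> bool" where
  "lattice_prime p \<longleftrightarrow> \<not> p dvd 1 \<and>
     (\<forall>a b. (\<forall>r. a dvd r \<longrightarrow> b dvd r \<longrightarrow> p dvd r) \<longrightarrow> p dvd a \<or> p dvd b)"

lemma prime_power_split:
  fixes g f :: "'k::field poly"
  assumes "f \<noteq> 0" "degree g > 0"
  obtains n h where "f = g ^ n * h" "\<not> g dvd h"
proof -
  have "\<exists>n h. f = g ^ n * h \<and> \<not> g dvd h"
    using assms(1)
  proof (induction "degree f" arbitrary: f rule: less_induct)
    case less
    show ?case
    proof (cases "g dvd f")
      case True
      then obtain f' where f': "f = g * f'" by blast
      then have "f' \<noteq> 0" "degree f' < degree f"
        using less.prems assms(2) degree_mult_eq[of g f'] by auto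
      then obtain n h where "f' = g ^ n * h" "\<not> g dvd h" using less.hyps by blast
      then have "f = g ^ Suc n * h" using f' by (simp add: mult.assoc)
      then show ?thesis using \<open>\<not> g dvd h\<close> by blast
    next
      case False
      then show ?thesis by (intro exI[of _ 0] exI[of _ f]) simp
    qed
  qed
  then show thesis using that by blast
qed

lemma prime_power_dvd_mult:
  fixes g :: "'k::field poly"
  assumes "prime_elem g" "\<not> g dvd h" "g ^ n dvd h * r"
  shows "g ^ n dvd r"
  using assms(3)
proof (induction n)
  case (Suc n)
  then have "g ^ n dvd h * r" by (metis dvd_mult_left power_Suc2)
  then obtain s where s: "r = g ^ n * s" using Suc.IH by blast
  have "g ^ n * g dvd g ^ n * (h * s)" using Suc.prems s by (simp add: mult_ac)
  then have "g dvd h * s" using assms(1) by (simp add: prime_elem_not_zeroI)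
  then have "g dvd s" using assms(1,2) prime_elem_dvd_mult_iff by blast
  then show ?case using s by (simp add: mult_dvd_mono mult.commute)
qed simp

text \<open>If g^n divides neither a nor b, their g-parts are g^i and g^j with i, j < n, and the
  common multiple g^max(i,j) a' b' is not divisible by g^n. The unit u absorbs the constant left
  over by a factorisation.\<close>

lemma lattice_prime_power:
  fixes g :: "'k::field poly"
  assumes g: "prime_elem g" "degree g > 0" and n: "n > 0" and u: "u dvd 1"
  shows "lattice_prime (g ^ n * u)"
  unfolding lattice_prime_def
proof (intro conjI allI impI)
  have "\<not> g dvd 1" using g(1) unfolding prime_elem_def by blast
  moreover have "g dvd g ^ n * u" using n by (simp add: dvd_power)
  ultimately show "\<not> g ^ n * u dvd 1" using dvd_trans by blast
  fix a b assume ab: "\<forall>r. a dvd r \<longrightarrow> b dvd r \<longrightarrow> g ^ n * u dvd r"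
  have un: "g ^ n * u dvd r \<longleftrightarrow> g ^ n dvd r" for r using u by (simp add: mult_unit_dvd_iff)
  show "g ^ n * u dvd a \<or> g ^ n * u dvd b"
  proof (rule ccontr)
    assume "\<not> (g ^ n * u dvd a \<or> g ^ n * u dvd b)"
    then have nd: "\<not> g ^ n dvd a" "\<not> g ^ n dvd b" using un by auto
    then have "a \<noteq> 0" "b \<noteq> 0" by auto
    then obtain i a' j b' where a: "a = g ^ i * a'" "\<not> g dvd a'" and b: "b = g ^ j * b'" "\<not> g dvd b'"
      using prime_power_split[OF _ g(2)] by metis
    have ij: "i < n" "j < n" using nd a b by (meson dvd_triv_left le_imp_power_dvd dvd_trans not_less)+
    define l where "l = g ^ max i j * (a' * b')"
    have "a dvd l" "b dvd l" unfolding l_def a b by (intro mult_dvd_mono le_imp_power_dvd; simp)+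
    then have "g ^ n dvd a' * b' * g ^ max i j" using ab un unfolding l_def by (simp add: mult.commute)
    moreover have "\<not> g dvd a' * b'" using g a b prime_elem_dvd_mult_iff by blast
    ultimately have "g ^ n dvd g ^ max i j" using prime_power_dvd_mult g by blast
    then have "degree (g ^ n) \<le> degree (g ^ max i j)" using g(1) by (intro dvd_imp_degree_le) auto
    then show False using ij g(2) g(1) by (simp add: degree_power_eq prime_elem_not_zeroI)
  qed
qed

lemma exists_prime_divisor:
  fixes f :: "'k::field poly"
  assumes "degree f > 0"
  obtains g where "prime_elem g" "degree g > 0" "g dvd f"
proof -
  obtain g where g: "g dvd f" "degree g > 0" "\<And>h. h dvd f \<Longrightarrow> degree h > 0 \<Longrightarrow> degree g \<le> degree h"
    using ex_has_least_nat[of "\<lambda>g. g dvd f \<and> degree g > 0" f degree] assms by auto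
  have "irreducible g"
  proof (rule irreducibleI)
    show "g \<noteq> 0" using g by auto
    then show "\<not> g dvd 1" using g(2) by (simp add: is_unit_iff_degree)
    fix a b assume ab: "g = a * b"
    then have nz: "a \<noteq> 0" "b \<noteq> 0" using g(2) by auto
    then have deg: "degree g = degree a + degree b" using ab degree_mult_eq by blast
    have "a dvd f" "b dvd f" using ab g(1) by (auto intro: dvd_trans)
    then have "degree a = 0 \<or> degree b = 0" using g(3)[of a] g(3)[of b] deg by linarith
    then show "a dvd 1 \<or> b dvd 1" using nz by (simp add: is_unit_iff_degree)
  qed
  then show thesis using that g field_poly_irreducible_imp_prime by blast
qed

text \<open>The factors belong to distinct primes. That their product is f serves the product of
  ideals; the last property makes f their least common multiple and serves the intersection.\<close>

lemma lattice_prime_factorisation: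
  fixes f :: "'k::field poly"
  assumes "degree f > 0"
  obtains ps where "ps \<noteq> []" "\<And>p. p \<in> set ps \<Longrightarrow> lattice_prime p" "prod_list ps = f"
    "\<And>r. (\<And>p. p \<in> set ps \<Longrightarrow> p dvd r) \<Longrightarrow> f dvd r"
proof -
  have "\<exists>ps. ps \<noteq> [] \<and> (\<forall>p\<in>set ps. lattice_prime p) \<and> prod_list ps = f \<and>
      (\<forall>r. (\<forall>p\<in>set ps. p dvd r) \<longrightarrow> f dvd r)" (is "\<exists>ps. ?P ps")
    using assms
  proof (induction "degree f" arbitrary: f rule: less_induct)
    case less
    obtain g where g: "prime_elem g" "degree g > 0" "g dvd f" using exists_prime_divisor[OF less.prems] by blast
    have f0: "f \<noteq> 0" using less.prems by auto
    obtain n h where h: "f = g ^ n * h" "\<not> g dvd h" using prime_power_split[OF f0 g(2)] by blast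
    have n: "n > 0" using g h by (cases n) auto
    show ?case
    proof (cases "degree h = 0")
      case True
      then have "h dvd 1" using h f0 by (auto simp: is_unit_iff_degree)
      then show ?thesis
        using lattice_prime_power[OF g(1,2) n] h by (intro exI[of _ "[f]"]) auto
    next
      case False
      have "g ^ n \<noteq> 0" "h \<noteq> 0" using f0 h by auto
      then have "degree f = degree (g ^ n) + degree h" using h degree_mult_eq by blast
      moreover have "degree (g ^ n) > 0" using g n by (simp add: degree_power_eq prime_elem_not_zeroI)
      ultimately obtain ps where ps: "ps \<noteq> []" "\<forall>p\<in>set ps. lattice_prime p" "prod_list ps = h"
        "\<And>r. (\<forall>p\<in>set ps. p dvd r) \<Longrightarrow> h dvd r"
        using less.hyps[of h] False by auto
      have "f dvd r" if r: "\<forall>p\<in>set (g ^ n # ps). p dvd r" for r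
      proof -
        have "h dvd r" using ps(4) r by simp
        then obtain s where s: "r = h * s" by blast
        then have "g ^ n dvd s" using prime_power_dvd_mult[OF g(1) h(2), of n s] r by simp
        then show ?thesis using s h by (simp add: mult.commute mult_dvd_mono)
      qed
      moreover have "lattice_prime (g ^ n)" using lattice_prime_power[OF g(1,2) n, of 1] by simp
      ultimately show ?thesis using ps h by (intro exI[of _ "g ^ n # ps"]) auto
    qed
  qed
  then obtain ps where "?P ps" by blast
  then show thesis by (intro that[of ps]) auto
qed

text \<open>A non-zero constant term makes p coprime to x. This is how divisibility in the Laurent
  ring returns to K[x].\<close>

lemma dvd_mult_monom_cancel:
  fixes p r :: "'k::field poly"
  assumes "coeff p 0 \<noteq> 0" "p dvd r * monom 1 n"
  shows "p dvd r"
  using assms(2)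
proof (induction n)
  case (Suc n)
  have "r * monom 1 (Suc n) = pCons 0 (r * monom 1 n)" by (simp add: monom_Suc mult_pCons_right)
  then obtain s where s: "pCons 0 (r * monom 1 n) = p * s" using Suc.prems by auto
  have "coeff (p * s) 0 = 0" unfolding s[symmetric] by simp
  then have "coeff s 0 = 0" using assms(1) by (simp add: coeff_mult)
  then obtain s' where "s = pCons 0 s'" by (cases s) auto
  then have "pCons 0 (r * monom 1 n) = pCons 0 (p * s')" using s by (simp add: mult_pCons_right)
  then have "r * monom 1 n = p * s'" by simp
  then show ?case using Suc.IH by simp
qed simp

context leavitt
begin

subsection \<open>Ideals over a graded prime ideal\<close>

lemma prime_idlD: "prime_idl P \<Longrightarrow> idl C P"
  unfolding prime_idl_def by blast

lemma prime_inter: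
  assumes "prime_idl P" "idl C A" "idl C B" "A \<inter> B \<subseteq> P"
  shows "A \<subseteq> P \<or> B \<subseteq> P"
  using assms iprod_subset[OF assms(2,3)] unfolding prime_idl_def by blast

lemma prime_sirred: "prime_idl P \<Longrightarrow> sirred_idl P"
  unfolding sirred_idl_def using prime_inter prime_idlD by blast

text \<open>Inside the ideal of the base only the corner counts. A corner element of A becomes a
  polynomial modulo J after multiplication by a power of c, and the power is cancelled once the
  product is known to lie in B.\<close>

lemma corner_generated:
  assumes J: "idl C J" and c: "exitless J c" and A: "idl C A" "J \<subseteq> A" and B: "idl C B" "J \<subseteq> B"
    and AB: "\<And>r. pc c r \<in> A \<Longrightarrow> pc c r \<in> B"
  shows "A \<inter> vert_ideal (base c) \<subseteq> B"
proof (rule corner_subset[OF _ A(1) B(1)])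
  let ?v = "base c"
  show v: "?v \<in> verts E" using closed_pathD(2) exitless_closed_path[OF c] by blast
  fix y assume y: "y \<in> A"
  obtain n r where nr: "V ?v * y * V ?v * pc c (monom 1 n) - pc c r \<in> J"
    using corner_poly[OF J c] y idl_sub[OF A(1)] by blast
  have "V ?v * y * V ?v * pc c (monom 1 n) \<in> A"
    using y idl_lmult[OF A(1)] idl_rmult[OF A(1)] by blast
  then have "pc c r \<in> B" using AB nr A idl_diff_mem by blast
  then have "V ?v * y * V ?v * pc c (monom 1 n) \<in> B" using nr B idl_diff_mem by blast
  then show "V ?v * y * V ?v \<in> B"
    using exitless_cancel[OF J B c] V_idem[OF v] by (simp add: mult.assoc)
qed

text \<open>A graded ideal that avoids the base of c contains no non-zero polynomial in c, so inside
  the ideal of that base it adds nothing to J.\<close>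

lemma prime_vert_inter:
  assumes J: "idl C J" "J \<subseteq> P" and P: "graded P" and c: "exitless J c" "V (base c) \<notin> P"
  shows "P \<inter> vert_ideal (base c) \<subseteq> J"
proof (rule corner_generated[OF J(1) c(1) graded_idl[OF P] J(2) J(1) order_refl])
  fix r assume "pc c r \<in> P"
  then have "r = 0" using graded_pc[OF P exitless_closed_path[OF c(1)] c(2)] by blast
  then show "pc c r \<in> J" using idl_zero[OF J(1)] by simp
qed

text \<open>By primeness \<open>gr A\<close> meets the ideal of the base outside P and so contains a
  non-zero polynomial in c; being graded, it then contains the base.\<close>

lemma nongraded_vert:
  assumes P: "graded P" "prime_idl P" and c: "exitless P c" and A: "idl C A" "P \<subseteq> A" "\<not> gr A \<subseteq> P"
  shows "V (base c) \<in> A"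
proof -
  have cp: "closed_path c" using exitless_closed_path c by blast
  have M: "idl C (vert_ideal (base c))" using vert_ideal closed_pathD(2)[OF cp] by blast
  have "\<not> gr A \<inter> vert_ideal (base c) \<subseteq> P"
    using prime_inter[OF P(2) idl_gr M] A(3) exitless_vert_ideal[OF c] by blast
  then obtain y q where y: "y \<in> gr A" "y - pc c q \<in> P" "q \<noteq> 0"
    using corner_element[OF graded_idl[OF P(1)] c idl_gr] by blast
  have "P \<subseteq> gr A" using graded_subset_gr[OF P(1) A(1,2)] .
  then have "pc c q \<in> gr A" using y idl_diff_mem[OF idl_gr] by blast
  then have "V (base c) \<in> gr A" using graded_pc[OF gr_graded cp] y(3) by blast
  then show ?thesis using gr_subset[OF A(1)] by blast
qed

text \<open>Used with both orders of c and d, this makes the two bases generate the same ideal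
  modulo P: over a graded prime there is essentially one exitless cycle.\<close>

lemma vert_in_other:
  assumes P: "graded P" "prime_idl P" and c: "exitless P c" and d: "exitless P d"
  shows "V (base d) \<in> isum (vert_ideal (base c)) P"
proof (rule nongraded_vert[OF P d])
  have M: "idl C (vert_ideal (base c))" "graded (vert_ideal (base c))"
    using vert_ideal closed_pathD(2)[OF exitless_closed_path[OF c]] by blast+
  note iP = graded_idl[OF P(1)]
  show A: "idl C (isum (vert_ideal (base c)) P)" using idl_isum' M iP by blast
  show "P \<subseteq> isum (vert_ideal (base c)) P" using isum_subset(2)[OF M(1) iP] .
  have "vert_ideal (base c) \<subseteq> gr (isum (vert_ideal (base c)) P)"
    using graded_subset_gr[OF M(2) A] isum_subset(1)[OF M(1) iP] by blast
  then show "\<not> gr (isum (vert_ideal (base c)) P) \<subseteq> P" using exitless_vert_ideal[OF c] by blast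
qed

text \<open>The graded part of A is P, and polynomials in any other exitless cycle lie in P plus the
  ideal of the base of c; so the polynomials in c determine A.\<close>

lemma over_prime_generated:
  assumes P: "graded P" "prime_idl P" and c: "exitless P c" and A: "idl C A" "P \<subseteq> A" "V (base c) \<notin> A"
    and B: "idl C B" "P \<subseteq> B" "\<And>r. pc c r \<in> A \<Longrightarrow> pc c r \<in> B"
  shows "A \<subseteq> B"
proof -
  note iP = graded_idl[OF P(1)]
  have "gr A \<subseteq> P" using nongraded_vert[OF P c A(1,2)] A(3) by blast
  then have grA: "gr A = P" using graded_subset_gr[OF P(1) A(1,2)] by blast
  have M: "idl C (vert_ideal (base c))"
    using vert_ideal closed_pathD(2)[OF exitless_closed_path[OF c]] by blast
  have AM: "A \<inter> vert_ideal (base c) \<subseteq> B" using corner_generated[OF iP c A(1,2) B] .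
  show ?thesis
  proof (rule ideal_structure[OF A(1) B(1)])
    show "gr A \<subseteq> B" using grA B by simp
    fix d p assume d: "exitless (gr A) d" "pc d p \<in> A"
    then have "V (base d) \<in> isum (vert_ideal (base c)) P" using vert_in_other[OF P c] grA by simp
    then have "V (base d) * pc d p \<in> isum (vert_ideal (base c)) P"
      using idl_rmult[OF idl_isum'[OF M iP]] by blast
    then have "pc d p \<in> isum (vert_ideal (base c)) P" using V_pc[OF exitless_closed_path[OF d(1)]] by simp
    then have "pc d p \<in> isum (A \<inter> vert_ideal (base c)) (A \<inter> P)"
      using modular_split[OF A(1) M iP graded_locally_unital[OF P(1)] d(2)] by blast
    then obtain a b where ab: "pc d p = a + b" "a \<in> A \<inter> vert_ideal (base c)" "b \<in> A \<inter> P" by (rule isumE)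
    then have "a \<in> B" "b \<in> B" using AM B(2) by blast+
    then show "pc d p \<in> B" using ab(1) idl_add[OF B(1)] by simp
  qed
qed

text \<open>f is a non-zero polynomial of least degree, or 0 if A contains none; division with
  remainder does the rest.\<close>

lemma principal_generator:
  assumes A: "idl C A" and c: "closed_path c"
  obtains f where "\<And>p. pc c p \<in> A \<longleftrightarrow> f dvd p" "f \<noteq> 0 \<Longrightarrow> coeff f 0 \<noteq> 0"
proof (cases "\<exists>p. p \<noteq> 0 \<and> pc c p \<in> A")
  case False
  then have "pc c p \<in> A \<longleftrightarrow> 0 dvd p" for p using idl_zero[OF A] by auto
  then show thesis using that by blast
next
  case True
  then obtain p0 where "p0 \<noteq> 0 \<and> pc c p0 \<in> A" by blast
  then obtain f where f: "f \<noteq> 0" "pc c f \<in> A" "\<And>p. p \<noteq> 0 \<Longrightarrow> pc c p \<in> A \<Longrightarrow> degree f \<le> degree p"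
    using ex_has_least_nat[of "\<lambda>p. p \<noteq> 0 \<and> pc c p \<in> A" p0 degree] by blast
  have "pc c p \<in> A \<longleftrightarrow> f dvd p" for p
  proof
    assume "f dvd p"
    then show "pc c p \<in> A" using f(2) idl_rmult[OF A] by (auto elim!: dvdE simp: pc_mult[OF c])
  next
    assume p: "pc c p \<in> A"
    have "pc c (f * (p div f)) \<in> A" using idl_rmult[OF A f(2)] by (simp add: pc_mult[OF c])
    then have "pc c (p - f * (p div f)) \<in> A" using p idl_diff[OF A] by (simp add: pc_diff)
    then have "pc c (p mod f) \<in> A" by (simp add: minus_mult_div_eq_mod)
    then have "p mod f = 0" using f(3)[of "p mod f"] degree_mod_less[OF f(1), of p] by fastforce
    then show "f dvd p" by auto
  qed
  moreover have "coeff f 0 \<noteq> 0"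
  proof
    assume "coeff f 0 = 0"
    then obtain g where g: "f = pCons 0 g" by (cases f) auto
    \<comment> \<open>If x divided f, multiplication by c* would cancel it and lower the
      degree.\<close>
    have "pg (base c) c * pc c f = pc c g"
      using pg_pe[OF closed_pathD(1)[OF c]] V_pc[OF c] by (simp add: g pc_pCons mult.assoc[symmetric])
    then have "pc c g \<in> A" using idl_lmult[OF A f(2)] by metis
    moreover have "g \<noteq> 0" using f(1) g by auto
    ultimately show False using f(3)[of g] g by simp
  qed
  ultimately show thesis using that by blast
qed

definition poly_over :: "'a set \<Rightarrow> 'e list \<Rightarrow> 'k poly \<Rightarrow> 'a set" where
  "poly_over P c p = isum P (gen C {pc c p})"

lemma poly_over:
  assumes "idl C P" "closed_path c"
  shows "idl C (poly_over P c p)" "P \<subseteq> poly_over P c p" "p dvd q \<Longrightarrow> pc c q \<in> poly_over P c p"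
proof -
  have g: "idl C (gen C {pc c p})" using idl_gen pc_C assms(2) by simp
  show "idl C (poly_over P c p)" "P \<subseteq> poly_over P c p"
    unfolding poly_over_def using idl_isum' isum_subset(1) assms(1) g by blast+
  assume "p dvd q"
  then have "pc c q \<in> gen C {pc c p}"
    using gen_superset[of "{pc c p}" C] idl_rmult[OF g] by (auto elim!: dvdE simp: pc_mult[OF assms(2)])
  then show "pc c q \<in> poly_over P c p" unfolding poly_over_def using isum_subset(2)[OF assms(1) g] by blast
qed

lemma poly_over_least:
  assumes "idl C J" "P \<subseteq> J" "pc c p \<in> J"
  shows "poly_over P c p \<subseteq> J"
  unfolding poly_over_def using assms gen_least[of C J "{pc c p}"] by (intro isum_least) auto

lemma poly_over_dvd:
  assumes P: "graded P" and c: "exitless P c" and p: "coeff p 0 \<noteq> 0" and r: "pc c r \<in> poly_over P c p"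
  shows "p dvd r"
proof -
  note iP = graded_idl[OF P]
  have cp: "closed_path c" using exitless_closed_path c by blast
  let ?v = "base c"
  let ?K = "\<lambda>x. V ?v * x * V ?v"
  have v: "?v \<in> verts E" using closed_pathD cp by blast
  have mon: "pc c (monom 1 (m + n)) = pc c (monom 1 m) * pc c (monom 1 n)" for m n
    using pc_mult[OF cp, of "monom 1 m" "monom 1 n"] by (simp add: mult_monom)
  have "\<exists>n s. ?K z * pc c (monom 1 n) - pc c (p * s) \<in> P" if z: "z \<in> gen C {pc c p}" for z
  proof -
    have "z \<in> aspan {x * g * y |x g y. x \<in> C \<and> g \<in> {pc c p} \<and> y \<in> C}"
      using gen_span'[of "{pc c p}"] z pc_C[OF cp] by auto
    then show ?thesis
    proof induction
      case aspan_zero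
      show ?case using idl_zero[OF iP] by (intro exI[of _ 0]) simp
    next
      case (aspan_add b x)
      then obtain n s where ns: "?K x * pc c (monom 1 n) - pc c (p * s) \<in> P" by blast
      obtain a d where b: "b = a * pc c p * d" "a \<in> C" "d \<in> C" using aspan_add by blast
      obtain i \<alpha> where i: "?K a * pc c (monom 1 i) - pc c \<alpha> \<in> P" using corner_poly[OF iP c b(2)] by blast
      obtain j \<beta> where j: "?K d * pc c (monom 1 j) - pc c \<beta> \<in> P" using corner_poly[OF iP c b(3)] by blast
      have VpV: "V ?v * (pc c p * V ?v) = pc c p" using pc_V[OF cp] V_pc[OF cp] by simp
      have "?K a * pc c p * ?K d = V ?v * a * (V ?v * (pc c p * V ?v)) * d * V ?v"
        by (simp add: mult.assoc)
      also have "\<dots> = ?K b" by (simp only: VpV b(1) mult.assoc)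
      finally have "?K b = ?K a * pc c p * ?K d" by (rule sym)
      \<comment> \<open>The outer factors become polynomials one at a time, first the right one and
        then the left one; both errors lie in P.\<close>
      then have 1: "?K b * pc c (monom 1 (j + i)) - ?K a * pc c (monom 1 i) * pc c (p * \<beta>)
          = ?K a * pc c p * (?K d * pc c (monom 1 j) - pc c \<beta>) * pc c (monom 1 i)"
        using pc_commute[OF cp, of "monom 1 i" "p * \<beta>"]
        by (simp add: mon pc_mult[OF cp] right_diff_distrib left_diff_distrib mult.assoc)
      have 2: "?K a * pc c (monom 1 i) * pc c (p * \<beta>) - pc c (p * (\<alpha> * \<beta>))
          = (?K a * pc c (monom 1 i) - pc c \<alpha>) * pc c (p * \<beta>)"
        using pc_mult[OF cp, of \<alpha> "p * \<beta>"] by (simp add: left_diff_distrib mult_ac)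
      have bP: "?K b * pc c (monom 1 (j + i)) - pc c (p * (\<alpha> * \<beta>)) \<in> P"
        by (rule idl_diff_trans[OF iP, of _ "?K a * pc c (monom 1 i) * pc c (p * \<beta>)"])
           (unfold 1 2, rule idl_rmult[OF iP idl_lmult[OF iP j]], rule idl_rmult[OF iP i])
      let ?l = "j + i"
      have "?K (b + x) * pc c (monom 1 (?l + n)) - pc c (p * (\<alpha> * \<beta> * monom 1 n + s * monom 1 ?l))
          = (?K b * pc c (monom 1 ?l) - pc c (p * (\<alpha> * \<beta>))) * pc c (monom 1 n)
            + (?K x * pc c (monom 1 n) - pc c (p * s)) * pc c (monom 1 ?l)"
      proof -
        have "pc c (p * (\<alpha> * \<beta> * monom 1 n + s * monom 1 ?l))
            = pc c (p * (\<alpha> * \<beta>)) * pc c (monom 1 n) + pc c (p * s) * pc c (monom 1 ?l)"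
          by (simp add: pc_mult[OF cp, symmetric] pc_add[symmetric] algebra_simps)
        moreover have "?K (b + x) * pc c (monom 1 (?l + n))
            = ?K b * pc c (monom 1 ?l) * pc c (monom 1 n) + ?K x * pc c (monom 1 n) * pc c (monom 1 ?l)"
          using mon[of ?l n] mon[of n ?l] by (simp add: distrib_left distrib_right mult.assoc add.commute)
        ultimately show ?thesis by (simp add: left_diff_distrib)
      qed
      moreover have "\<dots> \<in> P" using bP ns idl_add[OF iP] idl_rmult[OF iP] by blast
      ultimately show ?case by metis
    qed
  qed
  moreover obtain a z where az: "pc c r = a + z" "a \<in> P" "z \<in> gen C {pc c p}"
    using r unfolding poly_over_def by (rule isumE)
  ultimately obtain n s where ns: "?K z * pc c (monom 1 n) - pc c (p * s) \<in> P" by blast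
  have "pc c r = ?K (pc c r)" using pc_V[OF cp] V_pc[OF cp] by (simp add: mult.assoc)
  then have "pc c r * pc c (monom 1 n) = ?K a * pc c (monom 1 n) + ?K z * pc c (monom 1 n)"
    using az(1) by (simp add: distrib_left distrib_right)
  moreover have "?K a * pc c (monom 1 n) \<in> P" using az(2) idl_lmult[OF iP] idl_rmult[OF iP] by blast
  ultimately have "pc c r * pc c (monom 1 n) - pc c (p * s) \<in> P"
    using idl_add[OF iP _ ns] by (simp add: add_diff_eq)
  then have "pc c (r * monom 1 n - p * s) \<in> P" by (simp add: pc_mult[OF cp] pc_diff)
  then have "r * monom 1 n - p * s = 0" using exitless_graded_poly[OF P c] by blast
  then show ?thesis using dvd_mult_monom_cancel[OF p] by (metis dvd_triv_left eq_iff_diff_eq_0)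
qed

theorem poly_over_sirred:
  assumes P: "graded P" "prime_idl P" and c: "exitless P c" and p: "lattice_prime p" "coeff p 0 \<noteq> 0"
  shows "sirred_idl (poly_over P c p)"
  unfolding sirred_idl_def
proof (intro conjI allI impI)
  note iP = graded_idl[OF P(1)]
  have cp: "closed_path c" using exitless_closed_path c by blast
  let ?Q = "poly_over P c p"
  note Q = poly_over[OF iP cp, of p]
  show "idl C ?Q" using Q by blast
  fix A0 B0 assume A0: "idl C A0" and B0: "idl C B0" and AB0: "A0 \<inter> B0 \<subseteq> ?Q"
  \<comment> \<open>Adding P to both ideals keeps their intersection inside \<open>?Q\<close>, by
    two modular splits; afterwards both contain P, as \<open>over_prime_generated\<close>
    demands.\<close>
  define A B where "A = isum A0 P" and "B = isum B0 P"
  have A: "idl C A" "P \<subseteq> A" "A0 \<subseteq> A" and B: "idl C B" "P \<subseteq> B" "B0 \<subseteq> B"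
    unfolding A_def B_def using A0 B0 iP idl_isum' isum_subset by blast+
  note lu = graded_locally_unital[OF P(1)]
  have AB: "x \<in> ?Q" if x: "x \<in> A" "x \<in> B" for x
  proof -
    have "x \<in> isum (A \<inter> B0) (A \<inter> P)" using modular_split[OF A(1) B0 iP lu x(1)] x(2) unfolding B_def .
    then obtain y z where yz: "x = y + z" "y \<in> A" "y \<in> B0" "z \<in> P" by (auto elim: isumE)
    have "y \<in> isum (B0 \<inter> A0) (B0 \<inter> P)" using modular_split[OF B0 A0 iP lu yz(3)] yz(2) unfolding A_def .
    then have "y \<in> ?Q" using AB0 Q(2) idl_add[OF Q(1)] by (auto elim!: isumE)
    then show ?thesis using yz Q(2) idl_add[OF Q(1)] by blast
  qed
  have sub: "D \<subseteq> ?Q" if D: "idl C D" "P \<subseteq> D" "V (base c) \<notin> D" "\<And>r. pc c r \<in> D \<Longrightarrow> pc c r \<in> ?Q" for D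
    using over_prime_generated[OF P c D(1-3) Q(1,2) D(4)] .
  have "A \<subseteq> ?Q \<or> B \<subseteq> ?Q"
  proof (cases "V (base c) \<in> A \<or> V (base c) \<in> B")
    case True
    \<comment> \<open>The base is not in \<open>?Q\<close>, as p is not a unit, so exactly one of
      the two ideals contains it. That one contains all polynomials in c, hence those of the other
      lie in \<open>?Q\<close>.\<close>
    have "pc c 1 = V (base c)" using pc_const[of c 1] by (simp add: sc_one one_pCons)
    moreover have "\<not> p dvd 1" using p unfolding lattice_prime_def by blast
    ultimately have "V (base c) \<notin> ?Q" using poly_over_dvd[OF P(1) c p(2), of 1] by auto
    then have *: "V (base c) \<notin> A \<or> V (base c) \<notin> B" using AB by blast
    have **: "pc c r \<in> D" if "V (base c) \<in> D" "idl C D" for r D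
      using that V_pc[OF cp] idl_rmult by metis
    show ?thesis using True * sub[OF A(1,2)] sub[OF B(1,2)] AB **[OF _ A(1)] **[OF _ B(1)] by blast
  next
    case False
    obtain a where a: "\<And>q. pc c q \<in> A \<longleftrightarrow> a dvd q" using principal_generator[OF A(1) cp] by metis
    obtain b where b: "\<And>q. pc c q \<in> B \<longleftrightarrow> b dvd q" using principal_generator[OF B(1) cp] by metis
    have "p dvd r" if "a dvd r" "b dvd r" for r
      using AB a b that poly_over_dvd[OF P(1) c p(2)] by blast
    then have "p dvd a \<or> p dvd b" using p(1) unfolding lattice_prime_def by blast
    then show ?thesis
      using sub[OF A(1,2)] sub[OF B(1,2)] False a b Q(3) by (meson dvd_trans)
  qed
  then show "A0 \<subseteq> ?Q \<or> B0 \<subseteq> ?Q" using A B by blast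
qed

text \<open>An element of one \<open>poly_over P c p\<close> lies in P up to a summand in the ideal
  of the base. That summand belongs to the whole intersection, and there polynomials decide.\<close>

lemma poly_over_Inter:
  assumes P: "graded P" and c: "exitless P c" and S: "S \<noteq> {}" "\<And>p. p \<in> S \<Longrightarrow> coeff p 0 \<noteq> 0"
    and f: "\<And>r. (\<And>p. p \<in> S \<Longrightarrow> p dvd r) \<Longrightarrow> f dvd r"
  shows "(\<Inter>p\<in>S. poly_over P c p) \<subseteq> poly_over P c f"
proof
  note iP = graded_idl[OF P]
  have cp: "closed_path c" using exitless_closed_path c by blast
  note Q = poly_over[OF iP cp]
  let ?A = "\<Inter>p\<in>S. poly_over P c p"
  have A: "idl C ?A" using S(1) Q by (intro idl_Inter) auto
  have PA: "P \<subseteq> ?A" using Q(2) by blast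
  have AM: "?A \<inter> vert_ideal (base c) \<subseteq> poly_over P c f"
  proof (rule corner_generated[OF iP c A PA Q(1,2)])
    fix r assume "pc c r \<in> ?A"
    then have "p dvd r" if "p \<in> S" for p using that poly_over_dvd[OF P c S(2)] by blast
    then have "f dvd r" by (rule f)
    then show "pc c r \<in> poly_over P c f" using Q(3) by blast
  qed
  fix x assume x: "x \<in> ?A"
  obtain p where p: "p \<in> S" using S by blast
  obtain a b where ab: "x = a + b" "a \<in> P" "b \<in> gen C {pc c p}"
    using x p unfolding poly_over_def by (blast elim: isumE)
  have M: "idl C (vert_ideal (base c))" "V (base c) \<in> vert_ideal (base c)"
    using vert_ideal closed_pathD(2)[OF cp] by blast+
  have "pc c p \<in> vert_ideal (base c)" using V_pc[OF cp] idl_rmult[OF M] by metis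
  then have bM: "b \<in> vert_ideal (base c)" using gen_least[OF M(1), of "{pc c p}"] ab(3) by auto
  have "b = x - a" using ab by simp
  then have "b \<in> ?A" using idl_diff[OF A x subsetD[OF PA ab(2)]] by simp
  then have "b \<in> poly_over P c f" using AM bM by blast
  then show "x \<in> poly_over P c f" unfolding ab(1) using idl_add[OF Q(1) subsetD[OF Q(2) ab(2)]] by blast
qed

end

lemma dvd_prod_list: "p \<in> set ps \<Longrightarrow> (p::'b::comm_monoid_mult) dvd prod_list ps"
  by (induction ps) auto

context leavitt
begin

subsection \<open>Finite decompositions\<close>

definition prime_decomposition :: "'a set \<Rightarrow> nat \<Rightarrow> (nat \<Rightarrow> 'a set) \<Rightarrow> bool" where
  "prime_decomposition J m P \<longleftrightarrow>
     1 \<le> m \<and> (\<forall>i\<in>{1..m}. graded (P i) \<and> prime_idl (P i)) \<and> J = (\<Inter>i\<in>{1..m}. P i) \<and>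
     (\<forall>j\<in>{1..m}. \<not> (C \<inter> (\<Inter>i\<in>{1..m} - {j}. P i) \<subseteq> P j))"

lemma graded_Inter: "F \<noteq> {} \<Longrightarrow> (\<And>A. A \<in> F \<Longrightarrow> graded A) \<Longrightarrow> graded (\<Inter>F)"
  unfolding graded_def using idl_Inter[of F C] by blast

text \<open>Take a subfamily of least cardinality with the same intersection.\<close>

lemma irredundant_subfamily:
  assumes "finite F" "F \<noteq> {}" "\<And>A. A \<in> F \<Longrightarrow> graded A \<and> prime_idl A"
  shows "\<exists>m P. prime_decomposition (\<Inter>F) m P"
proof -
  define R where "R = (\<lambda>G. G \<subseteq> F \<and> G \<noteq> {} \<and> \<Inter>G = \<Inter>F)"
  have "R F" unfolding R_def using assms(2) by blast
  then obtain G where "R G" and "\<forall>G'. R G' \<longrightarrow> card G \<le> card G'"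
    using ex_has_least_nat[of R F card] by metis
  then have G: "G \<subseteq> F" "G \<noteq> {}" "\<Inter>G = \<Inter>F"
    and min: "\<And>G'. G' \<subseteq> F \<Longrightarrow> G' \<noteq> {} \<Longrightarrow> \<Inter>G' = \<Inter>F \<Longrightarrow> card G \<le> card G'"
    unfolding R_def by simp_all
  have fin: "finite G" using G(1) assms(1) finite_subset by blast
  obtain P where P: "bij_betw P {1..card G} G" using ex_bij_betw_nat_finite_1[OF fin] by blast
  have img: "P ` {1..card G} = G" using P bij_betw_imp_surj_on by blast
  have "\<not> (C \<inter> (\<Inter>i\<in>{1..card G} - {j}. P i) \<subseteq> P j)" if j: "j \<in> {1..card G}" for j
  proof
    assume sub: "C \<inter> (\<Inter>i\<in>{1..card G} - {j}. P i) \<subseteq> P j"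
    have PjG: "P j \<in> G" using img j by blast
    have img': "P ` ({1..card G} - {j}) = G - {P j}"
      using inj_on_image_set_diff[OF bij_betw_imp_inj_on[OF P], of "{1..card G}" "{j}"] j img by simp
    have Pj: "prime_idl (P j)" "P j \<noteq> C" "P j \<subseteq> C"
      using assms(3) G(1) PjG idl_sub unfolding prime_idl_def by blast+
    show False
    proof (cases "G - {P j} = {}")
      \<comment> \<open>Here only one prime is left. The empty intersection is read as
        \<open>C\<close>, and a prime is proper.\<close>
      case True
      then show False using sub img' Pj by auto
    next
      case False
      have "\<Inter>(G - {P j}) \<subseteq> C"
        using False assms(3) G(1) idl_sub unfolding prime_idl_def by blast
      then have "\<Inter>(G - {P j}) \<subseteq> P j" using sub img' by auto
      then have "\<Inter>(G - {P j}) = \<Inter>G" by blast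
      then have "card G \<le> card (G - {P j})" using min[of "G - {P j}"] False G by auto
      then show False using PjG fin by (metis card_Diff1_less not_less)
    qed
  qed
  moreover have "1 \<le> card G" using G(2) fin by (simp add: Suc_le_eq card_gt_0_iff)
  ultimately have "prime_decomposition (\<Inter>F) (card G) P"
    unfolding prime_decomposition_def img G(3) using assms(3) G(1) img by blast
  then show ?thesis by blast
qed

text \<open>The last assumption concerns elements of all graded parts only. This is weak enough to
  cover products as well as intersections, because graded ideals have local units.\<close>

theorem decomposition_of_irreducibles:
  assumes I: "idl C I" "I \<noteq> C" and F: "finite F" "\<And>A. A \<in> F \<Longrightarrow> irred_idl A \<and> I \<subseteq> A"
    and inter: "\<And>x. x \<in> C \<Longrightarrow> (\<And>A. A \<in> F \<Longrightarrow> x \<in> gr A) \<Longrightarrow> x \<in> I"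
  shows "\<exists>m P. prime_decomposition (gr I) m P"
proof -
  \<comment> \<open>Improper members are dropped, since only proper irreducible ideals have prime
    graded parts; as I is proper, some member remains.\<close>
  let ?B = "gr ` {A \<in> F. A \<noteq> C}"
  have iF: "idl C A" if "A \<in> F" for A using F(2) that unfolding irred_idl_def by blast
  have grC: "gr C = C"
  proof (rule graded_gr_eq)
    have "V ` verts E \<subseteq> C" "V ` verts E \<subseteq> diag" "\<And>g. g \<in> V ` verts E \<Longrightarrow> g * g = g"
      using V_C V_diag V_idem by auto
    then show "graded C" using diag_gen_graded[of "V ` verts E"] V_gen_C by simp
  qed
  have ne: "?B \<noteq> {}"
  proof
    assume "?B = {}"
    then have "\<And>A. A \<in> F \<Longrightarrow> A = C" by blast
    then have "C \<subseteq> I" using inter grC by blast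
    then show False using I idl_sub by blast
  qed
  have "\<Inter>?B = gr I"
  proof
    have g: "graded (\<Inter>?B)" using graded_Inter[OF ne] gr_graded by blast
    have BC: "\<Inter>?B \<subseteq> C" using idl_sub[OF graded_idl[OF g]] .
    have "\<Inter>?B \<subseteq> I"
    proof
      fix x assume x: "x \<in> \<Inter>?B"
      then have "x \<in> gr A" if "A \<in> F" for A using that grC BC by (cases "A = C") auto
      then show "x \<in> I" using inter x BC by blast
    qed
    then show "\<Inter>?B \<subseteq> gr I" using graded_subset_gr[OF g I(1)] by blast
    have "gr I \<subseteq> gr A" if "A \<in> F" for A
      using graded_subset_gr[OF gr_graded iF[OF that]] gr_subset[OF I(1)] F(2)[OF that] by blast
    then show "gr I \<subseteq> \<Inter>?B" by blast
  qed
  moreover have "\<exists>m P. prime_decomposition (\<Inter>?B) m P"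
    using F gr_graded irred_gr_prime ne by (intro irredundant_subfamily) auto
  ultimately show ?thesis by simp
qed

text \<open>Each polynomial is indexed by a prime that avoids its cycle, which bounds their number
  by m. The last clause says that \<open>gr I\<close> and the polynomials generate I.\<close>

definition poly_data :: "'a set \<Rightarrow> nat \<Rightarrow> (nat \<Rightarrow> 'a set) \<Rightarrow> nat set \<Rightarrow> (nat \<Rightarrow> 'e list) \<Rightarrow> (nat \<Rightarrow> 'k poly) \<Rightarrow> bool" where
  "poly_data I m P T c f \<longleftrightarrow> T \<subseteq> {1..m} \<and>
     (\<forall>t\<in>T. exitless (gr I) (c t) \<and> V (base (c t)) \<notin> P t \<and> coeff (f t) 0 \<noteq> 0 \<and> pc (c t) (f t) \<in> I) \<and>
     (\<forall>J. idl C J \<longrightarrow> gr I \<subseteq> J \<longrightarrow> (\<forall>t\<in>T. pc (c t) (f t) \<in> J) \<longrightarrow> I \<subseteq> J)"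

text \<open>One cycle for each prime suffices: if P i also avoids d, then modulo \<open>gr I\<close>
  the base of d lies in the ideal of the base of c i, and the polynomials in c i account for those
  in d.\<close>

theorem poly_data_exists:
  assumes I: "idl C I" and dec: "prime_decomposition (gr I) m P"
  shows "\<exists>T c f. poly_data I m P T c f"
proof -
  have P: "graded (P i)" "prime_idl (P i)" "gr I \<subseteq> P i" if "i \<in> {1..m}" for i
    using dec that unfolding prime_decomposition_def by auto
  have grI: "gr I \<subseteq> I" using gr_subset[OF I] .
  define good where "good = (\<lambda>i c. exitless (gr I) c \<and> V (base c) \<notin> P i \<and> (\<exists>p. p \<noteq> 0 \<and> pc c p \<in> I))"
  define T where "T = {i \<in> {1..m}. \<exists>c. good i c}"
  have "\<exists>c. i \<in> T \<longrightarrow> good i c" for i unfolding T_def by blast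
  then obtain c where c: "\<And>i. i \<in> T \<Longrightarrow> good i (c i)" by metis
  have "\<exists>f. i \<in> T \<longrightarrow> (\<forall>p. pc (c i) p \<in> I \<longleftrightarrow> f dvd p) \<and> coeff f 0 \<noteq> 0" for i
  proof (cases "i \<in> T")
    case True
    then have ci: "closed_path (c i)" "\<exists>p. p \<noteq> 0 \<and> pc (c i) p \<in> I"
      using c exitless_closed_path unfolding good_def by blast+
    obtain f where f: "\<And>p. pc (c i) p \<in> I \<longleftrightarrow> f dvd p" "f \<noteq> 0 \<Longrightarrow> coeff f 0 \<noteq> 0"
      using principal_generator[OF I ci(1)] by metis
    then have "f \<noteq> 0" using ci(2) by auto
    then show ?thesis using f by blast
  qed simp
  then obtain f where f: "\<And>i p. i \<in> T \<Longrightarrow> pc (c i) p \<in> I \<longleftrightarrow> f i dvd p" "\<And>i. i \<in> T \<Longrightarrow> coeff (f i) 0 \<noteq> 0"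
    by metis
  have "I \<subseteq> J" if J: "idl C J" "gr I \<subseteq> J" "\<forall>t\<in>T. pc (c t) (f t) \<in> J" for J
  proof (rule ideal_structure[OF I J(1,2)])
    fix d q assume d: "exitless (gr I) d" and q: "pc d q \<in> I"
    have cd: "closed_path d" using exitless_closed_path d by blast
    show "pc d q \<in> J"
    proof (cases "q = 0")
      case True
      then show ?thesis using idl_zero[OF J(1)] by simp
    next
      case q0: False
      have "V (base d) \<notin> (\<Inter>i\<in>{1..m}. P i)"
        using d dec unfolding exitless_def prime_decomposition_def by simp
      then obtain i where i: "i \<in> {1..m}" "V (base d) \<notin> P i" by blast
      then have iT: "i \<in> T" unfolding T_def good_def using d q q0 by blast
      have ci: "exitless (gr I) (c i)" "V (base (c i)) \<notin> P i" using c[OF iT] unfolding good_def by blast+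
      let ?M = "vert_ideal (base (c i))" and ?D = "vert_ideal (base d)"
      have M: "idl C ?M" "idl C ?D" "V (base d) \<in> ?D"
        using vert_ideal closed_pathD(2)[OF exitless_closed_path[OF ci(1)]] closed_pathD(2)[OF cd] by blast+
      note Pi = P[OF i(1)]
      have "V (base d) \<in> isum ?M (P i)"
        using vert_in_other[OF Pi(1,2)] exitless_mono[OF _ Pi(3)] ci d i(2) by blast
      then have "V (base d) \<in> isum (?D \<inter> ?M) (?D \<inter> P i)"
        using modular_split[OF M(2,1) graded_idl[OF Pi(1)] graded_locally_unital[OF Pi(1)] M(3)] by blast
      \<comment> \<open>Inside the ideal of the base of d the prime P i shrinks to
        \<open>gr I\<close>, which takes its place in the sum.\<close>
      moreover have "P i \<inter> ?D \<subseteq> gr I" using prime_vert_inter[OF idl_gr Pi(3,1) d i(2)] .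
      ultimately have "V (base d) \<in> isum ?M (gr I)" unfolding isum_def by blast
      then have "V (base d) * pc d q \<in> isum ?M (gr I)"
        using idl_rmult[OF idl_isum'[OF M(1) idl_gr]] by blast
      then have "pc d q \<in> isum ?M (gr I)" using V_pc[OF cd] by simp
      then have "pc d q \<in> isum (I \<inter> ?M) (I \<inter> gr I)"
        using modular_split[OF I M(1) idl_gr gr_locally_unital q] by blast
      moreover have "I \<inter> ?M \<subseteq> J"
      proof (rule corner_generated[OF idl_gr ci(1) I grI J(1,2)])
        fix r assume "pc (c i) r \<in> I"
        then obtain s where "r = f i * s" using f(1)[OF iT] by blast
        then have "pc (c i) r = pc (c i) (f i) * pc (c i) s"
          using pc_mult[OF exitless_closed_path[OF ci(1)]] by simp
        then show "pc (c i) r \<in> J" using J(3) iT idl_rmult[OF J(1)] by simp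
      qed
      ultimately show ?thesis using J(2) isum_least[OF J(1), of "I \<inter> ?M" "I \<inter> gr I"] by blast
    qed
  qed
  moreover have "pc (c t) (f t) \<in> I" if "t \<in> T" for t using f(1)[OF that] by simp
  moreover have "exitless (gr I) (c t)" "V (base (c t)) \<notin> P t" if "t \<in> T" for t
    using c[OF that] unfolding good_def by blast+
  moreover have "T \<subseteq> {1..m}" unfolding T_def by blast
  ultimately have "poly_data I m P T c f"
    unfolding poly_data_def using f(2) by simp
  then show ?thesis by blast
qed

definition fam_sum :: "nat set \<Rightarrow> (nat \<Rightarrow> 'a set) \<Rightarrow> 'a set" where
  "fam_sum T J = {(\<Sum>t\<in>T. b t) |b. \<forall>t\<in>T. b t \<in> J t}"

lemma idl_fam_sum:
  assumes "\<And>t. t \<in> T \<Longrightarrow> idl C (J t)"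
  shows "idl C (fam_sum T J)"
  unfolding idl_def
proof (intro conjI ballI allI)
  have J: "J t \<subseteq> C" if "t \<in> T" for t using idl_sub[OF assms[OF that]] .
  then show "fam_sum T J \<subseteq> C" unfolding fam_sum_def by (auto intro!: idl_sum[OF idl_C])
  show "0 \<in> fam_sum T J"
    unfolding fam_sum_def using assms idl_zero by (intro CollectI exI[of _ "\<lambda>_. 0"]) auto
  fix x assume "x \<in> fam_sum T J"
  then obtain b where b: "x = (\<Sum>t\<in>T. b t)" "\<forall>t\<in>T. b t \<in> J t" unfolding fam_sum_def by blast
  show "- x \<in> fam_sum T J"
    unfolding fam_sum_def using b idl_neg[OF assms] by (intro CollectI exI[of _ "\<lambda>t. - b t"]) (auto simp: sum_negf)
  { fix y
    show "y * x \<in> fam_sum T J"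
      unfolding fam_sum_def using b idl_lmult[OF assms]
      by (intro CollectI exI[of _ "\<lambda>t. y * b t"]) (auto simp: sum_distrib_left)
    show "x * y \<in> fam_sum T J"
      unfolding fam_sum_def using b idl_rmult[OF assms]
      by (intro CollectI exI[of _ "\<lambda>t. b t * y"]) (auto simp: sum_distrib_right) }
  fix y assume "y \<in> fam_sum T J"
  then obtain d where d: "y = (\<Sum>t\<in>T. d t)" "\<forall>t\<in>T. d t \<in> J t" unfolding fam_sum_def by blast
  show "x + y \<in> fam_sum T J"
    unfolding fam_sum_def using b d idl_add[OF assms]
    by (intro CollectI exI[of _ "\<lambda>t. b t + d t"]) (auto simp: sum.distrib)
qed

lemma fam_sum_superset:
  assumes "\<And>t. t \<in> T \<Longrightarrow> idl C (J t)" "finite T" "s \<in> T"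
  shows "J s \<subseteq> fam_sum T J"
proof
  fix x assume "x \<in> J s"
  then have "x = (\<Sum>t\<in>T. if t = s then x else 0)" "\<forall>t\<in>T. (if t = s then x else 0) \<in> J t"
    using assms idl_zero by auto
  then show "x \<in> fam_sum T J" unfolding fam_sum_def by (intro CollectI exI[of _ "\<lambda>t. if t = s then x else 0"]) simp
qed

text \<open>Condition (3) numbers the cycles 1 to k along with the primes, so the indices in T have
  to come first.\<close>

lemma permute_to_front:
  assumes "T \<subseteq> {1..m}"
  obtains \<pi> where "bij_betw \<pi> {1..m} {1..m}" "\<pi> ` {1..card T} = T" "card T \<le> m"
proof -
  have fin: "finite T" using assms finite_subset by blast
  have le: "card T \<le> m" using card_mono[OF _ assms] by simp
  obtain g where g: "bij_betw g {1..card T} T" using ex_bij_betw_nat_finite_1[OF fin] by blast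
  have "card ({1..m} - {1..card T}) = card ({1..m} - T)"
    using le assms by (simp add: card_Diff_subset fin)
  then obtain h where h: "bij_betw h ({1..m} - {1..card T}) ({1..m} - T)"
    using finite_same_card_bij[of "{1..m} - {1..card T}" "{1..m} - T"] by auto
  define \<pi> where "\<pi> = (\<lambda>i. if i \<in> {1..card T} then g i else h i)"
  have "bij_betw \<pi> {1..card T} T \<longleftrightarrow> bij_betw g {1..card T} T"
    by (rule bij_betw_cong) (simp add: \<pi>_def)
  moreover have "bij_betw \<pi> ({1..m} - {1..card T}) ({1..m} - T) \<longleftrightarrow> bij_betw h ({1..m} - {1..card T}) ({1..m} - T)"
    by (rule bij_betw_cong) (simp add: \<pi>_def)
  ultimately have \<pi>T: "bij_betw \<pi> {1..card T} T" "bij_betw \<pi> ({1..m} - {1..card T}) ({1..m} - T)"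
    using g h by blast+
  then have "bij_betw \<pi> ({1..card T} \<union> ({1..m} - {1..card T})) (T \<union> ({1..m} - T))"
    by (rule bij_betw_combine) blast
  moreover have "{1..card T} \<union> ({1..m} - {1..card T}) = {1..m}" "T \<union> ({1..m} - T) = {1..m}"
    using le assms by auto
  ultimately have "bij_betw \<pi> {1..m} {1..m}" by simp
  moreover have "\<pi> ` {1..card T} = T" using bij_betw_imp_surj_on[OF \<pi>T(1)] .
  ultimately show thesis using that le by blast
qed

lemma prime_decomposition_permute:
  assumes "prime_decomposition J m P" and \<pi>: "bij_betw \<pi> {1..m} {1..m}"
  shows "prime_decomposition J m (P \<circ> \<pi>)"
proof -
  have img: "\<pi> ` {1..m} = {1..m}" using \<pi> bij_betw_imp_surj_on by blast
  have img': "\<pi> ` ({1..m} - {j}) = {1..m} - {\<pi> j}" if "j \<in> {1..m}" for j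
    using inj_on_image_set_diff[OF bij_betw_imp_inj_on[OF \<pi>], of "{1..m}" "{j}"] that img by simp
  have "(\<Inter>i\<in>{1..m}. (P \<circ> \<pi>) i) = (\<Inter>i\<in>{1..m}. P i)" unfolding image_comp[symmetric] img ..
  moreover have "(\<Inter>i\<in>{1..m} - {j}. (P \<circ> \<pi>) i) = (\<Inter>i\<in>{1..m} - {\<pi> j}. P i)" if "j \<in> {1..m}" for j
    unfolding image_comp[symmetric] img'[OF that] ..
  moreover have "\<pi> j \<in> {1..m}" if "j \<in> {1..m}" for j using img that by blast
  ultimately show ?thesis using assms(1) unfolding prime_decomposition_def by (simp add: comp_def)
qed

theorem generated_by_polys:
  assumes I: "idl C I" and dec: "prime_decomposition (gr I) m P"
  shows "\<exists>P k c f. prime_decomposition (gr I) m P \<and> k \<le> m \<and>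
    (\<forall>t\<in>{1..k}. exitless (gr I) (c t) \<and> V (base (c t)) \<notin> P t \<and> coeff (f t) 0 \<noteq> 0) \<and>
    I = isum (gr I) (fam_sum {1..k} (\<lambda>t. gen C {pc (c t) (f t)}))"
proof -
  obtain T c f where d: "poly_data I m P T c f" using poly_data_exists[OF assms] by blast
  then obtain \<pi> where \<pi>: "bij_betw \<pi> {1..m} {1..m}" "\<pi> ` {1..card T} = T" "card T \<le> m"
    using permute_to_front unfolding poly_data_def by metis
  let ?c = "c \<circ> \<pi>" and ?f = "f \<circ> \<pi>" and ?K = "{1..card T}"
  have T: "\<pi> t \<in> T" if "t \<in> ?K" for t using \<pi>(2) that by blast
  have props: "exitless (gr I) (?c t) \<and> V (base (?c t)) \<notin> (P \<circ> \<pi>) t \<and> coeff (?f t) 0 \<noteq> 0 \<and> pc (?c t) (?f t) \<in> I"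
    if "t \<in> ?K" for t using d T[OF that] unfolding poly_data_def by auto
  let ?G = "\<lambda>t. gen C {pc (?c t) (?f t)}"
  have G: "idl C (?G t)" if "t \<in> ?K" for t
    using props[OF that] pc_C[OF exitless_closed_path] by (intro idl_gen) auto
  have S: "idl C (fam_sum ?K ?G)" by (rule idl_fam_sum[OF G])
  have "I = isum (gr I) (fam_sum ?K ?G)"
  proof
    show "isum (gr I) (fam_sum ?K ?G) \<subseteq> I"
    proof (rule isum_least[OF I gr_subset[OF I]])
      have GI: "?G t \<subseteq> I" if "t \<in> ?K" for t using props[OF that] by (intro gen_least[OF I]) simp
      have "sum b ?K \<in> I" if "\<forall>t\<in>?K. b t \<in> ?G t" for b
        using that GI by (intro idl_sum[OF I]) blast
      then show "fam_sum ?K ?G \<subseteq> I" unfolding fam_sum_def by blast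
    qed
    have "pc (c t) (f t) \<in> isum (gr I) (fam_sum ?K ?G)" if t: "t \<in> T" for t
    proof -
      obtain s where s: "s \<in> ?K" "t = \<pi> s" using \<pi>(2) t by blast
      have "pc (c t) (f t) \<in> ?G s" using gen_superset s(2) by auto
      then show ?thesis using fam_sum_superset[of ?K ?G s, OF G] s(1) isum_subset(2)[OF idl_gr S] by auto
    qed
    then show "I \<subseteq> isum (gr I) (fam_sum ?K ?G)"
      using d idl_isum'[OF idl_gr S] isum_subset(1)[OF idl_gr S] unfolding poly_data_def by blast
  qed
  then show ?thesis
    using prime_decomposition_permute[OF dec \<pi>(1)] \<pi>(3) props
    by (intro exI[of _ "P \<circ> \<pi>"] exI[of _ "card T"] exI[of _ ?c] exI[of _ ?f]) blast
qed

subsection \<open>Intersections and products of strongly irreducible ideals\<close>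

lemma idl_iprod:
  assumes A: "idl C A" and B: "idl C B"
  shows "idl C (iprod A B)"
  unfolding idl_def
proof (intro conjI ballI allI)
  show "iprod A B \<subseteq> C" using iprod_subset(1)[OF A B] idl_sub[OF A] by blast
  fix x assume x: "x \<in> iprod A B"
  show "- x \<in> iprod A B"
    using x unfolding iprod_def
  proof (rule aspan_image[where f = uminus])
    fix b assume "b \<in> {a * b |a b. a \<in> A \<and> b \<in> B}"
    then obtain a b' where "- b = - a * b'" "- a \<in> A" "b' \<in> B" using idl_neg[OF A] by auto
    then show "- b \<in> aspan {a * b |a b. a \<in> A \<and> b \<in> B}" by (blast intro: aspan_base)
  qed simp_all
  fix z
  show "z * x \<in> iprod A B"
    using x unfolding iprod_def
  proof (rule aspan_image[where f = "\<lambda>x. z * x"])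
    fix b assume "b \<in> {a * b |a b. a \<in> A \<and> b \<in> B}"
    then obtain a b' where "z * b = z * a * b'" "z * a \<in> A" "b' \<in> B"
      using idl_lmult[OF A] by (auto simp: mult.assoc)
    then show "z * b \<in> aspan {a * b |a b. a \<in> A \<and> b \<in> B}" by (blast intro: aspan_base)
  qed (simp_all add: distrib_left)
  show "x * z \<in> iprod A B"
    using x unfolding iprod_def
  proof (rule aspan_image[where f = "\<lambda>x. x * z"])
    fix b assume "b \<in> {a * b |a b. a \<in> A \<and> b \<in> B}"
    then obtain a b' where "b * z = a * (b' * z)" "a \<in> A" "b' * z \<in> B"
      using idl_rmult[OF B] by (auto simp: mult.assoc)
    then show "b * z \<in> aspan {a * b |a b. a \<in> A \<and> b \<in> B}" by (blast intro: aspan_base)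
  qed (simp_all add: distrib_right)
qed (auto simp: iprod_def intro: aspan_zero aspan_plus)

lemma idl_foldl_iprod: "idl C A \<Longrightarrow> (\<And>B. B \<in> set Bs \<Longrightarrow> idl C B) \<Longrightarrow> idl C (foldl iprod A Bs)"
  by (induction Bs arbitrary: A) (auto simp: idl_iprod)

lemma foldl_iprod_subset:
  "idl C A \<Longrightarrow> (\<And>B. B \<in> set Bs \<Longrightarrow> idl C B) \<Longrightarrow> D \<in> insert A (set Bs) \<Longrightarrow> foldl iprod A Bs \<subseteq> D"
proof (induction Bs arbitrary: A D)
  case (Cons B Bs)
  have iB: "idl C B" using Cons.prems by simp
  note sub = iprod_subset[OF Cons.prems(1) iB]
  have IH: "foldl iprod (iprod A B) Bs \<subseteq> D'" if "D' \<in> insert (iprod A B) (set Bs)" for D'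
    using Cons.IH[OF idl_iprod[OF Cons.prems(1) iB] _ that] Cons.prems by simp
  show ?case using IH[of "iprod A B"] IH[of D] Cons.prems(3) sub by auto
qed simp

text \<open>Writing x = x u with u in G lets every further factor contribute a local unit.\<close>

lemma foldl_iprod_unital:
  assumes "locally_unital G" "x \<in> G" "\<And>B. B \<in> set Bs \<Longrightarrow> G \<subseteq> B" "x \<in> A"
  shows "x \<in> foldl iprod A Bs"
  using assms(3,4)
proof (induction Bs arbitrary: A)
  case (Cons B Bs)
  obtain u where "u \<in> G" "x * u = x" using assms(1,2) unfolding locally_unital_def by blast
  then have "x \<in> iprod A B" using iprod_base[of x A u B] Cons.prems by auto
  then show ?case using Cons by simp
qed simp

lemma foldl_iprod_pc:
  assumes c: "closed_path c"
  shows "list_all2 (\<lambda>B q. pc c q \<in> B) Bs qs \<Longrightarrow> pc c p \<in> A \<Longrightarrow> pc c (p * prod_list qs) \<in> foldl iprod A Bs"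
proof (induction Bs qs arbitrary: A p rule: list_all2_induct)
  case (Cons B Bs q qs)
  have "pc c (p * q) \<in> iprod A B" using iprod_base[OF Cons.prems Cons.hyps(1)] pc_mult[OF c] by simp
  then show ?case using Cons.IH[of "p * q"] by (simp add: mult.assoc)
qed simp

lemma iprod_C: "idl C A \<Longrightarrow> iprod C A = A"
  using iprod_subset(2)[OF idl_C] iprod_base[of _ C _ A] C_units idl_sub by (metis subsetD subsetI subset_antisym)

text \<open>If P s avoided c t as well, it would meet the ideal of the base only in
  \<open>gr I\<close>, hence inside P t; primeness of P t then puts P s inside P t, against
  irredundancy.\<close>

lemma other_prime_vert:
  assumes dec: "prime_decomposition (gr I) m P" and d: "poly_data I m P T c f"
    and t: "t \<in> T" and s: "s \<in> {1..m}" "s \<noteq> t"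
  shows "V (base (c t)) \<in> P s"
proof (rule ccontr)
  assume nV: "V (base (c t)) \<notin> P s"
  have tm: "t \<in> {1..m}" using t d unfolding poly_data_def by blast
  have P: "graded (P i)" "prime_idl (P i)" "gr I \<subseteq> P i" if "i \<in> {1..m}" for i
    using dec that unfolding prime_decomposition_def by auto
  have c: "exitless (gr I) (c t)" "V (base (c t)) \<notin> P t" using d t unfolding poly_data_def by blast+
  have M: "idl C (vert_ideal (base (c t)))" "V (base (c t)) \<in> vert_ideal (base (c t))"
    using vert_ideal closed_pathD(2)[OF exitless_closed_path[OF c(1)]] by blast+
  have "P s \<inter> vert_ideal (base (c t)) \<subseteq> P t"
    using prime_vert_inter[OF idl_gr P(3,1)[OF s(1)] c(1) nV] P(3)[OF tm] by blast
  then have "P s \<subseteq> P t" using prime_inter[OF P(2)[OF tm] prime_idlD[OF P(2)[OF s(1)]] M(1)] M(2) c(2) by blast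
  then have "C \<inter> (\<Inter>i\<in>{1..m} - {t}. P i) \<subseteq> P t" using s by blast
  then show False using dec tm unfolding prime_decomposition_def by blast
qed

text \<open>For t in T the prime P t is enlarged by f t(c t) to Q t. I is the intersection of all
  the Q t, and each of these splits further along the prime powers of f t. One list of ideals serves
  for both the intersection and the product.\<close>

theorem sirred_list:
  assumes I: "idl C I" and dec: "prime_decomposition (gr I) m P"
  shows "\<exists>J Js. (\<forall>A\<in>set (J # Js). sirred_idl A) \<and> I = \<Inter>(set (J # Js)) \<and> I = foldl iprod J Js"
proof -
  obtain T c f where d: "poly_data I m P T c f" using poly_data_exists[OF assms] by blast
  have T: "T \<subseteq> {1..m}" using d unfolding poly_data_def by blast
  have P: "graded (P i)" "prime_idl (P i)" "gr I \<subseteq> P i" "idl C (P i)" if "i \<in> {1..m}" for i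
    using dec that prime_idlD unfolding prime_decomposition_def by auto
  have grI: "gr I = (\<Inter>i\<in>{1..m}. P i)" and m: "1 \<le> m" using dec unfolding prime_decomposition_def by blast+
  have cf: "exitless (gr I) (c t)" "V (base (c t)) \<notin> P t" "coeff (f t) 0 \<noteq> 0" "pc (c t) (f t) \<in> I"
    if "t \<in> T" for t using d that unfolding poly_data_def by blast+
  have cp: "closed_path (c t)" if "t \<in> T" for t using exitless_closed_path cf(1)[OF that] .
  have ex: "exitless (P t) (c t)" if "t \<in> T" for t
    using exitless_mono[OF cf(1)[OF that] P(3)] cf(2)[OF that] T that by blast
  note other = other_prime_vert[OF dec d]
  \<comment> \<open>A constant f t would put the base of c t into I.\<close>
  have "degree (f t) > 0" if t: "t \<in> T" for t
  proof (rule ccontr)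
    assume "\<not> degree (f t) > 0"
    then obtain k where k: "f t = [:k:]" by (metis degree_eq_zeroE not_gr_zero)
    then have "sc k (V (base (c t))) \<in> I" "k \<noteq> 0" using cf(3,4)[OF t] pc_const by auto
    then have "V (base (c t)) \<in> I" using sc_cancel[OF I] by blast
    then have "V (base (c t)) \<in> gr I" using V_gr closed_pathD(2)[OF cp[OF t]] unfolding gv_def by blast
    then show False using cf(1)[OF t] unfolding exitless_def by blast
  qed
  then have "\<exists>ps. t \<in> T \<longrightarrow> ps \<noteq> [] \<and> (\<forall>p\<in>set ps. lattice_prime p) \<and> prod_list ps = f t \<and>
      (\<forall>r. (\<forall>p\<in>set ps. p dvd r) \<longrightarrow> f t dvd r)" for t
    using lattice_prime_factorisation[of "f t"] by metis
  then obtain ps where ps: "\<And>t. t \<in> T \<Longrightarrow> ps t \<noteq> []" "\<And>t p. t \<in> T \<Longrightarrow> p \<in> set (ps t) \<Longrightarrow> lattice_prime p"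
    "\<And>t. t \<in> T \<Longrightarrow> prod_list (ps t) = f t"
    "\<And>t r. t \<in> T \<Longrightarrow> (\<And>p. p \<in> set (ps t) \<Longrightarrow> p dvd r) \<Longrightarrow> f t dvd r"
    by metis
  have ps_dvd: "p dvd f t" if "t \<in> T" "p \<in> set (ps t)" for t p
    using ps(3)[OF that(1)] that(2) dvd_prod_list by metis
  have ps0: "coeff p 0 \<noteq> 0" if "t \<in> T" "p \<in> set (ps t)" for t p
    using ps_dvd[OF that] cf(3)[OF that(1)] by (auto elim!: dvdE simp: coeff_mult)
  define F where "F = (\<lambda>i. poly_over (P i) (c i))"
  define Ls where "Ls = (\<lambda>i. if i \<in> T then map (F i) (ps i) else [P i])"
  define L where "L = concat (map Ls [1..<Suc m])"
  define Q where "Q = (\<lambda>i. if i \<in> T then F i (f i) else P i)"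
  have setL: "A \<in> set L \<longleftrightarrow> (\<exists>i\<in>{1..m}. A \<in> set (Ls i))" for A unfolding L_def by auto
  have Tm: "t \<in> {1..m}" if "t \<in> T" for t using T that by blast
  have FP: "idl C (F t p)" "P t \<subseteq> F t p" if "t \<in> T" for t p
    unfolding F_def using poly_over(1,2)[OF P(4)[OF Tm[OF that]] cp[OF that], of p] by blast+
  have FQ: "pc (c t) q \<in> F t p" if "t \<in> T" "p dvd q" for t p q
    unfolding F_def using poly_over(3)[OF P(4)[OF Tm[OF that(1)]] cp[OF that(1)] that(2)] .
  have sir: "sirred_idl A" if A: "A \<in> set L" for A
  proof -
    obtain i where i: "i \<in> {1..m}" "A \<in> set (Ls i)" using A setL by blast
    show ?thesis
    proof (cases "i \<in> T")
      case True
      then obtain p where "p \<in> set (ps i)" "A = F i p" using i unfolding Ls_def by auto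
      then show ?thesis unfolding F_def
        using poly_over_sirred[OF P(1,2)[OF i(1)] ex[OF True] ps(2)[OF True] ps0[OF True]] by blast
    next
      case False
      then show ?thesis using i prime_sirred P unfolding Ls_def by simp
    qed
  qed
  have idL: "idl C A" if "A \<in> set L" for A using sir[OF that] unfolding sirred_idl_def by blast
  have PL: "P i \<subseteq> A" if "i \<in> {1..m}" "A \<in> set (Ls i)" for i A
    using that FP(2)[of i] unfolding Ls_def by (cases "i \<in> T") auto
  have Qi: "idl C (Q i)" "P i \<subseteq> Q i" if "i \<in> {1..m}" for i
    using P(4)[OF that] FP unfolding Q_def by auto
  have LQ: "(\<Inter>(set (Ls i))) \<subseteq> Q i" if i: "i \<in> {1..m}" for i
  proof (cases "i \<in> T")
    case True
    then show ?thesis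
      using poly_over_Inter[OF P(1)[OF i] ex[OF True], of "set (ps i)" "f i"] ps(1,4)[OF True] ps0[OF True]
      unfolding Ls_def Q_def F_def by simp
  qed (simp add: Ls_def Q_def)
  have "F t (f t) \<subseteq> F t p" if "t \<in> T" "p \<in> set (ps t)" for t p
    unfolding F_def using FP[OF that(1), of p] FQ[OF that(1) ps_dvd[OF that]]
    by (intro poly_over_least) (auto simp: F_def)
  then have QL: "Q i \<subseteq> A" if "i \<in> {1..m}" "A \<in> set (Ls i)" for i A
    using that unfolding Q_def Ls_def by (auto split: if_splits)
  have IQ: "I \<subseteq> Q i" if i: "i \<in> {1..m}" for i
  proof -
    have "pc (c t) (f t) \<in> Q i" if t: "t \<in> T" for t
    proof (cases "i = t")
      case True
      then show ?thesis using t FQ[OF t dvd_refl] unfolding Q_def by simp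
    next
      case False
      then have "V (base (c t)) \<in> P i" using other[OF t i] by blast
      then have "V (base (c t)) * pc (c t) (f t) \<in> P i" using idl_rmult[OF P(4)[OF i]] by blast
      then show ?thesis using V_pc[OF cp[OF t]] Qi(2)[OF i] by auto
    qed
    then show ?thesis using d Qi[OF i] P(3)[OF i] unfolding poly_data_def by blast
  qed
  have QI: "(\<Inter>i\<in>{1..m}. Q i) \<subseteq> I"
  proof
    fix x assume x: "x \<in> (\<Inter>i\<in>{1..m}. Q i)"
    \<comment> \<open>An element z of I approximates x modulo one more P j at a time. The correction
      at j comes from the ideal of f j(c j), which lies in all other P i, so earlier congruences
      survive.\<close>
    have "\<exists>z\<in>I. \<forall>i\<in>S. x - z \<in> P i" if "finite S" "S \<subseteq> {1..m}" for S
      using that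
    proof (induction S)
      case empty
      show ?case using idl_zero[OF I] by blast
    next
      case (insert j S)
      then obtain z where z: "z \<in> I" "\<forall>i\<in>S. x - z \<in> P i" by blast
      have j: "j \<in> {1..m}" using insert by blast
      have xz: "x - z \<in> Q j" using x j z(1) IQ[OF j] idl_diff[OF Qi(1)[OF j]] by blast
      show ?case
      proof (cases "j \<in> T")
        case False
        then show ?thesis using z xz unfolding Q_def by auto
      next
        case jT: True
        then obtain a b where ab: "x - z = a + b" "a \<in> P j" "b \<in> gen C {pc (c j) (f j)}"
          using xz unfolding Q_def F_def poly_over_def by (auto elim: isumE)
        have bI: "b \<in> I" using gen_least[OF I, of "{pc (c j) (f j)}"] cf(4)[OF jT] ab(3) by auto
        have "x - (z + b) \<in> P i" if i: "i \<in> S" for i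
        proof -
          have im: "i \<in> {1..m}" "i \<noteq> j" using i insert by auto
          have "V (base (c j)) * pc (c j) (f j) \<in> P i"
            using other[OF jT im] idl_rmult[OF P(4)[OF im(1)]] by blast
          then have "b \<in> P i"
            using gen_least[OF P(4)[OF im(1)], of "{pc (c j) (f j)}"] V_pc[OF cp[OF jT]] ab(3) by auto
          then have "x - z - b \<in> P i" using z(2) i idl_diff[OF P(4)[OF im(1)]] by blast
          then show ?thesis by (simp add: diff_diff_eq)
        qed
        moreover have "x - (z + b) \<in> P j" using ab(1,2) by (simp add: diff_diff_eq[symmetric])
        ultimately show ?thesis using idl_add[OF I z(1) bI] by blast
      qed
    qed
    then obtain z where "z \<in> I" "\<forall>i\<in>{1..m}. x - z \<in> P i" by blast
    then have "x - z \<in> I" using grI gr_subset[OF I] by blast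
    then show "x \<in> I" using \<open>z \<in> I\<close> idl_diff_mem[OF I] by blast
  qed
  have LI: "\<Inter>(set L) = I"
  proof
    have "\<Inter>(set L) \<subseteq> \<Inter>(set (Ls i))" if "i \<in> {1..m}" for i using that setL by blast
    then have "\<Inter>(set L) \<subseteq> Q i" if "i \<in> {1..m}" for i using LQ[OF that] that by blast
    then have "\<Inter>(set L) \<subseteq> (\<Inter>i\<in>{1..m}. Q i)" by blast
    then show "\<Inter>(set L) \<subseteq> I" using QI by blast
    show "I \<subseteq> \<Inter>(set L)" using IQ QL setL by blast
  qed
  have "L \<noteq> []"
  proof -
    have "Ls m \<noteq> []" unfolding Ls_def using ps(1) by simp
    then show ?thesis unfolding L_def using m by simp
  qed
  then obtain J Js where L: "L = J # Js" by (cases L) auto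
  \<comment> \<open>Starting the product with \<open>C\<close> changes nothing and puts all factors
    on the same footing.\<close>
  have fold: "foldl iprod C L = foldl iprod J Js"
    using iprod_C idL unfolding L by simp
  have "foldl iprod J Js \<subseteq> I"
    using foldl_iprod_subset[of J Js] idL LI unfolding L by auto
  moreover have "I \<subseteq> foldl iprod C L"
  proof -
    have "gr I \<subseteq> foldl iprod C L"
    proof
      fix x assume x: "x \<in> gr I"
      show "x \<in> foldl iprod C L"
      proof (rule foldl_iprod_unital[OF gr_locally_unital x])
        show "gr I \<subseteq> B" if "B \<in> set L" for B using that LI gr_subset[OF I] by blast
        show "x \<in> C" using x idl_sub[OF idl_gr] by blast
      qed
    qed
    moreover have "pc (c t) (f t) \<in> foldl iprod C L" if t: "t \<in> T" for t
    proof -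
      \<comment> \<open>f t(c t) is a product of one polynomial from each factor: the prime powers
        at index t, and 1, that is the base of c t, at all other indices.\<close>
      define q where "q = (\<lambda>i. if i = t then ps t else map (\<lambda>_. 1) (Ls i))"
      have one: "pc (c t) 1 = V (base (c t))" using pc_const[of "c t" 1] by (simp add: sc_one one_pCons)
      have la: "list_all2 (\<lambda>B r. pc (c t) r \<in> B) (Ls i) (q i)" if i: "i \<in> {1..m}" for i
      proof (cases "i = t")
        case True
        then show ?thesis unfolding q_def Ls_def using t FQ[OF t dvd_refl]
          by (simp add: list_all2_map1 list_all2_same)
      next
        case False
        then have "pc (c t) 1 \<in> B" if "B \<in> set (Ls i)" for B
          using other[OF t i] PL[OF i that] one by auto
        then show ?thesis unfolding q_def using False by (simp add: list_all2_map2 list_all2_same)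
      qed
      have "list_all2 (\<lambda>B r. pc (c t) r \<in> B) L (concat (map q [1..<Suc m]))"
        unfolding L_def using la
        by (intro concat_transfer[unfolded rel_fun_def, rule_format])
           (auto simp: list_all2_map1 list_all2_map2 list_all2_same)
      then have "pc (c t) (1 * prod_list (concat (map q [1..<Suc m]))) \<in> foldl iprod C L"
        using foldl_iprod_pc[OF cp[OF t]] pc_C[OF cp[OF t]] by blast
      moreover have "prod_list (concat (map q [1..<Suc m])) = f t"
      proof -
        have "prod_list (q i) = (if i = t then f t else 1)" for i
          unfolding q_def using ps(3)[OF t] by (induction "Ls i") (auto simp: map_replicate_const)
        then have "prod_list (concat (map q xs)) = (if t \<in> set xs then f t else 1)" if "distinct xs" for xs
          using that by (induction xs) auto
        then show ?thesis using T t by auto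
      qed
      ultimately show ?thesis by simp
    qed
    ultimately show ?thesis
      using d idl_foldl_iprod[OF idl_C idL] unfolding poly_data_def by blast
  qed
  ultimately have "I = foldl iprod J Js" using fold by auto
  then show ?thesis using sir LI L by metis
qed

text \<open>The intersection of the graded parts is graded, so its local units place it inside the
  product.\<close>

theorem decomposition_of_product:
  assumes I: "idl C I" "I \<noteq> C" and J: "\<And>A. A \<in> set (J # Js) \<Longrightarrow> irred_idl A" and prod: "I = foldl iprod J Js"
  shows "\<exists>m P. prime_decomposition (gr I) m P"
proof (rule decomposition_of_irreducibles[OF I])
  have iJ: "idl C A" if "A \<in> set (J # Js)" for A using J[OF that] unfolding irred_idl_def by blast
  show "finite (set (J # Js))" by simp
  show "irred_idl A \<and> I \<subseteq> A" if "A \<in> set (J # Js)" for A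
    using J[OF that] foldl_iprod_subset[of J Js A] iJ that prod by auto
  fix x assume x: "x \<in> C" "\<And>A. A \<in> set (J # Js) \<Longrightarrow> x \<in> gr A"
  let ?G = "\<Inter>(gr ` set (J # Js))"
  have "graded ?G" using graded_Inter[of "gr ` set (J # Js)"] gr_graded by auto
  moreover have "?G \<subseteq> A" if "A \<in> set (J # Js)" for A using gr_subset[OF iJ[OF that]] that by blast
  ultimately show "x \<in> I"
    unfolding prod using x(2) by (intro foldl_iprod_unital[of ?G] graded_locally_unital) auto
qed

subsection \<open>Exitless cycles in the quotient graph\<close>

lemma cas_quotient:
  "pre_digraph.cas (quotient_graph E H S) (Inl u) (map Inl p) (Inl w) \<longleftrightarrow> cas u p w"
  by (induction p arbitrary: u) (auto simp: pre_digraph.cas.simps quotient_graph_def)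

lemma awalk_verts_quotient:
  "pre_digraph.awalk_verts (quotient_graph E H S) (Inl u) (map Inl p) = map Inl (awalk_verts u p)"
  by (induction p arbitrary: u) (auto simp: pre_digraph.awalk_verts.simps quotient_graph_def)

theorem exitless_cycle_without_exits:
  assumes I: "idl C I" and c: "exitless (gr I) c"
  shows "cycle_without_exits (quotient_graph E (gv I) (gs I)) (map Inl c)"
proof -
  let ?G = "quotient_graph E (gv I) (gs I)"
  let ?v = "base c"
  have cp: "closed_path c" "awalk ?v c ?v" "c \<noteq> []" using exitless_closed_path[OF c] closed_pathD by blast+
  have v: "?v \<notin> gv I" using c V_gr unfolding exitless_def by blast
  have head: "head E e \<notin> gv I" "e \<in> arcs E" if e: "e \<in> set c" for e
  proof -
    obtain i where i: "i < length c" "c ! i = e" using e unfolding in_set_conv_nth by blast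
    then show "head E e \<notin> gv I" "e \<in> arcs E" using awalk_split[OF cp(2) i(1)] gv_awalk[OF I] v by auto
  qed
  have succ: "\<exists>e'\<in>set c. tail E e' = head E e" if e: "e \<in> set c" for e
  proof -
    obtain i where i: "i < length c" "c ! i = e" using e unfolding in_set_conv_nth by blast
    then have "head E e = tail E (c ! (Suc i mod length c))" using closed_path_head_nth[OF cp(1), of i] by simp
    moreover have "Suc i mod length c < length c" using i by (intro mod_less_divisor) linarith
    ultimately show ?thesis by force
  qed
  have exit: "head E e \<in> gv I" if "e \<in> arcs E" "f \<in> set c" "tail E e = tail E f" "e \<noteq> f" for e f
  proof -
    have "V (tail E f) - X f * Y f \<in> gr I" using c that unfolding exitless_def by blast
    then have "head E e \<in> gv (gr I)"
      using mem_out_arcs_head[OF idl_gr[of I], of e "tail E f" f] that head(2) by auto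
    then show ?thesis unfolding gv_def using gr_subset[OF I] by blast
  qed
  have "pre_digraph.cycle ?G (map Inl c)"
    unfolding pre_digraph.cycle_def pre_digraph.awalk_def
  proof (intro exI[of _ "Inl ?v"] conjI)
    show "Inl ?v \<in> verts ?G" using v closed_pathD(2)[OF cp(1)] unfolding quotient_graph_def by simp
    show "set (map Inl c) \<subseteq> arcs ?G" using head unfolding quotient_graph_def by auto
    show "pre_digraph.cas ?G (Inl ?v) (map Inl c) (Inl ?v)"
      using cp(2) unfolding cas_quotient awalk_def by blast
    obtain e c' where ec: "c = e # c'" using cp(3) by (cases c) auto
    have "head E (last c) = ?v"
      using awalk_head_nth[OF cp(2), of "length c - 1"] cp(3) by (simp add: last_conv_nth)
    then have "tl (awalk_verts ?v c) = map (tail E) (c' @ [e])"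
      unfolding awalk_verts_conv using ec unfolding base_def by simp
    moreover have "distinct (map (tail E) (c' @ [e]))" using c ec unfolding exitless_def by auto
    ultimately have "distinct (tl (awalk_verts ?v c))" by simp
    then show "distinct (tl (pre_digraph.awalk_verts ?G (Inl ?v) (map Inl c)))"
      unfolding awalk_verts_quotient map_tl[symmetric] by (simp add: distinct_map)
    show "map Inl c \<noteq> []" using cp by simp
  qed
  moreover have "False" if d: "d \<in> set (map Inl c)" and a: "a \<in> arcs ?G" "tail ?G a = tail ?G d" "a \<noteq> d" for d a
  proof -
    obtain f where f: "f \<in> set c" "d = Inl f" using d by auto
    show False
    proof (cases a)
      case (Inl e)
      then have "e \<in> arcs E" "head E e \<notin> gv I" "tail E e = tail E f" "e \<noteq> f"
        using a f unfolding quotient_graph_def by auto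
      then show False using exit f(1) by blast
    next
      \<comment> \<open>An exit e' would force e to be on c with r(e) a breaking vertex outside S.
        But the edge g of c at r(e) is the only one there ending outside H, and r(e) - g g* is in I,
        so r(e) does belong to S.\<close>
      case (Inr e)
      then have e: "e \<in> arcs E" "head E e \<in> breaking_verts E (gv I) - gs I" "tail E e = tail E f"
        using a f unfolding quotient_graph_def by auto
      then have "head E e \<notin> gv I" unfolding breaking_verts_def by blast
      then have ef: "e = f" using exit[OF e(1) f(1) e(3)] by blast
      then obtain g where g: "g \<in> set c" "tail E g = head E e" using succ f by blast
      have "brk (gv I) (head E e) = {g}"
        unfolding brk_def using exit[OF _ g(1)] g head[OF g(1)] by auto
      moreover have "V (head E e) - X g * Y g \<in> I"
        using c g gr_subset[OF I] unfolding exitless_def by auto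
      ultimately have "head E e \<in> gs I" unfolding gs_def cut_def using e(2) by simp
      then show False using e(2) by blast
    qed
  qed
  ultimately show ?thesis unfolding cycle_without_exits_def by blast
qed

end

section \<open>Transfer to the coset construction\<close>

lemma two_sided_ideal_iff:
  "two_sided_ideal R J \<longleftrightarrow> J \<subseteq> carrier R \<and> \<zero>\<^bsub>R\<^esub> \<in> J \<and> (\<forall>x\<in>J. \<forall>y\<in>J. x \<oplus>\<^bsub>R\<^esub> y \<in> J) \<and>
     (\<forall>x\<in>J. \<ominus>\<^bsub>R\<^esub> x \<in> J) \<and> (\<forall>a\<in>J. \<forall>x\<in>carrier R. x \<otimes>\<^bsub>R\<^esub> a \<in> J \<and> a \<otimes>\<^bsub>R\<^esub> x \<in> J)"
  unfolding two_sided_ideal_def additive_subgroup_def subgroup_def a_inv_def by auto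

text \<open>Only the restriction of \<theta> to \<open>C\<close> is constrained, since
  \<open>C\<close> may be a proper part of the type; hence the membership conditions in the
  rules.\<close>

locale leavitt_iso = leavitt E V X Y sc hc C
  for E :: "('v, 'e) pre_digraph" and V :: "'v \<Rightarrow> 'a::ring" and X Y :: "'e \<Rightarrow> 'a"
    and sc :: "'k::field \<Rightarrow> 'a \<Rightarrow> 'a" and hc :: "int \<Rightarrow> 'a \<Rightarrow> 'a" and C :: "'a set" +
  fixes L :: "('b, 'm) ring_scheme" (structure) and \<theta> :: "'a \<Rightarrow> 'b"
  assumes bij: "bij_betw \<theta> C (carrier L)"
    and \<theta>_zero: "\<theta> 0 = \<zero>"
    and \<theta>_add: "x \<in> C \<Longrightarrow> y \<in> C \<Longrightarrow> \<theta> (x + y) = \<theta> x \<oplus> \<theta> y"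
    and \<theta>_mult: "x \<in> C \<Longrightarrow> y \<in> C \<Longrightarrow> \<theta> (x * y) = \<theta> x \<otimes> \<theta> y"
begin

definition pull :: "'b set \<Rightarrow> 'a set" where
  "pull J = {x \<in> C. \<theta> x \<in> J}"

lemma inj: "inj_on \<theta> C"
  using bij by (rule bij_betw_imp_inj_on)

lemma \<theta>_inj: "x \<in> C \<Longrightarrow> y \<in> C \<Longrightarrow> \<theta> x = \<theta> y \<Longrightarrow> x = y"
  using inj by (rule inj_onD)

lemma \<theta>_carrier: "\<theta> ` C = carrier L"
  using bij by (rule bij_betw_imp_surj_on)

lemma \<theta>_closed: "x \<in> C \<Longrightarrow> \<theta> x \<in> carrier L"
  using \<theta>_carrier by blast

lemma carrier_obtain:
  assumes "a \<in> carrier L" obtains x where "x \<in> C" "a = \<theta> x"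
  using assms \<theta>_carrier by blast

lemma C_zero: "0 \<in> C" and C_add: "x \<in> C \<Longrightarrow> y \<in> C \<Longrightarrow> x + y \<in> C"
  and C_neg: "x \<in> C \<Longrightarrow> - x \<in> C" and C_mult: "x \<in> C \<Longrightarrow> y * x \<in> C"
  using idl_zero[OF idl_C] idl_add[OF idl_C] idl_neg[OF idl_C] idl_lmult[OF idl_C] by blast+

lemma image_mem: "A \<subseteq> C \<Longrightarrow> x \<in> C \<Longrightarrow> \<theta> x \<in> \<theta> ` A \<longleftrightarrow> x \<in> A"
  using inj_on_image_mem_iff[OF inj] .

lemma image_subset: "A \<subseteq> C \<Longrightarrow> B \<subseteq> C \<Longrightarrow> \<theta> ` A \<subseteq> \<theta> ` B \<longleftrightarrow> A \<subseteq> B"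
proof
  assume AB: "A \<subseteq> C" "B \<subseteq> C" and sub: "\<theta> ` A \<subseteq> \<theta> ` B"
  show "A \<subseteq> B"
  proof
    fix a assume "a \<in> A"
    then have "\<theta> a \<in> \<theta> ` B" "a \<in> C" using sub AB by blast+
    then show "a \<in> B" using image_mem[OF AB(2)] by blast
  qed
qed (rule image_mono)

lemma image_eq: "A \<subseteq> C \<Longrightarrow> B \<subseteq> C \<Longrightarrow> \<theta> ` A = \<theta> ` B \<longleftrightarrow> A = B"
  using inj_on_image_eq_iff[OF inj] .

lemma image_pull: "J \<subseteq> carrier L \<Longrightarrow> \<theta> ` pull J = J"
proof (intro subset_antisym subsetI)
  fix a assume "J \<subseteq> carrier L" "a \<in> J"
  then obtain x where "x \<in> C" "a = \<theta> x" using carrier_obtain by blast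
  then show "a \<in> \<theta> ` pull J" unfolding pull_def using \<open>a \<in> J\<close> by simp
qed (auto simp: pull_def)

lemma pull_C: "pull J \<subseteq> C"
  unfolding pull_def by blast

lemma image_INT_C:
  assumes "T \<noteq> {}" "\<And>t. t \<in> T \<Longrightarrow> A t \<subseteq> C"
  shows "\<theta> ` (\<Inter>t\<in>T. A t) = (\<Inter>t\<in>T. \<theta> ` A t)"
proof -
  obtain j where "j \<in> T" using assms(1) by blast
  then show ?thesis using image_INT[OF inj, of T A j] assms(2) by blast
qed

lemma image_Int_C: "A \<subseteq> C \<Longrightarrow> B \<subseteq> C \<Longrightarrow> \<theta> ` A \<inter> \<theta> ` B = \<theta> ` (A \<inter> B)"
  using inj_on_image_Int[OF inj] by blast

lemma abelian_group_L: "abelian_group L"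
proof (rule abelian_groupI)
  fix x y z assume xyz: "x \<in> carrier L" "y \<in> carrier L" "z \<in> carrier L"
  obtain a where a: "a \<in> C" "x = \<theta> a" using xyz(1) by (rule carrier_obtain)
  obtain b where b: "b \<in> C" "y = \<theta> b" using xyz(2) by (rule carrier_obtain)
  obtain c where c: "c \<in> C" "z = \<theta> c" using xyz(3) by (rule carrier_obtain)
  show "x \<oplus> y \<oplus> z = x \<oplus> (y \<oplus> z)"
    unfolding a b c using a b c by (simp add: \<theta>_add[symmetric] C_add add.assoc)
next
  fix x y assume xy: "x \<in> carrier L" "y \<in> carrier L"
  obtain a where a: "a \<in> C" "x = \<theta> a" using xy(1) by (rule carrier_obtain)
  obtain b where b: "b \<in> C" "y = \<theta> b" using xy(2) by (rule carrier_obtain)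
  show "x \<oplus> y \<in> carrier L" "x \<oplus> y = y \<oplus> x"
    unfolding a b using a b by (simp_all add: \<theta>_add[symmetric] C_add add.commute \<theta>_closed)
next
  fix x assume "x \<in> carrier L"
  then obtain a where a: "a \<in> C" "x = \<theta> a" by (rule carrier_obtain)
  show "\<zero> \<oplus> x = x"
    unfolding a \<theta>_zero[symmetric] using a by (simp add: \<theta>_add[symmetric] C_zero)
  have "\<theta> (- a) \<oplus> x = \<zero>"
    unfolding a \<theta>_zero[symmetric] using a by (simp add: \<theta>_add[symmetric] C_neg)
  then show "\<exists>y\<in>carrier L. y \<oplus> x = \<zero>" using \<theta>_closed[OF C_neg[OF a(1)]] by blast
qed (use \<theta>_closed[OF C_zero] \<theta>_zero in simp)

lemma \<theta>_neg: "x \<in> C \<Longrightarrow> \<theta> (- x) = \<ominus> \<theta> x"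
proof -
  assume x: "x \<in> C"
  have "\<theta> (- x) \<oplus> \<theta> x = \<zero>" unfolding \<theta>_zero[symmetric] using x by (simp add: \<theta>_add[symmetric] C_neg)
  then have "\<ominus> \<theta> x = \<theta> (- x)"
    using abelian_group.minus_equality[OF abelian_group_L] \<theta>_closed x C_neg by blast
  then show ?thesis by (rule sym)
qed

lemma \<theta>_diff: "x \<in> C \<Longrightarrow> y \<in> C \<Longrightarrow> \<theta> (x - y) = \<theta> x \<ominus> \<theta> y"
  using \<theta>_add[of x "- y"] \<theta>_neg[of y] C_neg[of y] by (simp add: a_minus_def)

lemma \<theta>_sum:
  assumes "finite T" "\<And>t. t \<in> T \<Longrightarrow> b t \<in> C"
  shows "\<theta> (\<Sum>t\<in>T. b t) = (\<Oplus>t\<in>T. \<theta> (b t))"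
proof -
  interpret abelian_group L by (rule abelian_group_L)
  show ?thesis
    using assms
  proof (induction T)
    case (insert t T)
    have "(\<Sum>s\<in>T. b s) \<in> C" using insert.prems by (intro idl_sum[OF idl_C]) simp
    moreover have "(\<lambda>t. \<theta> (b t)) \<in> T \<rightarrow> carrier L" "\<theta> (b t) \<in> carrier L"
      using insert.prems \<theta>_closed by simp_all
    ultimately show ?case
      using insert \<theta>_add[of "b t" "\<Sum>s\<in>T. b s"] finsum_insert[OF insert.hyps] by simp
  qed (simp add: \<theta>_zero)
qed

lemma ideal_image:
  assumes A: "A \<subseteq> C"
  shows "two_sided_ideal L (\<theta> ` A) \<longleftrightarrow> idl C A"
proof
  assume iA: "idl C A"
  show "two_sided_ideal L (\<theta> ` A)"
    unfolding two_sided_ideal_iff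
  proof (intro conjI ballI)
    show "\<theta> ` A \<subseteq> carrier L" using A \<theta>_carrier by blast
    show "\<zero> \<in> \<theta> ` A" using imageI[OF idl_zero[OF iA], of \<theta>] \<theta>_zero by simp
    fix x assume "x \<in> \<theta> ` A"
    then obtain a where a: "a \<in> A" "x = \<theta> a" by blast
    then have aC: "a \<in> C" using A by blast
    show "\<ominus> x \<in> \<theta> ` A" unfolding a(2) \<theta>_neg[OF aC, symmetric] using idl_neg[OF iA a(1)] by (rule imageI)
    { fix y assume "y \<in> carrier L"
      then obtain b where b: "b \<in> C" "y = \<theta> b" by (rule carrier_obtain)
      show "y \<otimes> x \<in> \<theta> ` A"
        unfolding a(2) b(2) \<theta>_mult[OF b(1) aC, symmetric] using idl_lmult[OF iA a(1)] by (rule imageI)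
      show "x \<otimes> y \<in> \<theta> ` A"
        unfolding a(2) b(2) \<theta>_mult[OF aC b(1), symmetric] using idl_rmult[OF iA a(1)] by (rule imageI) }
    fix y assume "y \<in> \<theta> ` A"
    then obtain b where b: "b \<in> A" "y = \<theta> b" by blast
    then have bC: "b \<in> C" using A by blast
    show "x \<oplus> y \<in> \<theta> ` A"
      unfolding a(2) b(2) \<theta>_add[OF aC bC, symmetric] using idl_add[OF iA a(1) b(1)] by (rule imageI)
  qed
next
  assume t: "two_sided_ideal L (\<theta> ` A)"
  note t' = t[unfolded two_sided_ideal_iff]
  have mult: "y * x \<in> A" "x * y \<in> A" if x: "x \<in> A" and y: "y \<in> C" for x y
  proof -
    have xC: "x \<in> C" using x A by blast
    have "\<theta> x \<in> \<theta> ` A" "\<theta> y \<in> carrier L" using x y \<theta>_closed by blast+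
    then have "\<theta> y \<otimes> \<theta> x \<in> \<theta> ` A" "\<theta> x \<otimes> \<theta> y \<in> \<theta> ` A" using t' by blast+
    then show "y * x \<in> A" "x * y \<in> A"
      unfolding \<theta>_mult[OF y xC, symmetric] \<theta>_mult[OF xC y, symmetric]
      using image_mem[OF A] C_mult xC y by blast+
  qed
  show "idl C A"
    unfolding idl_def
  proof (intro conjI ballI allI A)
    have "\<theta> 0 \<in> \<theta> ` A" using t' unfolding \<theta>_zero by blast
    then show "0 \<in> A" using image_mem[OF A C_zero] by blast
    fix x assume x: "x \<in> A"
    then have xC: "x \<in> C" using A by blast
    have "\<ominus> \<theta> x \<in> \<theta> ` A" using t' x by blast
    then show "- x \<in> A" unfolding \<theta>_neg[OF xC, symmetric] using image_mem[OF A C_neg[OF xC]] by blast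
    \<comment> \<open>Ideals of \<open>L\<close> absorb factors from the carrier only. A local unit
      u brings an arbitrary y of the ambient ring into \<open>C\<close>, as y x = (y u) x.\<close>
    obtain u where u: "u \<in> C" "u * x = x" "x * u = x" using C_units[OF xC] by blast
    { fix y
      have "y * u \<in> C" "u * y \<in> C" using idl_lmult[OF idl_C u(1)] idl_rmult[OF idl_C u(1)] by blast+
      then have "(y * u) * x \<in> A" "x * (u * y) \<in> A" using mult x by blast+
      moreover have "(y * u) * x = y * x" "x * (u * y) = x * y"
        using u(2) u(3) by (simp_all add: mult.assoc) (simp add: mult.assoc[symmetric])
      ultimately show "y * x \<in> A" "x * y \<in> A" by simp_all }
    fix y assume y: "y \<in> A"
    then have yC: "y \<in> C" using A by blast
    have "\<theta> x \<oplus> \<theta> y \<in> \<theta> ` A" using t' x y by blast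
    then show "x + y \<in> A"
      unfolding \<theta>_add[OF xC yC, symmetric] using image_mem[OF A C_add[OF xC yC]] by blast
  qed
qed

lemma ideal_obtain:
  assumes "two_sided_ideal L J"
  obtains A where "J = \<theta> ` A" "idl C A" "A = pull J"
proof -
  have J: "J = \<theta> ` pull J" using image_pull[of J] assms unfolding two_sided_ideal_iff by simp
  then have "idl C (pull J)" using ideal_image[OF pull_C, of J] assms by simp
  then show thesis using that J by blast
qed

lemma ideal_gen_image:
  assumes B: "B \<subseteq> C"
  shows "ideal_gen L (\<theta> ` B) = \<theta> ` gen C B"
proof
  have "two_sided_ideal L (\<theta> ` gen C B)"
    using ideal_image[OF idl_sub[OF idl_gen[OF B]]] idl_gen[OF B] by blast
  then show "ideal_gen L (\<theta> ` B) \<subseteq> \<theta> ` gen C B"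
    unfolding ideal_gen_def using gen_superset[of B C] by blast
  show "\<theta> ` gen C B \<subseteq> ideal_gen L (\<theta> ` B)"
    unfolding ideal_gen_def
  proof (intro Inter_greatest)
    fix J assume "J \<in> {I. two_sided_ideal L I \<and> \<theta> ` B \<subseteq> I}"
    then have J: "two_sided_ideal L J" "\<theta> ` B \<subseteq> J" by blast+
    obtain A where A: "J = \<theta> ` A" "idl C A" using J(1) by (rule ideal_obtain)
    then have "B \<subseteq> A" using J(2) image_subset[OF B idl_sub[OF A(2)]] by simp
    then show "\<theta> ` gen C B \<subseteq> J" using gen_least[OF A(2)] A(1) by blast
  qed
qed

lemma ideal_prod_image:
  assumes A: "idl C A" and B: "idl C B"
  shows "ideal_prod L (\<theta> ` A) (\<theta> ` B) = \<theta> ` iprod A B"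
proof
  have AC: "a \<in> C" if "a \<in> A" for a using idl_sub[OF A] that by blast
  have BC: "b \<in> C" if "b \<in> B" for b using idl_sub[OF B] that by blast
  note P = idl_iprod[OF A B]
  have PC: "x \<in> C" if "x \<in> iprod A B" for x using idl_sub[OF P] that by blast
  show "ideal_prod L (\<theta> ` A) (\<theta> ` B) \<subseteq> \<theta> ` iprod A B"
  proof
    fix z assume "z \<in> ideal_prod L (\<theta> ` A) (\<theta> ` B)"
    then show "z \<in> \<theta> ` iprod A B"
    proof induction
      case (prod i j)
      then obtain a b where ab: "a \<in> A" "b \<in> B" "i = \<theta> a" "j = \<theta> b" by blast
      show ?case
        unfolding ab(3,4) \<theta>_mult[OF AC[OF ab(1)] BC[OF ab(2)], symmetric]
        by (rule imageI[OF iprod_base[OF ab(1,2)]])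
    next
      case (sum s1 s2)
      then obtain x y where xy: "x \<in> iprod A B" "y \<in> iprod A B" "s1 = \<theta> x" "s2 = \<theta> y" by blast
      show ?case
        unfolding xy(3,4) \<theta>_add[OF PC[OF xy(1)] PC[OF xy(2)], symmetric]
        by (rule imageI[OF idl_add[OF P xy(1,2)]])
    qed
  qed
  have prod: "\<theta> (a * b) \<in> ideal_prod L (\<theta> ` A) (\<theta> ` B)" if "a \<in> A" "b \<in> B" for a b
    unfolding \<theta>_mult[OF AC[OF that(1)] BC[OF that(2)]] using that by (intro ideal_prod.prod imageI)
  have "x \<in> C \<and> \<theta> x \<in> ideal_prod L (\<theta> ` A) (\<theta> ` B)" if "x \<in> iprod A B" for x
    using that unfolding iprod_def
  proof induction
    case aspan_zero
    \<comment> \<open>\<open>ideal_prod\<close> has no rule for zero, so 0 is obtained as the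
      product of two zeros.\<close>
    show ?case using prod[OF idl_zero[OF A] idl_zero[OF B]] C_zero by simp
  next
    case (aspan_add b x)
    then obtain a a' where a: "b = a * a'" "a \<in> A" "a' \<in> B" by blast
    have b: "b \<in> C" using a BC C_mult by blast
    show ?case
      using \<theta>_add[OF b, of x] aspan_add.IH ideal_prod.sum[OF prod[OF a(2,3)], of "\<theta> x"] C_add[OF b] a(1)
      by simp
  qed
  then show "\<theta> ` iprod A B \<subseteq> ideal_prod L (\<theta> ` A) (\<theta> ` B)" by blast
qed

lemma foldl_ideal_prod_image:
  "idl C A \<Longrightarrow> (\<And>B. B \<in> set Bs \<Longrightarrow> idl C B) \<Longrightarrow>
    foldl (ideal_prod L) (\<theta> ` A) (map ((`) \<theta>) Bs) = \<theta> ` foldl iprod A Bs"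
  by (induction Bs arbitrary: A) (simp_all add: ideal_prod_image idl_iprod)

lemma set_add_image:
  assumes "A \<subseteq> C" "B \<subseteq> C"
  shows "\<theta> ` A <+> \<theta> ` B = \<theta> ` isum A B"
proof -
  have "\<theta> ` A <+> \<theta> ` B = {\<theta> a \<oplus> \<theta> b |a b. a \<in> A \<and> b \<in> B}"
    unfolding set_add_def set_mult_def by auto
  also have "\<dots> = {\<theta> (a + b) |a b. a \<in> A \<and> b \<in> B}"
    using \<theta>_add assms by (metis (no_types, opaque_lifting) subsetD)
  also have "\<dots> = \<theta> ` isum A B" unfolding isum_def by blast
  finally show ?thesis .
qed

lemma finsum_image:
  assumes "finite T" "\<And>t. t \<in> T \<Longrightarrow> a t \<in> C" "\<And>t. t \<in> T \<Longrightarrow> b t = \<theta> (a t)"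
  shows "(\<Oplus>t\<in>T. b t) = \<theta> (\<Sum>t\<in>T. a t)"
proof -
  interpret abelian_group L by (rule abelian_group_L)
  have "(\<Oplus>t\<in>T. b t) = (\<Oplus>t\<in>T. \<theta> (a t))"
    using assms \<theta>_closed by (intro finsum_cong') simp_all
  then show ?thesis using \<theta>_sum[OF assms(1,2)] by simp
qed

lemma ideal_sum_image:
  assumes "finite T" "\<And>t. t \<in> T \<Longrightarrow> idl C (J t)"
  shows "ideal_sum L T (\<lambda>t. \<theta> ` J t) = \<theta> ` fam_sum T J"
proof
  have JC: "x \<in> C" if "t \<in> T" "x \<in> J t" for t x using idl_sub[OF assms(2)[OF that(1)]] that(2) by blast
  show "ideal_sum L T (\<lambda>t. \<theta> ` J t) \<subseteq> \<theta> ` fam_sum T J"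
  proof
    fix x assume "x \<in> ideal_sum L T (\<lambda>t. \<theta> ` J t)"
    then obtain b where b: "x = (\<Oplus>t\<in>T. b t)" "\<forall>t\<in>T. b t \<in> \<theta> ` J t" unfolding ideal_sum_def by blast
    then have "\<forall>t\<in>T. \<exists>y. y \<in> J t \<and> b t = \<theta> y" by blast
    then obtain a where a: "\<forall>t\<in>T. a t \<in> J t \<and> b t = \<theta> (a t)" by metis
    have "x = \<theta> (\<Sum>t\<in>T. a t)"
      unfolding b(1) using a JC by (intro finsum_image assms(1)) blast+
    then show "x \<in> \<theta> ` fam_sum T J" unfolding fam_sum_def using a by blast
  qed
  show "\<theta> ` fam_sum T J \<subseteq> ideal_sum L T (\<lambda>t. \<theta> ` J t)"
  proof
    fix x assume "x \<in> \<theta> ` fam_sum T J"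
    then obtain a where a: "x = \<theta> (\<Sum>t\<in>T. a t)" "\<forall>t\<in>T. a t \<in> J t" unfolding fam_sum_def by blast
    have "x = (\<Oplus>t\<in>T. \<theta> (a t))" unfolding a(1) using a(2) JC by (intro \<theta>_sum assms(1)) blast
    then show "x \<in> ideal_sum L T (\<lambda>t. \<theta> ` J t)" unfolding ideal_sum_def using a(2) by blast
  qed
qed

lemma all_ideals:
  "(\<forall>J. two_sided_ideal L J \<longrightarrow> Q J) \<longleftrightarrow> (\<forall>A. idl C A \<longrightarrow> Q (\<theta> ` A))"
proof (intro iffI allI impI)
  fix A assume "\<forall>J. two_sided_ideal L J \<longrightarrow> Q J" "idl C A"
  then show "Q (\<theta> ` A)" using ideal_image[OF idl_sub] by blast
next
  fix J assume "\<forall>A. idl C A \<longrightarrow> Q (\<theta> ` A)" "two_sided_ideal L J"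
  then show "Q J" using ideal_obtain[of J] by metis
qed

lemma all_ideals2:
  "(\<forall>J K. two_sided_ideal L J \<longrightarrow> two_sided_ideal L K \<longrightarrow> Q J K) \<longleftrightarrow>
    (\<forall>A B. idl C A \<longrightarrow> idl C B \<longrightarrow> Q (\<theta> ` A) (\<theta> ` B))"
proof -
  have "(\<forall>J K. two_sided_ideal L J \<longrightarrow> two_sided_ideal L K \<longrightarrow> Q J K) \<longleftrightarrow>
      (\<forall>J. two_sided_ideal L J \<longrightarrow> (\<forall>K. two_sided_ideal L K \<longrightarrow> Q J K))" by blast
  also have "\<dots> \<longleftrightarrow> (\<forall>A. idl C A \<longrightarrow> (\<forall>B. idl C B \<longrightarrow> Q (\<theta> ` A) (\<theta> ` B)))"
    by (simp only: all_ideals)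
  finally show ?thesis by blast
qed

lemma prime_image:
  assumes P: "idl C P"
  shows "prime_ideal L (\<theta> ` P) \<longleftrightarrow> prime_idl P"
proof -
  have "(ideal_prod L (\<theta> ` A) (\<theta> ` B) \<subseteq> \<theta> ` P \<longrightarrow> \<theta> ` A \<subseteq> \<theta> ` P \<or> \<theta> ` B \<subseteq> \<theta> ` P) \<longleftrightarrow>
      (iprod A B \<subseteq> P \<longrightarrow> A \<subseteq> P \<or> B \<subseteq> P)" if "idl C A" "idl C B" for A B
    using that P by (simp add: ideal_prod_image image_subset idl_sub idl_iprod)
  then show ?thesis
    unfolding prime_ideal_def prime_idl_def \<theta>_carrier[symmetric] all_ideals2
    using ideal_image[OF idl_sub[OF P]] P image_eq[OF idl_sub[OF P] order_refl] by simp
qed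

lemma irreducible_image:
  assumes A: "idl C A"
  shows "irreducible_ideal L (\<theta> ` A) \<longleftrightarrow> irred_idl A"
proof -
  have "(\<theta> ` B \<inter> \<theta> ` D = \<theta> ` A \<longrightarrow> \<theta> ` B = \<theta> ` A \<or> \<theta> ` D = \<theta> ` A) \<longleftrightarrow> (B \<inter> D = A \<longrightarrow> B = A \<or> D = A)"
    if "idl C B" "idl C D" for B D
    using that A by (simp add: image_Int_C image_eq idl_sub le_infI1)
  then show ?thesis
    unfolding irreducible_ideal_def irred_idl_def all_ideals2
    using ideal_image[OF idl_sub[OF A]] A by simp
qed

lemma strongly_irreducible_image:
  assumes A: "idl C A"
  shows "strongly_irreducible_ideal L (\<theta> ` A) \<longleftrightarrow> sirred_idl A"
proof -
  have "(\<theta> ` B \<inter> \<theta> ` D \<subseteq> \<theta> ` A \<longrightarrow> \<theta> ` B \<subseteq> \<theta> ` A \<or> \<theta> ` D \<subseteq> \<theta> ` A) \<longleftrightarrow>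
      (B \<inter> D \<subseteq> A \<longrightarrow> B \<subseteq> A \<or> D \<subseteq> A)"
    if "idl C B" "idl C D" for B D
    using that A by (simp add: image_Int_C image_subset idl_sub le_infI1)
  then show ?thesis
    unfolding strongly_irreducible_ideal_def sirred_idl_def all_ideals2
    using ideal_image[OF idl_sub[OF A]] A by simp
qed

end

section \<open>Graded ideals, graded parts and cycle polynomials in the coset algebra\<close>

locale leavitt_lpa = leavitt_iso E V X Y sc hc C "lpa E" \<theta>
  for E :: "('v, 'e) pre_digraph" and V :: "'v \<Rightarrow> 'a::ring" and X Y :: "'e \<Rightarrow> 'a"
    and sc :: "'k::field \<Rightarrow> 'a \<Rightarrow> 'a" and hc :: "int \<Rightarrow> 'a \<Rightarrow> 'a" and C :: "'a set"
    and \<theta> :: "'a \<Rightarrow> ('v, 'e, 'k) lpa_elem" +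
  assumes \<theta>_sc: "x \<in> C \<Longrightarrow> \<theta> (sc k x) = k \<odot>\<^bsub>lpa E\<^esub> \<theta> x"
    and \<theta>_V: "v \<in> verts E \<Longrightarrow> \<theta> (V v) = lpa_gen E (Vert v)"
    and \<theta>_X: "e \<in> arcs E \<Longrightarrow> \<theta> (X e) = lpa_gen E (Edge e)"
    and \<theta>_Y: "e \<in> arcs E \<Longrightarrow> \<theta> (Y e) = lpa_gen E (Ghost e)"
    and \<theta>_component: "lpa_component E n = \<theta> ` {x \<in> C. hc n x = x}"
    and hc_finite: "x \<in> C \<Longrightarrow> \<exists>N. finite N \<and> x = (\<Sum>n\<in>N. hc n x)"
begin

abbreviation L :: "('k, ('v, 'e, 'k) lpa_elem) module" where
  "L \<equiv> lpa E"

text \<open>One notion asks for homogeneous summands inside the ideal, the other for closure under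
  the projections; they agree because \<open>hc n\<close> picks the summand of degree n out of any
  such sum.\<close>

lemma graded_image:
  assumes A: "idl C A"
  shows "graded_ideal E (\<theta> ` A) \<longleftrightarrow> graded A"
proof
  note AC = idl_sub[OF A]
  assume g: "graded A"
  show "graded_ideal E (\<theta> ` A)"
    unfolding graded_ideal_def
  proof (intro conjI ballI)
    show "two_sided_ideal L (\<theta> ` A)" using ideal_image[OF AC] A by blast
    fix a assume "a \<in> \<theta> ` A"
    then obtain x where x: "a = \<theta> x" "x \<in> A" by blast
    obtain N where N: "finite N" "x = (\<Sum>n\<in>N. hc n x)" using hc_finite x AC by blast
    have hA: "hc n x \<in> A" for n using g x unfolding graded_def by blast
    have hC: "hc n x \<in> C" for n using hA AC by blast
    have "a = (\<Oplus>\<^bsub>L\<^esub>n\<in>N. \<theta> (hc n x))"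
      using \<theta>_sum[OF N(1), of "\<lambda>n. hc n x"] hC N(2) x(1) by simp
    moreover have "\<theta> (hc n x) \<in> \<theta> ` A \<inter> lpa_component E n" for n
      unfolding \<theta>_component using hA[of n] hC[of n] hc_hc[of n n x] by (simp add: image_eqI)
    ultimately show "\<exists>N h. finite N \<and> (\<forall>n\<in>N. h n \<in> \<theta> ` A \<inter> lpa_component E n) \<and> a = (\<Oplus>\<^bsub>L\<^esub>n\<in>N. h n)"
      using N(1) by (intro exI[of _ N] exI[of _ "\<lambda>n. \<theta> (hc n x)"]) blast
  qed
next
  note AC = idl_sub[OF A]
  assume g: "graded_ideal E (\<theta> ` A)"
  show "graded A"
    unfolding graded_def
  proof (intro conjI ballI allI A)
    fix x m assume x: "x \<in> A"
    then have "\<theta> x \<in> \<theta> ` A" by blast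
    then obtain N h where N: "finite N" "\<forall>n\<in>N. h n \<in> \<theta> ` A \<inter> lpa_component E n" "\<theta> x = (\<Oplus>\<^bsub>L\<^esub>n\<in>N. h n)"
      using g unfolding graded_ideal_def by meson
    have "\<exists>y. y \<in> A \<and> hc n y = y \<and> h n = \<theta> y" if n: "n \<in> N" for n
    proof -
      obtain y where y: "y \<in> A" "h n = \<theta> y" using N(2) n by blast
      obtain z where z: "z \<in> C" "hc n z = z" "h n = \<theta> z" using N(2) n unfolding \<theta>_component by blast
      have "y = z" using \<theta>_inj[of y z] y z AC by auto
      then show ?thesis using y z by blast
    qed
    then obtain y where y: "\<forall>n\<in>N. y n \<in> A \<and> hc n (y n) = y n \<and> h n = \<theta> (y n)" by metis
    have "\<theta> x = \<theta> (\<Sum>n\<in>N. y n)"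
      unfolding N(3) using y AC by (intro finsum_image N(1)) blast+
    moreover have "(\<Sum>n\<in>N. y n) \<in> C" using y AC by (intro idl_sum[OF idl_C]) blast
    ultimately have "x = (\<Sum>n\<in>N. y n)" using \<theta>_inj x AC by blast
    then have "hc m x = (\<Sum>n\<in>N. hc m (y n))" by (simp add: hc_sum)
    also have "\<dots> \<in> A"
    proof (rule idl_sum[OF A])
      fix n assume "n \<in> N"
      then show "hc m (y n) \<in> A" using y hc_homogeneous[of n "y n" m] idl_zero[OF A] by auto
    qed
    finally show "hc m x \<in> A" .
  qed
qed

lemma gr_verts_image:
  assumes "A \<subseteq> C"
  shows "gr_verts E (\<theta> ` A) = gv A"
proof -
  have "lpa_gen E (Vert v) \<in> \<theta> ` A \<longleftrightarrow> V v \<in> A" if "v \<in> verts E" for v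
    using image_mem[OF assms V_C[OF that]] \<theta>_V[OF that] by simp
  then show ?thesis unfolding gr_verts_def gv_def by (intro Collect_cong) blast
qed

lemma breaking_elem_image:
  assumes "v \<in> breaking_verts E H"
  shows "breaking_elem E H v = \<theta> (cut v (brk H v))" "cut v (brk H v) \<in> C"
proof -
  have v: "v \<in> verts E" and fin: "finite (brk H v)" and sub: "brk H v \<subseteq> out_arcs E v"
    using assms unfolding breaking_verts_def brk_def by auto
  show "cut v (brk H v) \<in> C" using cut_C[OF fin sub v] .
  have XY: "X e * Y e \<in> C" "X e \<in> C" "Y e \<in> C" "e \<in> arcs E" if "e \<in> brk H v" for e
    using that sub X_in_C Y_in_C idl_rmult[OF idl_C] by auto
  have "\<theta> (\<Sum>e\<in>brk H v. X e * Y e) = (\<Oplus>\<^bsub>L\<^esub>e\<in>brk H v. \<theta> (X e * Y e))" using XY fin by (intro \<theta>_sum) auto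
  also have "\<dots> = (\<Oplus>\<^bsub>L\<^esub>e\<in>brk H v. lpa_gen E (Edge e) \<otimes>\<^bsub>L\<^esub> lpa_gen E (Ghost e))"
  proof (rule abelian_monoid.finsum_cong'[OF abelian_group.axioms(1)[OF abelian_group_L] refl])
    have *: "\<theta> (X e * Y e) = lpa_gen E (Edge e) \<otimes>\<^bsub>L\<^esub> lpa_gen E (Ghost e)" if "e \<in> brk H v" for e
      using XY[OF that] \<theta>_mult \<theta>_X \<theta>_Y by simp
    then show "\<theta> (X e * Y e) = lpa_gen E (Edge e) \<otimes>\<^bsub>L\<^esub> lpa_gen E (Ghost e)" if "e \<in> brk H v" for e
      using that .
    show "(\<lambda>e. lpa_gen E (Edge e) \<otimes>\<^bsub>L\<^esub> lpa_gen E (Ghost e)) \<in> brk H v \<rightarrow> carrier L"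
      using *[symmetric] XY(1) \<theta>_carrier by auto
  qed
  finally have "\<theta> (\<Sum>e\<in>brk H v. X e * Y e) = (\<Oplus>\<^bsub>L\<^esub>e\<in>brk H v. lpa_gen E (Edge e) \<otimes>\<^bsub>L\<^esub> lpa_gen E (Ghost e))" .
  moreover have "(\<Sum>e\<in>brk H v. X e * Y e) \<in> C" using XY(1) by (intro idl_sum[OF idl_C])
  ultimately show "breaking_elem E H v = \<theta> (cut v (brk H v))"
    unfolding breaking_elem_def cut_def using \<theta>_diff V_C[OF v] \<theta>_V[OF v] by (simp add: brk_def)
qed

lemma gr_breaking_image:
  assumes "A \<subseteq> C"
  shows "gr_breaking E (\<theta> ` A) = gs A"
proof -
  have "breaking_elem E (gv A) v \<in> \<theta> ` A \<longleftrightarrow> cut v (brk (gv A) v) \<in> A" if "v \<in> breaking_verts E (gv A)" for v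
    using image_mem[OF assms breaking_elem_image(2)[OF that]] breaking_elem_image(1)[OF that] by simp
  then show ?thesis
    unfolding gr_breaking_def gs_def gr_verts_image[OF assms] by (intro Collect_cong) blast
qed

lemma pair_ideal_image:
  assumes "A \<subseteq> C"
  shows "pair_ideal E (gv A) (gs A) = \<theta> ` gr A"
proof -
  have "(\<lambda>v. lpa_gen E (Vert v)) ` gv A = \<theta> ` V ` gv A"
    unfolding image_image by (rule image_cong) (auto simp: \<theta>_V gv_def)
  moreover have "breaking_elem E (gv A) ` gs A = \<theta> ` (\<lambda>v. cut v (brk (gv A) v)) ` gs A"
    unfolding image_image by (rule image_cong) (auto simp: breaking_elem_image gs_def)
  ultimately show ?thesis
    unfolding pair_ideal_def gr_def using ideal_gen_image[OF gr_gens(1)] by (simp add: image_Un)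
qed

lemma gr_part_image: "A \<subseteq> C \<Longrightarrow> gr_part E (\<theta> ` A) = \<theta> ` gr A"
  unfolding gr_part_def using gr_verts_image gr_breaking_image pair_ideal_image by simp

lemma prime_decomposition_C: "prime_decomposition J m P \<Longrightarrow> i \<in> {1..m} \<Longrightarrow> P i \<subseteq> C"
  unfolding prime_decomposition_def using idl_sub[OF graded_idl] by simp

lemma prime_decomposition_image:
  assumes J: "J \<subseteq> C" and P: "\<And>i. i \<in> {1..m} \<Longrightarrow> P' i = \<theta> ` P i \<and> P i \<subseteq> C"
  shows "graded_prime_decomposition E (\<theta> ` J) m P' \<longleftrightarrow> prime_decomposition J m P"
proof (cases "1 \<le> m")
  case m: True
  have "graded_prime_ideal E (P' i) \<longleftrightarrow> graded (P i) \<and> prime_idl (P i)" if "i \<in> {1..m}" for i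
  proof (cases "idl C (P i)")
    case True
    then show ?thesis unfolding graded_prime_ideal_def using P[OF that] graded_image prime_image by simp
  next
    case False
    then have "\<not> two_sided_ideal L (P' i)" using P[OF that] ideal_image by simp
    then show ?thesis using False unfolding graded_prime_ideal_def graded_ideal_def graded_def by simp
  qed
  moreover have "\<theta> ` J = (\<Inter>i\<in>{1..m}. P' i) \<longleftrightarrow> J = (\<Inter>i\<in>{1..m}. P i)"
  proof -
    have ne: "{1..m} \<noteq> {}" "1 \<in> {1..m}" using m by simp_all
    have PC: "P i \<subseteq> C" if "i \<in> {1..m}" for i using P[OF that] by blast
    have "(\<Inter>i\<in>{1..m}. P' i) = (\<Inter>i\<in>{1..m}. \<theta> ` P i)" using P by simp
    also have "\<dots> = \<theta> ` (\<Inter>i\<in>{1..m}. P i)" using image_INT_C[OF ne(1) PC] by simp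
    finally have eq: "(\<Inter>i\<in>{1..m}. P' i) = \<theta> ` (\<Inter>i\<in>{1..m}. P i)" .
    have sub: "(\<Inter>i\<in>{1..m}. P i) \<subseteq> C" using PC[OF ne(2)] ne(2) by blast
    show ?thesis unfolding eq by (rule image_eq[OF J sub])
  qed
  moreover have "carrier L \<inter> (\<Inter>i\<in>{1..m} - {j}. P' i) \<subseteq> P' j \<longleftrightarrow> C \<inter> (\<Inter>i\<in>{1..m} - {j}. P i) \<subseteq> P j"
    if j: "j \<in> {1..m}" for j
  proof -
    have "carrier L \<inter> (\<Inter>i\<in>{1..m} - {j}. P' i) = \<theta> ` (C \<inter> (\<Inter>i\<in>{1..m} - {j}. P i))"
      unfolding \<theta>_carrier[symmetric]
    proof (intro subset_antisym subsetI)
      fix x assume x: "x \<in> \<theta> ` C \<inter> (\<Inter>i\<in>{1..m} - {j}. P' i)"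
      then obtain y where y: "y \<in> C" "x = \<theta> y" by blast
      then have "y \<in> P i" if i: "i \<in> {1..m} - {j}" for i
      proof -
        have "\<theta> y \<in> P' i" using x y i by blast
        moreover have "P' i = \<theta> ` P i" "P i \<subseteq> C" using P[of i] i by blast+
        ultimately show ?thesis using image_mem[of "P i" y] y by simp
      qed
      then show "x \<in> \<theta> ` (C \<inter> (\<Inter>i\<in>{1..m} - {j}. P i))" using y by blast
    qed (use P in auto)
    then show ?thesis using image_subset[of "C \<inter> (\<Inter>i\<in>{1..m} - {j}. P i)" "P j"] P[OF j] by auto
  qed
  ultimately show ?thesis
    unfolding graded_prime_decomposition_def prime_decomposition_def irredundant_inter_def by simp
qed (simp add: graded_prime_decomposition_def prime_decomposition_def)

text \<open>Generalised over the accumulator y, which must end where the remaining path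
  starts.\<close>

lemma foldl_edges:
  assumes "awalk v p w" "y \<in> C" "y * V v = y"
  shows "foldl (\<lambda>x e. x \<otimes>\<^bsub>L\<^esub> lpa_gen E (Edge e)) (\<theta> y) p = \<theta> (y * pe v p)"
  using assms
proof (induction p arbitrary: v y)
  case (Cons e p)
  then have e: "e \<in> arcs E" "awalk (head E e) p w" by (auto simp: awalk_Cons_iff)
  have "foldl (\<lambda>x e. x \<otimes>\<^bsub>L\<^esub> lpa_gen E (Edge e)) (\<theta> (y * X e)) p = \<theta> (y * X e * pe (head E e) p)"
    using C_mult[OF X_in_C[OF e(1)]] XV[OF e(1)] by (intro Cons.IH e) (auto simp: mult.assoc)
  then show ?case using \<theta>_mult[OF Cons.prems(2) X_in_C[OF e(1)]] \<theta>_X[OF e(1)] by (simp add: mult.assoc)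
qed simp

lemma cycle_elem_image: "closed_path c \<Longrightarrow> cycle_elem E c = \<theta> (pe (base c) c)"
proof -
  assume c: "closed_path c"
  obtain e p where ep: "c = e # p" using closed_pathD(3)[OF c] by (cases c) auto
  have e: "e \<in> arcs E" "awalk (head E e) p (base c)" using closed_pathD(1)[OF c] ep by (auto simp: awalk_Cons_iff)
  show ?thesis
    unfolding cycle_elem_def using foldl_edges[OF e(2) X_in_C[OF e(1)] XV[OF e(1)]] \<theta>_X[OF e(1)] by (simp add: ep)
qed

lemma cycle_power_image: "closed_path c \<Longrightarrow> cycle_power E c n = \<theta> (pe (base c) (power_path c n))"
proof (induction n)
  case 0
  then show ?case unfolding cycle_power_def cycle_base_def using \<theta>_V closed_pathD(2) by (simp add: base_def)
next
  case (Suc n)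
  note c = Suc.prems
  have mem: "pe (base c) (power_path c i) \<in> C" for i using pc_C[OF c] pc_power[OF c] by simp
  have 1: "pe (base c) c = pe (base c) (power_path c 1)" by simp
  have "pe (base c) (power_path c n) * pe (base c) (power_path c 1) = pe (base c) (power_path c (n + 1))"
    using pc_mult[OF c, of "monom 1 n" "monom 1 1"] unfolding pc_power[OF c] by (simp add: mult_monom)
  then have "pe (base c) (power_path c n) * pe (base c) c = pe (base c) (power_path c (Suc n))" by simp
  then show ?case
    using Suc \<theta>_mult[OF mem[of n] mem[of 1]] cycle_elem_image[OF c] unfolding cycle_power_def by simp
qed

lemma poly_at_cycle_image:
  assumes c: "closed_path c"
  shows "poly_at_cycle E f c = \<theta> (pc c f)"
proof -
  let ?p = "\<lambda>i. pe (base c) (power_path c i)"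
  have mem: "?p i \<in> C" for i using pc_C[OF c] pc_power[OF c] by simp
  have "\<theta> (pc c f) = (\<Oplus>\<^bsub>L\<^esub>i\<in>{..degree f}. \<theta> (sc (coeff f i) (?p i)))"
    unfolding pc_altdef[OF c order_refl] using mem idl_sc[OF idl_C] by (intro \<theta>_sum) auto
  then show ?thesis
    unfolding poly_at_cycle_def using cycle_power_image[OF c] \<theta>_sc[OF mem] by simp
qed

text \<open>Everything passes through (2): intersections of irreducible ideals and products lead to
  (2), and (2) returns strongly irreducible ideals, which settles both readings of (1) at once.
  Condition (3) contains (2).\<close>

theorem finite_decompositions:
  assumes "two_sided_ideal L I" and "I \<noteq> carrier L" and H: "H = gr_verts E I" and S: "S = gr_breaking E I"
  shows
    "let C1 = (\<exists>\<A>. finite \<A> \<and> \<A> \<noteq> {} \<and> (\<forall>A\<in>\<A>. irreducible_ideal L A) \<and> I = \<Inter>\<A>);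
         C1s = (\<exists>\<A>. finite \<A> \<and> \<A> \<noteq> {} \<and> (\<forall>A\<in>\<A>. strongly_irreducible_ideal L A) \<and> I = \<Inter>\<A>);
         C2 = (\<exists>m P. graded_prime_decomposition E (gr_part E I) m P);
         C3 = (\<exists>m (P :: nat \<Rightarrow> ('v, 'e, 'k) lpa_elem set) k (f :: nat \<Rightarrow> 'k poly)
                 (c :: nat \<Rightarrow> 'e list).
                 gr_part E I = pair_ideal E H S \<and>
                 graded_prime_decomposition E (gr_part E I) m P \<and>
                 k \<le> m \<and>
                 (\<forall>t\<in>{1..k}.
                    cycle_without_exits (quotient_graph E H S) (map Inl (c t)) \<and>
                    lpa_gen E (Vert (cycle_base E (c t))) \<notin> P t \<and>
                    poly.coeff (f t) 0 \<noteq> 0) \<and>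
                 I = pair_ideal E H S <+>\<^bsub>L\<^esub>
                       ideal_sum L {1..k} (\<lambda>t. ideal_gen L {poly_at_cycle E (f t) (c t)}));
         C4 = (\<exists>J Js. (\<forall>A\<in>set (J # Js). strongly_irreducible_ideal L A) \<and>
                 I = foldl (ideal_prod L) J Js)
     in (C1 \<longleftrightarrow> C2) \<and> (C1s \<longleftrightarrow> C2) \<and> (C3 \<longleftrightarrow> C2) \<and> (C4 \<longleftrightarrow> C2)"
proof -
  obtain A where IA: "I = \<theta> ` A" and A: "idl C A" using assms(1) by (rule ideal_obtain)
  have AC: "A \<subseteq> C" using idl_sub[OF A] .
  have AneqC: "A \<noteq> C" using assms(2) IA \<theta>_carrier by blast
  have HS: "H = gv A" "S = gs A" using H S gr_verts_image[OF AC] gr_breaking_image[OF AC] IA by simp_all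
  have grI: "gr_part E I = \<theta> ` gr A" using gr_part_image[OF AC] IA by simp
  have pair: "pair_ideal E H S = \<theta> ` gr A" using pair_ideal_image[OF AC] HS by simp
  have grC: "gr A \<subseteq> C" using idl_sub[OF idl_gr] .
  let ?C1 = "\<exists>\<A>. finite \<A> \<and> \<A> \<noteq> {} \<and> (\<forall>A\<in>\<A>. irreducible_ideal L A) \<and> I = \<Inter>\<A>"
  let ?C1s = "\<exists>\<A>. finite \<A> \<and> \<A> \<noteq> {} \<and> (\<forall>A\<in>\<A>. strongly_irreducible_ideal L A) \<and> I = \<Inter>\<A>"
  let ?C2 = "\<exists>m P. graded_prime_decomposition E (gr_part E I) m P"
  let ?C3 = "\<exists>m (P :: nat \<Rightarrow> ('v, 'e, 'k) lpa_elem set) k (f :: nat \<Rightarrow> 'k poly) (c :: nat \<Rightarrow> 'e list).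
      gr_part E I = pair_ideal E H S \<and> graded_prime_decomposition E (gr_part E I) m P \<and> k \<le> m \<and>
      (\<forall>t\<in>{1..k}. cycle_without_exits (quotient_graph E H S) (map Inl (c t)) \<and>
         lpa_gen E (Vert (cycle_base E (c t))) \<notin> P t \<and> poly.coeff (f t) 0 \<noteq> 0) \<and>
      I = pair_ideal E H S <+>\<^bsub>L\<^esub> ideal_sum L {1..k} (\<lambda>t. ideal_gen L {poly_at_cycle E (f t) (c t)})"
  let ?C4 = "\<exists>J Js. (\<forall>A\<in>set (J # Js). strongly_irreducible_ideal L A) \<and> I = foldl (ideal_prod L) J Js"
  have dec: "?C2 \<longleftrightarrow> (\<exists>m P. prime_decomposition (gr A) m P)"
  proof
    assume ?C2
    then obtain m P' where P': "graded_prime_decomposition E (\<theta> ` gr A) m P'" unfolding grI by blast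
    have "P' i = \<theta> ` pull (P' i) \<and> pull (P' i) \<subseteq> C" if "i \<in> {1..m}" for i
    proof -
      have "graded_prime_ideal E (P' i)" using P' that unfolding graded_prime_decomposition_def by simp
      then have "two_sided_ideal L (P' i)" unfolding graded_prime_ideal_def graded_ideal_def by simp
      then have "P' i \<subseteq> carrier L" unfolding two_sided_ideal_iff by simp
      then show ?thesis using image_pull[of "P' i"] pull_C by simp
    qed
    then have "prime_decomposition (gr A) m (\<lambda>i. pull (P' i))"
      using prime_decomposition_image[OF grC, of m P' "\<lambda>i. pull (P' i)"] P' by blast
    then show "\<exists>m P. prime_decomposition (gr A) m P" by blast
  next
    assume "\<exists>m P. prime_decomposition (gr A) m P"
    then obtain m P where P: "prime_decomposition (gr A) m P" by blast
    have "P i \<subseteq> C" if "i \<in> {1..m}" for i using prime_decomposition_C[OF P that] .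
    then have "graded_prime_decomposition E (\<theta> ` gr A) m (\<lambda>i. \<theta> ` P i)"
      using prime_decomposition_image[OF grC, of m "\<lambda>i. \<theta> ` P i" P] P by blast
    then show ?C2 unfolding grI by blast
  qed
  have strong: "irreducible_ideal L B" if "strongly_irreducible_ideal L B" for B
    using that unfolding strongly_irreducible_ideal_def irreducible_ideal_def by blast
  have C1s1: "?C1s \<Longrightarrow> ?C1" using strong by blast
  have C12: ?C2 if ?C1
  proof -
    obtain \<A> where \<A>: "finite \<A>" "\<A> \<noteq> {}" "\<forall>B\<in>\<A>. irreducible_ideal L B" "I = \<Inter>\<A>" using \<open>?C1\<close> by blast
    have B: "idl C (pull B) \<and> B = \<theta> ` pull B \<and> irred_idl (pull B)" if "B \<in> \<A>" for B
    proof -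
      have "two_sided_ideal L B" using \<A>(3) that unfolding irreducible_ideal_def by blast
      then obtain D where D: "B = \<theta> ` D" "idl C D" "D = pull B" by (rule ideal_obtain)
      then show ?thesis using irreducible_image[OF D(2)] \<A>(3) that by auto
    qed
    have mem: "x \<in> A \<longleftrightarrow> (\<forall>B\<in>\<A>. x \<in> pull B)" if "x \<in> C" for x
      using image_mem[OF AC that] \<A>(4) IA that unfolding pull_def by auto
    have "\<exists>m P. prime_decomposition (gr A) m P"
    proof (rule decomposition_of_irreducibles[OF A AneqC, of "pull ` \<A>"])
      show "finite (pull ` \<A>)" using \<A> by simp
      show "irred_idl D \<and> A \<subseteq> D" if "D \<in> pull ` \<A>" for D
        using that B mem AC by blast
      show "x \<in> A" if x: "x \<in> C" "\<And>D. D \<in> pull ` \<A> \<Longrightarrow> x \<in> gr D" for x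
      proof -
        have "x \<in> pull B" if "B \<in> \<A>" for B using x(2)[of "pull B"] that gr_subset B by blast
        then show ?thesis using mem[OF x(1)] by blast
      qed
    qed
    then show ?thesis using dec by blast
  qed
  have C2_1s4: "?C1s \<and> ?C4" if ?C2
  proof -
    obtain m P where "prime_decomposition (gr A) m P" using dec \<open>?C2\<close> by blast
    then obtain J Js where J: "\<forall>B\<in>set (J # Js). sirred_idl B" "A = \<Inter>(set (J # Js))" "A = foldl iprod J Js"
      using sirred_list[OF A] by blast
    have idl: "idl C B" if "B \<in> set (J # Js)" for B using J(1) that unfolding sirred_idl_def by blast
    have sirr: "strongly_irreducible_ideal L (\<theta> ` B)" if "B \<in> set (J # Js)" for B
      using strongly_irreducible_image[OF idl[OF that]] J(1) that by blast
    have "I = (\<Inter>B\<in>set (J # Js). \<theta> ` B)"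
      unfolding IA using image_INT_C[of "set (J # Js)" "\<lambda>B. B"] idl_sub[OF idl] J(2) by simp
    then have ?C1s using sirr by (intro exI[of _ "(`) \<theta> ` set (J # Js)"]) auto
    moreover have "I = foldl (ideal_prod L) (\<theta> ` J) (map ((`) \<theta>) Js)"
      unfolding IA using foldl_ideal_prod_image[of J Js] idl J(3) by simp
    then have ?C4 using sirr by (intro exI[of _ "\<theta> ` J"] exI[of _ "map ((`) \<theta>) Js"]) auto
    ultimately show ?thesis by blast
  qed
  have C42: ?C2 if ?C4
  proof -
    obtain J Js where J: "\<forall>B\<in>set (J # Js). strongly_irreducible_ideal L B" "I = foldl (ideal_prod L) J Js"
      using \<open>?C4\<close> by blast
    have B: "idl C (pull B) \<and> B = \<theta> ` pull B \<and> irred_idl (pull B)" if "B \<in> set (J # Js)" for B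
    proof -
      have sB: "strongly_irreducible_ideal L B" using J(1) that by blast
      then have "two_sided_ideal L B" unfolding strongly_irreducible_ideal_def by blast
      then obtain D where D: "B = \<theta> ` D" "idl C D" "D = pull B" by (rule ideal_obtain)
      have "sirred_idl D" using strongly_irreducible_image[OF D(2)] sB unfolding D(1)[symmetric] by blast
      then show ?thesis unfolding D(3)[symmetric] using D(1,2) sirred_irred by blast
    qed
    have "\<theta> ` pull B = B" if "B \<in> set Js" for B using B[of B] that by simp
    then have Js: "map ((`) \<theta>) (map pull Js) = Js" by (simp add: map_idI)
    have iJ: "idl C (pull J)" "\<theta> ` pull J = J" using B[of J] by simp_all
    have iJs: "idl C B" if "B \<in> set (map pull Js)" for B using B that by fastforce
    have "\<theta> ` A = \<theta> ` foldl iprod (pull J) (map pull Js)"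
      using foldl_ideal_prod_image[OF iJ(1), of "map pull Js", OF iJs] J(2) IA Js iJ(2) by simp
    moreover have "foldl iprod (pull J) (map pull Js) \<subseteq> C"
      using idl_sub[OF idl_foldl_iprod[OF iJ(1), of "map pull Js", OF iJs]] by simp
    ultimately have "A = foldl iprod (pull J) (map pull Js)" using image_eq[OF AC] by blast
    then have "\<exists>m P. prime_decomposition (gr A) m P"
      using B by (intro decomposition_of_product[OF A AneqC, of "pull J" "map pull Js"]) auto
    then show ?thesis using dec by blast
  qed
  have C23: ?C3 if ?C2
  proof -
    obtain m P0 where P0: "prime_decomposition (gr A) m P0" using dec \<open>?C2\<close> by blast
    obtain P k c f where P: "prime_decomposition (gr A) m P" "k \<le> m"
      "\<forall>t\<in>{1..k}. exitless (gr A) (c t) \<and> V (base (c t)) \<notin> P t \<and> coeff (f t) 0 \<noteq> 0"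
      "A = isum (gr A) (fam_sum {1..k} (\<lambda>t. gen C {pc (c t) (f t)}))"
      using generated_by_polys[OF A P0] by blast
    have PC: "P i \<subseteq> C" if "i \<in> {1..m}" for i using prime_decomposition_C[OF P(1) that] .
    then have "graded_prime_decomposition E (\<theta> ` gr A) m (\<lambda>i. \<theta> ` P i)"
      using prime_decomposition_image[OF grC, of m "\<lambda>i. \<theta> ` P i" P] P(1) by blast
    moreover have "cycle_without_exits (quotient_graph E H S) (map Inl (c t)) \<and>
        lpa_gen E (Vert (cycle_base E (c t))) \<notin> \<theta> ` P t \<and> poly.coeff (f t) 0 \<noteq> 0" if t: "t \<in> {1..k}" for t
    proof -
      have c: "exitless (gr A) (c t)" "V (base (c t)) \<notin> P t" using P(3) t by blast+
      have b: "base (c t) \<in> verts E" "cycle_base E (c t) = base (c t)"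
        using closed_pathD(2)[OF exitless_closed_path[OF c(1)]] unfolding cycle_base_def base_def by auto
      have "t \<in> {1..m}" using t P(2) by simp
      then have "\<theta> (V (base (c t))) \<notin> \<theta> ` P t" using image_mem[OF PC V_C[OF b(1)]] c(2) by blast
      then show ?thesis
        using exitless_cycle_without_exits[OF A c(1)] HS \<theta>_V[OF b(1)] b(2) P(3) t by auto
    qed
    moreover have "I = pair_ideal E H S <+>\<^bsub>L\<^esub> ideal_sum L {1..k} (\<lambda>t. ideal_gen L {poly_at_cycle E (f t) (c t)})"
    proof -
      let ?G = "\<lambda>t. gen C {pc (c t) (f t)}"
      have cp: "closed_path (c t)" if "t \<in> {1..k}" for t using P(3) that exitless_closed_path by blast
      have sub: "{pc (c t) (f t)} \<subseteq> C" if "t \<in> {1..k}" for t using pc_C[OF cp[OF that]] by simp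
      have "ideal_gen L {poly_at_cycle E (f t) (c t)} = \<theta> ` ?G t" if "t \<in> {1..k}" for t
        using ideal_gen_image[OF sub[OF that]] poly_at_cycle_image[OF cp[OF that]] by simp
      then have "ideal_sum L {1..k} (\<lambda>t. ideal_gen L {poly_at_cycle E (f t) (c t)}) = ideal_sum L {1..k} (\<lambda>t. \<theta> ` ?G t)"
        unfolding ideal_sum_def by simp
      also have "\<dots> = \<theta> ` fam_sum {1..k} ?G"
        using idl_gen[OF sub] by (intro ideal_sum_image) auto
      finally have "ideal_sum L {1..k} (\<lambda>t. ideal_gen L {poly_at_cycle E (f t) (c t)}) = \<theta> ` fam_sum {1..k} ?G" .
      moreover have "fam_sum {1..k} ?G \<subseteq> C" using idl_sub[OF idl_fam_sum[of "{1..k}" ?G]] idl_gen[OF sub] by blast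
      ultimately show ?thesis using set_add_image[OF grC] P(4) IA pair by simp
    qed
    ultimately show ?thesis
      using P(2) unfolding grI pair
      by - (rule exI[of _ m], rule exI[of _ "\<lambda>i. \<theta> ` P i"], rule exI[of _ k], rule exI[of _ f],
          rule exI[of _ c], intro conjI ballI refl; blast)
  qed
  have C32: "?C3 \<Longrightarrow> ?C2" by blast
  show ?thesis
    unfolding Let_def
  proof (intro conjI iffI)
    show ?C2 if ?C1 by (rule C12[OF that])
    show ?C1 if ?C2 by (rule C1s1[OF conjunct1[OF C2_1s4[OF that]]])
    show ?C2 if ?C1s by (rule C12[OF C1s1[OF that]])
    show ?C1s if ?C2 by (rule conjunct1[OF C2_1s4[OF that]])
    show ?C2 if ?C3 by (rule C32[OF that])
    show ?C3 if ?C2 by (rule C23[OF that])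
    show ?C2 if ?C4 by (rule C42[OF that])
    show ?C4 if ?C2 by (rule conjunct2[OF C2_1s4[OF that]])
  qed
qed

end

section \<open>All Leavitt path algebras inside one type-class ring\<close>

lemma poly_mapping_sum_single:
  fixes p :: "'a \<Rightarrow>\<^sub>0 'b::comm_monoid_add"
  shows "p = (\<Sum>w\<in>Poly_Mapping.keys p. Poly_Mapping.single w (Poly_Mapping.lookup p w))"
proof (rule poly_mapping_eqI)
  fix k
  show "Poly_Mapping.lookup p k
      = Poly_Mapping.lookup (\<Sum>w\<in>Poly_Mapping.keys p. Poly_Mapping.single w (Poly_Mapping.lookup p w)) k"
    by (simp add: lookup_sum lookup_single when_def in_keys_iff)
qed

lemma poly_mapping_induct_single [case_names zero add]:
  fixes p :: "'a \<Rightarrow>\<^sub>0 'b::comm_monoid_add"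
  assumes "P 0" "\<And>w c q. w \<in> Poly_Mapping.keys p \<Longrightarrow> P q \<Longrightarrow> P (Poly_Mapping.single w c + q)"
  shows "P p"
proof -
  have "P (\<Sum>w\<in>W. Poly_Mapping.single w (Poly_Mapping.lookup p w))"
    if "finite W" "W \<subseteq> Poly_Mapping.keys p" for W
    using that by (induction W) (use assms in auto)
  then show ?thesis using poly_mapping_sum_single[of p] by (metis finite_keys order_refl)
qed

section \<open>Grading and scalars on the free algebra\<close>

definition word_deg :: "('v, 'e) gen fmon \<Rightarrow> int" where
  "word_deg w = sum_list (map gen_deg (letters w))"

lemma word_deg_add: "word_deg (u + w) = word_deg u + word_deg w"
  unfolding word_deg_def plus_fmon_def by simp

definition free_comp :: "int \<Rightarrow> ('v, 'e, 'k::field) free_elem \<Rightarrow> ('v, 'e, 'k) free_elem" where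
  "free_comp n p = Poly_Mapping.mapp (\<lambda>w c. c when word_deg w = n) p"

lemma lookup_free_comp: "Poly_Mapping.lookup (free_comp n p) w = (if word_deg w = n then Poly_Mapping.lookup p w else 0)"
  unfolding free_comp_def by (simp add: lookup_mapp when_def in_keys_iff)

lemma free_comp_add: "free_comp n (p + q) = free_comp n p + free_comp n q"
  by (rule poly_mapping_eqI) (simp add: lookup_free_comp lookup_add)

lemma free_comp_zero: "free_comp n 0 = 0"
  by (rule poly_mapping_eqI) (simp add: lookup_free_comp)

lemma free_comp_uminus: "free_comp n (- p) = - free_comp n p"
  by (rule poly_mapping_eqI) (simp add: lookup_free_comp)

lemma free_comp_diff: "free_comp n (p - q) = free_comp n p - free_comp n q"
  by (rule poly_mapping_eqI) (simp add: lookup_free_comp lookup_minus)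

lemma free_comp_single:
  "free_comp n (Poly_Mapping.single w c) = (if word_deg w = n then Poly_Mapping.single w c else 0)"
  by (rule poly_mapping_eqI) (simp add: lookup_free_comp lookup_single when_def)

lemma free_comp_gen:
  "free_comp 0 (gen_elem (Vert v)) = gen_elem (Vert v)" "free_comp 1 (gen_elem (Edge e)) = gen_elem (Edge e)"
  "free_comp (-1) (gen_elem (Ghost e)) = gen_elem (Ghost e)"
  unfolding gen_elem_def by (simp_all add: free_comp_single word_deg_def)

lemma free_comp_comp: "free_comp n (free_comp d p) = (if n = d then free_comp d p else 0)"
  by (rule poly_mapping_eqI) (simp add: lookup_free_comp)

lemma free_comp_sum: "free_comp n (sum f F) = (\<Sum>i\<in>F. free_comp n (f i))"
  by (induction F rule: infinite_finite_induct) (auto simp: free_comp_add free_comp_zero)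

lemma free_comp_single_mult:
  "free_comp n (Poly_Mapping.single w c * q) = Poly_Mapping.single w c * free_comp (n - word_deg w) q"
proof (induction q rule: poly_mapping_induct_single)
  case (add u d q)
  then show ?case
    by (auto simp: distrib_left free_comp_add mult_single free_comp_single word_deg_add)
qed (simp add: free_comp_zero)

lemma free_comp_mult_single:
  "free_comp n (q * Poly_Mapping.single w c) = free_comp (n - word_deg w) q * Poly_Mapping.single w c"
proof (induction q rule: poly_mapping_induct_single)
  case (add u d q)
  then show ?case
    by (auto simp: distrib_right free_comp_add mult_single free_comp_single word_deg_add)
qed (simp add: free_comp_zero)

lemma free_comp_mult_left: "free_comp n (free_comp d p * q) = free_comp d p * free_comp (n - d) q"
proof (induction p rule: poly_mapping_induct_single)
  case (add u c p)
  then show ?case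
    by (auto simp: distrib_right free_comp_add free_comp_single free_comp_single_mult free_comp_zero)
qed (simp add: free_comp_zero)

lemma free_comp_mult_right: "free_comp n (q * free_comp d p) = free_comp (n - d) q * free_comp d p"
proof (induction p rule: poly_mapping_induct_single)
  case (add u c p)
  then show ?case
    by (auto simp: distrib_left free_comp_add free_comp_single free_comp_mult_single free_comp_zero)
qed (simp add: free_comp_zero)

text \<open>The empty word is excluded from the non-unital free algebra but available in the type,
  so scalars act as multiplication by elements at the empty word, which are central.\<close>

lemma scale_conv: "scale k p = Poly_Mapping.single 0 k * p"
  unfolding scale_def by (rule mult_map_scale_conv_mult)

lemma mult_single_zero_commute:
  fixes p :: "('v, 'e, 'k::field) free_elem"
  shows "p * Poly_Mapping.single 0 k = Poly_Mapping.single 0 k * p"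
proof (induction p rule: poly_mapping_induct_single)
  case (add w c q)
  then show ?case by (simp add: distrib_left distrib_right mult_single mult.commute)
qed simp

lemma scale_laws:
  "scale k (p + q) = scale k p + scale k q" "scale (k + l) p = scale k p + scale l p"
  "scale k (scale l p) = scale (k * l) p" "scale 1 p = p" "scale k p * q = scale k (p * q)"
  "p * scale k q = scale k (p * q)" "scale k (- p) = - scale k p" "scale k 0 = 0"
proof -
  show "scale k (p + q) = scale k p + scale k q" "scale k 0 = 0" "scale k (- p) = - scale k p"
    unfolding scale_conv by (simp_all only: distrib_left mult_zero_right mult_minus_right)
  show "scale (k + l) p = scale k p + scale l p"
    unfolding scale_conv single_add by (rule distrib_right)
  show "scale k (scale l p) = scale (k * l) p"
    unfolding scale_conv mult.assoc[symmetric] mult_single by simp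
  show "scale 1 p = p"
    unfolding scale_conv single_one by simp
  show "scale k p * q = scale k (p * q)"
    unfolding scale_conv by (rule mult.assoc)
  show "p * scale k q = scale k (p * q)"
    unfolding scale_conv mult.assoc[symmetric] mult_single_zero_commute[of p] by (rule refl)
qed

lemma scale_diff: "scale k (p - q) = scale k p - scale k q"
  unfolding scale_conv by (rule right_diff_distrib)

lemma free_comp_scale: "free_comp n (scale k p) = scale k (free_comp n p)"
  unfolding scale_conv free_comp_single_mult by (simp add: word_deg_def zero_fmon_def)

section \<open>The non-unital free algebra and its ideal of relations\<close>

abbreviation free_carrier :: "('v, 'e) pre_digraph \<Rightarrow> ('v, 'e, 'k::field) free_elem set" where
  "free_carrier E \<equiv> carrier (free_alg E)"

definition valid_word :: "('v, 'e) pre_digraph \<Rightarrow> ('v, 'e) gen fmon \<Rightarrow> bool" where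
  "valid_word E w \<longleftrightarrow> letters w \<noteq> [] \<and> set (letters w) \<subseteq> Vert ` verts E \<union> Edge ` arcs E \<union> Ghost ` arcs E"

lemma free_carrier_iff: "p \<in> free_carrier E \<longleftrightarrow> (\<forall>w\<in>Poly_Mapping.keys p. valid_word E w)"
  unfolding free_alg_def valid_word_def by simp

lemma free_alg_simps [simp]:
  "x \<otimes>\<^bsub>free_alg E\<^esub> y = x * y" "\<zero>\<^bsub>free_alg E\<^esub> = 0" "x \<oplus>\<^bsub>free_alg E\<^esub> y = x + y"
  unfolding free_alg_def by simp_all

lemma free_carrier_zero: "0 \<in> free_carrier E"
  by (simp add: free_carrier_iff)

lemma free_carrier_add: "p \<in> free_carrier E \<Longrightarrow> q \<in> free_carrier E \<Longrightarrow> p + q \<in> free_carrier E"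
  unfolding free_carrier_iff using keys_add[of p q] by blast

lemma free_carrier_uminus: "p \<in> free_carrier E \<Longrightarrow> - p \<in> free_carrier E"
  unfolding free_carrier_iff by (simp add: in_keys_iff)

lemma free_carrier_diff: "p \<in> free_carrier E \<Longrightarrow> q \<in> free_carrier E \<Longrightarrow> p - q \<in> free_carrier E"
  using free_carrier_add[OF _ free_carrier_uminus, of p E q] by simp

lemma free_carrier_mult: "p \<in> free_carrier E \<Longrightarrow> q \<in> free_carrier E \<Longrightarrow> p * q \<in> free_carrier E"
proof -
  have "valid_word E (u + w)" if "valid_word E u" "valid_word E w" for u w
    using that unfolding valid_word_def plus_fmon_def by simp
  then show "p \<in> free_carrier E \<Longrightarrow> q \<in> free_carrier E \<Longrightarrow> p * q \<in> free_carrier E"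
    unfolding free_carrier_iff using keys_mult[of p q] by blast
qed

lemma free_carrier_sum: "(\<And>i. i \<in> F \<Longrightarrow> f i \<in> free_carrier E) \<Longrightarrow> sum f F \<in> free_carrier E"
  by (induction F rule: infinite_finite_induct) (auto intro: free_carrier_zero free_carrier_add)

lemma free_carrier_scale: "p \<in> free_carrier E \<Longrightarrow> scale k p \<in> free_carrier E"
  unfolding free_carrier_iff scale_def by (auto simp: in_keys_iff map.rep_eq when_def)

lemma free_carrier_comp: "p \<in> free_carrier E \<Longrightarrow> free_comp n p \<in> free_carrier E"
  unfolding free_carrier_iff by (auto simp: in_keys_iff lookup_free_comp split: if_splits)

lemma free_carrier_single: "valid_word E w \<Longrightarrow> Poly_Mapping.single w c \<in> free_carrier E"
  unfolding free_carrier_iff by (cases "c = 0") auto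

lemma free_carrier_gen:
  "v \<in> verts E \<Longrightarrow> gen_elem (Vert v) \<in> free_carrier E" "e \<in> arcs E \<Longrightarrow> gen_elem (Edge e) \<in> free_carrier E"
  "e \<in> arcs E \<Longrightarrow> gen_elem (Ghost e) \<in> free_carrier E"
  unfolding gen_elem_def by (intro free_carrier_single; simp add: valid_word_def)+

lemma abelian_group_free_alg: "abelian_group (free_alg E :: ('v, 'e, 'k::field) free_elem ring)"
proof (rule abelian_groupI)
  fix x :: "('v, 'e, 'k) free_elem" assume "x \<in> free_carrier E"
  then show "\<exists>y\<in>free_carrier E. y \<oplus>\<^bsub>free_alg E\<^esub> x = \<zero>\<^bsub>free_alg E\<^esub>"
    by (intro bexI[of _ "- x"]) (auto intro: free_carrier_uminus)
qed (auto intro: free_carrier_add free_carrier_zero simp: algebra_simps)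

lemma free_alg_neg: "p \<in> free_carrier E \<Longrightarrow> \<ominus>\<^bsub>free_alg E\<^esub> p = - p"
  by (rule abelian_group.minus_equality[OF abelian_group_free_alg]) (simp_all add: free_carrier_uminus)

definition free_ideal :: "('v, 'e) pre_digraph \<Rightarrow> ('v, 'e, 'k::field) free_elem set \<Rightarrow> bool" where
  "free_ideal E J \<longleftrightarrow> J \<subseteq> free_carrier E \<and> 0 \<in> J \<and> (\<forall>x\<in>J. \<forall>y\<in>J. x + y \<in> J) \<and> (\<forall>x\<in>J. - x \<in> J) \<and>
     (\<forall>x\<in>J. \<forall>y\<in>free_carrier E. y * x \<in> J \<and> x * y \<in> J)"

lemma free_idealI:
  assumes "J \<subseteq> free_carrier E" "0 \<in> J" "\<And>x y. x \<in> J \<Longrightarrow> y \<in> J \<Longrightarrow> x + y \<in> J" "\<And>x. x \<in> J \<Longrightarrow> - x \<in> J"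
    "\<And>x y. x \<in> J \<Longrightarrow> y \<in> free_carrier E \<Longrightarrow> y * x \<in> J" "\<And>x y. x \<in> J \<Longrightarrow> y \<in> free_carrier E \<Longrightarrow> x * y \<in> J"
  shows "free_ideal E J"
  unfolding free_ideal_def using assms by (simp add: subset_iff)

lemma free_idealD:
  assumes "free_ideal E J"
  shows "0 \<in> J" "x \<in> J \<Longrightarrow> y \<in> J \<Longrightarrow> x + y \<in> J" "x \<in> J \<Longrightarrow> - x \<in> J"
    "x \<in> J \<Longrightarrow> z \<in> free_carrier E \<Longrightarrow> z * x \<in> J" "x \<in> J \<Longrightarrow> z \<in> free_carrier E \<Longrightarrow> x * z \<in> J"
    "x \<in> J \<Longrightarrow> x \<in> free_carrier E"
  using assms unfolding free_ideal_def by (simp_all add: subset_iff)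

lemma free_ideal_iff: "free_ideal E J \<longleftrightarrow> two_sided_ideal (free_alg E) J"
proof -
  have "(\<forall>x\<in>J. \<ominus>\<^bsub>free_alg E\<^esub> x \<in> J) \<longleftrightarrow> (\<forall>x\<in>J. - x \<in> J)" if "J \<subseteq> free_carrier E"
    using that by (intro ball_cong refl) (auto simp: free_alg_neg)
  then show ?thesis unfolding two_sided_ideal_iff free_ideal_def free_alg_simps by blast
qed

lemma free_ideal_Inter:
  assumes "\<J> \<noteq> {}" and J: "\<And>J. J \<in> \<J> \<Longrightarrow> free_ideal E J"
  shows "free_ideal E (\<Inter>\<J>)"
proof (rule free_idealI)
  show "\<Inter>\<J> \<subseteq> free_carrier E" using assms free_idealD(6) by blast
  show "0 \<in> \<Inter>\<J>" using free_idealD(1)[OF J] by (rule InterI)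
  show "- x \<in> \<Inter>\<J>" if "x \<in> \<Inter>\<J>" for x using that free_idealD(3)[OF J] by simp
  show "x + y \<in> \<Inter>\<J>" if "x \<in> \<Inter>\<J>" "y \<in> \<Inter>\<J>" for x y using that free_idealD(2)[OF J] by simp
  show "y * x \<in> \<Inter>\<J>" "x * y \<in> \<Inter>\<J>" if "x \<in> \<Inter>\<J>" "y \<in> free_carrier E" for x y
    using that by (simp_all add: free_idealD(4,5)[OF J])
qed

lemma free_ideal_carrier: "free_ideal E (free_carrier E)"
  unfolding free_ideal_def
  using free_carrier_zero free_carrier_add free_carrier_uminus free_carrier_mult by blast

text \<open>The degrees that occur are 0, 1 and -1; homogeneity lets the grading descend to the
  quotient.\<close>

lemma rels_homogeneous:
  assumes "r \<in> lpa_rels E"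
  shows "\<exists>d. free_comp d r = r"
  using assms
  by cases
    (auto simp: gen_elem_def mult_single plus_fmon_def free_comp_diff free_comp_single word_deg_def
      free_comp_sum free_comp_zero intro!: exI[of _ 0] exI[of _ "1::int"] exI[of _ "-1::int"])

lemma rels_carrier:
  assumes "wf_digraph E" "r \<in> lpa_rels E"
  shows "r \<in> free_carrier E"
  using assms(2)
proof cases
  case (CK2 v)
  then have "v \<in> verts E" "\<And>e. e \<in> out_arcs E v \<Longrightarrow> e \<in> arcs E" unfolding regular_vertex_def by auto
  then show ?thesis
    unfolding CK2(1) by (intro free_carrier_diff free_carrier_sum free_carrier_mult free_carrier_gen) auto
qed (auto intro!: free_carrier_diff free_carrier_mult free_carrier_gen
    wf_digraph.tail_in_verts[OF assms(1)] wf_digraph.head_in_verts[OF assms(1)])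

lemma free_ideal_rel_ideal:
  assumes "wf_digraph E"
  shows "free_ideal E (rel_ideal E)"
proof -
  have "free_ideal E (free_carrier E) \<and> {scale k r |k r. r \<in> lpa_rels E} \<subseteq> free_carrier E"
    using free_ideal_carrier rels_carrier[OF assms] free_carrier_scale by blast
  then show ?thesis
    unfolding rel_ideal_def ideal_gen_def free_ideal_iff[symmetric] by (intro free_ideal_Inter) blast+
qed

lemma rel_ideal_rels: "r \<in> lpa_rels E \<Longrightarrow> scale k r \<in> rel_ideal E"
  unfolding rel_ideal_def ideal_gen_def by blast

lemma rel_ideal_least: "free_ideal E J \<Longrightarrow> (\<And>k r. r \<in> lpa_rels E \<Longrightarrow> scale k r \<in> J) \<Longrightarrow> rel_ideal E \<subseteq> J"
  unfolding rel_ideal_def ideal_gen_def free_ideal_iff by blast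

lemma rel_ideal_scale:
  fixes x :: "('v, 'e, 'k::field) free_elem"
  assumes wf: "wf_digraph E" and x: "x \<in> rel_ideal E"
  shows "scale k x \<in> rel_ideal E"
proof -
  have R: "free_ideal E (rel_ideal E :: ('v, 'e, 'k) free_elem set)" by (rule free_ideal_rel_ideal[OF wf])
  \<comment> \<open>The elements all of whose multiples lie in \<open>rel_ideal E\<close> form an
    ideal, which contains the scaled relations and so all of \<open>rel_ideal E\<close>.\<close>
  let ?J = "{x :: ('v, 'e, 'k) free_elem. x \<in> free_carrier E \<and> (\<forall>k. scale k x \<in> rel_ideal E)}"
  have "rel_ideal E \<subseteq> ?J"
  proof (rule rel_ideal_least)
    show "free_ideal E ?J"
    proof (rule free_idealI)
      show "0 \<in> ?J" using free_idealD(1)[OF R] free_carrier_zero by (simp add: scale_laws(8))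
    next
      fix x y assume "x \<in> ?J" "y \<in> ?J"
      then show "x + y \<in> ?J" using free_idealD(2)[OF R] by (simp add: scale_laws(1) free_carrier_add)
    next
      fix x assume "x \<in> ?J"
      then show "- x \<in> ?J" using free_idealD(3)[OF R] by (simp add: scale_laws(7) free_carrier_uminus)
    next
      fix x y :: "('v, 'e, 'k) free_elem" assume "x \<in> ?J" "y \<in> free_carrier E"
      then show "y * x \<in> ?J"
        using free_idealD(4)[OF R] by (simp add: free_carrier_mult scale_laws(6)[symmetric])
      show "x * y \<in> ?J" if "x \<in> ?J" "y \<in> free_carrier E" for x y :: "('v, 'e, 'k) free_elem"
        using that free_idealD(5)[OF R] by (simp add: free_carrier_mult scale_laws(5)[symmetric])
    qed blast
    fix l and r :: "('v, 'e, 'k) free_elem" assume r: "r \<in> lpa_rels E"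
    then show "scale l r \<in> ?J"
      using rels_carrier[OF wf r] by (simp add: scale_laws(3) rel_ideal_rels free_carrier_scale)
  qed
  then show ?thesis using x by blast
qed

lemma rel_ideal_comp:
  fixes x :: "('v, 'e, 'k::field) free_elem"
  assumes wf: "wf_digraph E" and x: "x \<in> rel_ideal E"
  shows "free_comp n x \<in> rel_ideal E"
proof -
  have R: "free_ideal E (rel_ideal E :: ('v, 'e, 'k) free_elem set)" by (rule free_ideal_rel_ideal[OF wf])
  let ?J = "{x :: ('v, 'e, 'k) free_elem. x \<in> free_carrier E \<and> (\<forall>n. free_comp n x \<in> rel_ideal E)}"
  \<comment> \<open>Multiplication by a single word shifts the degree, so components of products
    reduce to components of x in other degrees.\<close>
  have mult: "free_comp m (y * x) \<in> rel_ideal E \<and> free_comp m (x * y) \<in> rel_ideal E"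
    if x: "x \<in> ?J" and y: "y \<in> free_carrier E" for x y m
  proof (induction y rule: poly_mapping_induct_single)
    case zero
    show ?case using free_idealD(1)[OF R] by (simp add: free_comp_zero)
  next
    case (add w c q)
    have s: "Poly_Mapping.single w c \<in> free_carrier E"
      using add y free_carrier_iff free_carrier_single by blast
    have "free_comp (m - word_deg w) x \<in> rel_ideal E" using x by blast
    then show ?case
      unfolding distrib_left distrib_right free_comp_add free_comp_single_mult free_comp_mult_single
      using add(2) by (intro conjI free_idealD(2,4,5)[OF R] s) simp_all
  qed
  have "rel_ideal E \<subseteq> ?J"
  proof (rule rel_ideal_least)
    show "free_ideal E ?J"
    proof (rule free_idealI)
      show "0 \<in> ?J" using free_idealD(1)[OF R] free_carrier_zero by (simp add: free_comp_zero)
    next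
      fix x y assume "x \<in> ?J" "y \<in> ?J"
      then show "x + y \<in> ?J" using free_idealD(2)[OF R] by (simp add: free_comp_add free_carrier_add)
    next
      fix x assume "x \<in> ?J"
      then show "- x \<in> ?J" using free_idealD(3)[OF R] by (simp add: free_comp_uminus free_carrier_uminus)
    next
      fix x y :: "('v, 'e, 'k) free_elem" assume "x \<in> ?J" "y \<in> free_carrier E"
      then show "y * x \<in> ?J" "x * y \<in> ?J" using mult by (simp_all add: free_carrier_mult)
    qed blast
    fix k and r :: "('v, 'e, 'k) free_elem" assume r: "r \<in> lpa_rels E"
    obtain d where "free_comp d r = r" using rels_homogeneous[OF r] by blast
    then have "free_comp m r = (if m = d then r else 0)" for m using free_comp_comp by metis
    then have "free_comp m (scale k r) \<in> rel_ideal E" for m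
      using free_idealD(1)[OF R] rel_ideal_rels[OF r] by (simp add: free_comp_scale scale_laws(8))
    then show "scale k r \<in> ?J" using rels_carrier[OF wf r] free_carrier_scale by blast
  qed
  then show ?thesis using x by blast
qed

text \<open>A type-class ring cannot depend on \<open>E\<close>. So take the product of \<open>L\<^sub>K(E)\<close> over all graphs \<open>E\<close>
  (over the zero ring where the incidence maps leave the vertex set): \<open>L\<^sub>K(E)\<close> is a direct factor, so
  its ideals are the ideals of the product inside that factor.\<close>

definition rel_kernel :: "('v, 'e) pre_digraph \<Rightarrow> ('v, 'e, 'k::field) free_elem set" where
  "rel_kernel E = (if wf_digraph E then rel_ideal E else free_carrier E)"

lemma rel_kernel:
  "free_ideal E (rel_kernel E)" "x \<in> rel_kernel E \<Longrightarrow> scale k x \<in> rel_kernel E"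
  "x \<in> rel_kernel E \<Longrightarrow> free_comp n x \<in> rel_kernel E"
  unfolding rel_kernel_def
  using free_ideal_rel_ideal free_ideal_carrier rel_ideal_scale rel_ideal_comp
    free_carrier_scale free_carrier_comp by auto

lemmas rel_kernelD = free_idealD[OF rel_kernel(1)]

text \<open>The relation is partial: families that leave the free carrier at some graph are
  discarded.\<close>

definition fam_rel :: "(('v, 'e) pre_digraph \<Rightarrow> ('v, 'e, 'k::field) free_elem) \<Rightarrow>
    (('v, 'e) pre_digraph \<Rightarrow> ('v, 'e, 'k) free_elem) \<Rightarrow> bool" where
  "fam_rel f g \<longleftrightarrow> (\<forall>E. f E \<in> free_carrier E \<and> g E \<in> free_carrier E \<and> f E - g E \<in> rel_kernel E)"

lemma fam_rel_refl: "(\<And>E. f E \<in> free_carrier E) \<Longrightarrow> (\<And>E. g E = f E) \<Longrightarrow> fam_rel f g"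
  unfolding fam_rel_def by (simp add: rel_kernelD(1))

quotient_type (overloaded) ('v, 'e, 'k) lpa_family =
  "('v, 'e) pre_digraph \<Rightarrow> ('v, 'e, 'k::field) free_elem" / partial: fam_rel
proof (rule part_equivpI)
  show "\<exists>x::('v, 'e) pre_digraph \<Rightarrow> ('v, 'e, 'k) free_elem. fam_rel x x"
    by (intro exI[of _ "\<lambda>_. 0"] fam_rel_refl) (simp_all add: free_carrier_zero)
  show "symp (fam_rel :: (('v, 'e) pre_digraph \<Rightarrow> ('v, 'e, 'k) free_elem) \<Rightarrow> _)"
  proof (rule sympI)
    fix f g :: "('v, 'e) pre_digraph \<Rightarrow> ('v, 'e, 'k) free_elem"
    assume "fam_rel f g"
    then show "fam_rel g f"
      unfolding fam_rel_def using rel_kernelD(3)[where x = "f E - g E" and E = E for E] by simp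
  qed
  show "transp (fam_rel :: (('v, 'e) pre_digraph \<Rightarrow> ('v, 'e, 'k) free_elem) \<Rightarrow> _)"
  proof (rule transpI)
    fix f g h :: "('v, 'e) pre_digraph \<Rightarrow> ('v, 'e, 'k) free_elem"
    assume "fam_rel f g" "fam_rel g h"
    then show "fam_rel f h"
      unfolding fam_rel_def
      using rel_kernelD(2)[where x = "f E - g E" and y = "g E - h E" and E = E for E] by simp
  qed
qed

instantiation lpa_family :: (type, type, field) ring
begin

lift_definition zero_lpa_family :: "('v, 'e, 'k::field) lpa_family" is "\<lambda>_. 0"
  by (rule fam_rel_refl) (auto simp: free_carrier_zero)

lift_definition plus_lpa_family :: "('v, 'e, 'k::field) lpa_family \<Rightarrow> ('v, 'e, 'k) lpa_family \<Rightarrow> ('v, 'e, 'k) lpa_family"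
  is "\<lambda>f g E. f E + g E"
  unfolding fam_rel_def add_diff_add by (simp add: free_carrier_add rel_kernelD(2))

lift_definition uminus_lpa_family :: "('v, 'e, 'k::field) lpa_family \<Rightarrow> ('v, 'e, 'k) lpa_family"
  is "\<lambda>f E. - f E"
  unfolding fam_rel_def minus_diff_minus by (simp only: free_carrier_uminus rel_kernelD(3) simp_thms)

lift_definition minus_lpa_family :: "('v, 'e, 'k::field) lpa_family \<Rightarrow> ('v, 'e, 'k) lpa_family \<Rightarrow> ('v, 'e, 'k) lpa_family"
  is "\<lambda>f g E. f E - g E"
proof -
  fix f f' g g' :: "('v, 'e) pre_digraph \<Rightarrow> ('v, 'e, 'k) free_elem"
  assume "fam_rel f f'" "fam_rel g g'"
  moreover have "f E - g E - (f' E - g' E) = (f E - f' E) + - (g E - g' E)" for E by simp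
  ultimately show "fam_rel (\<lambda>E. f E - g E) (\<lambda>E. f' E - g' E)"
    unfolding fam_rel_def by (simp only: free_carrier_diff rel_kernelD(2,3) simp_thms)
qed

lift_definition times_lpa_family :: "('v, 'e, 'k::field) lpa_family \<Rightarrow> ('v, 'e, 'k) lpa_family \<Rightarrow> ('v, 'e, 'k) lpa_family"
  is "\<lambda>f g E. f E * g E"
proof -
  fix f f' g g' :: "('v, 'e) pre_digraph \<Rightarrow> ('v, 'e, 'k) free_elem"
  assume a: "fam_rel f f'" "fam_rel g g'"
  have "f E * g E - f' E * g' E = (f E - f' E) * g E + f' E * (g E - g' E)" for E
    by (simp add: algebra_simps)
  then show "fam_rel (\<lambda>E. f E * g E) (\<lambda>E. f' E * g' E)"
    using a unfolding fam_rel_def by (simp add: free_carrier_mult rel_kernelD(2,4,5))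
qed

instance
proof
  fix a b c :: "('a, 'b, 'c) lpa_family"
  show "a * b * c = a * (b * c)"
    by transfer (rule fam_rel_refl; simp add: fam_rel_def free_carrier_mult mult.assoc)
  show "a + b + c = a + (b + c)"
    by transfer (rule fam_rel_refl; simp add: fam_rel_def free_carrier_add add.assoc)
  show "a + b = b + a"
    by transfer (rule fam_rel_refl; simp add: fam_rel_def free_carrier_add add.commute)
  show "0 + a = a"
    by transfer (rule fam_rel_refl; simp add: fam_rel_def)
  show "- a + a = 0"
    by transfer (rule fam_rel_refl; simp add: fam_rel_def free_carrier_zero)
  show "a - b = a + - b"
    by transfer (rule fam_rel_refl; simp add: fam_rel_def free_carrier_diff)
  show "(a + b) * c = a * c + b * c"
    by transfer (rule fam_rel_refl; simp add: fam_rel_def free_carrier_mult free_carrier_add distrib_right)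
  show "a * (b + c) = a * b + a * c"
    by transfer (rule fam_rel_refl; simp add: fam_rel_def free_carrier_mult free_carrier_add distrib_left)
qed

end

lift_definition fam_scale :: "'k::field \<Rightarrow> ('v, 'e, 'k) lpa_family \<Rightarrow> ('v, 'e, 'k) lpa_family"
  is "\<lambda>k f E. scale k (f E)"
  unfolding fam_rel_def scale_diff[symmetric] by (simp add: free_carrier_scale rel_kernel(2))

lift_definition fam_comp :: "int \<Rightarrow> ('v, 'e, 'k::field) lpa_family \<Rightarrow> ('v, 'e, 'k) lpa_family"
  is "\<lambda>n f E. free_comp n (f E)"
  unfolding fam_rel_def free_comp_diff[symmetric] by (simp add: free_carrier_comp rel_kernel(3))

text \<open>The family concentrated at E. Sending elements outside the free carrier to 0 keeps every
  image admissible.\<close>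

lift_definition fam_emb :: "('v, 'e) pre_digraph \<Rightarrow> ('v, 'e, 'k::field) free_elem \<Rightarrow> ('v, 'e, 'k) lpa_family"
  is "\<lambda>E p E'. if E' = E \<and> p \<in> free_carrier E then p else 0"
  by (rule fam_rel_refl) (auto simp: free_carrier_zero)

lemma lpa_class_eq: "lpa_class E p = {r + p |r. r \<in> rel_ideal E}"
  unfolding lpa_class_def a_r_coset_def r_coset_def by auto

lemma lpa_class_iff:
  assumes "wf_digraph E" "p \<in> free_carrier E" "q \<in> free_carrier E"
  shows "lpa_class E p = lpa_class E q \<longleftrightarrow> p - q \<in> rel_ideal E"
proof
  note R = free_idealD[OF free_ideal_rel_ideal[OF assms(1)]]
  { assume "lpa_class E p = lpa_class E q"
    moreover have "0 + p \<in> lpa_class E p" unfolding lpa_class_eq using R by blast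
    ultimately obtain r where "p = r + q" "r \<in> rel_ideal E" unfolding lpa_class_eq by auto
    then show "p - q \<in> rel_ideal E" by simp }
  assume pq: "p - q \<in> rel_ideal E"
  then have qp: "q - p \<in> rel_ideal E" using R by (metis minus_diff_eq)
  have "r + p = (r + (p - q)) + q" "r + q = (r + (q - p)) + p" for r by simp_all
  then show "lpa_class E p = lpa_class E q" unfolding lpa_class_eq using pq qp R by blast
qed

text \<open>For graphs that are not well formed the kernel is the whole free carrier, so a coset of
  \<open>rel_ideal E\<close> need not be well defined; the empty set is a placeholder.\<close>

lift_definition fam_proj :: "('v, 'e) pre_digraph \<Rightarrow> ('v, 'e, 'k::field) lpa_family \<Rightarrow> ('v, 'e, 'k) lpa_elem"
  is "\<lambda>E f. if wf_digraph E then lpa_class E (f E) else {}"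
proof -
  fix E :: "('v, 'e) pre_digraph" and f g :: "('v, 'e) pre_digraph \<Rightarrow> ('v, 'e, 'k) free_elem"
  assume "fam_rel f g"
  then have "f E \<in> free_carrier E" "g E \<in> free_carrier E" "wf_digraph E \<Longrightarrow> f E - g E \<in> rel_ideal E"
    unfolding fam_rel_def rel_kernel_def by (auto split: if_splits dest: spec[of _ E])
  then show "(if wf_digraph E then lpa_class E (f E) else {}) = (if wf_digraph E then lpa_class E (g E) else {})"
    using lpa_class_iff by auto
qed

section \<open>The factor of a single graph inside the product\<close>

context
  fixes E :: "('v, 'e) pre_digraph"
  assumes wf: "wf_digraph E"
begin

lemma fam_proj_emb: "p \<in> free_carrier E \<Longrightarrow> fam_proj E (fam_emb E p) = lpa_class E p"
  using wf by transfer simp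

lemma fam_emb_refl:
  "fam_rel (\<lambda>E'. if E' = E \<and> p \<in> free_carrier E then p else 0) (\<lambda>E'. if E' = E \<and> p \<in> free_carrier E then p else 0)"
  by (rule fam_rel_refl) (simp_all add: free_carrier_zero)

lemma fam_emb_eq:
  assumes "p \<in> free_carrier E" "q \<in> free_carrier E"
  shows "fam_emb E p = fam_emb E q \<longleftrightarrow> p - q \<in> rel_ideal E"
proof -
  have "fam_emb E p = fam_emb E q \<longleftrightarrow> fam_rel (\<lambda>E'. if E' = E \<and> p \<in> free_carrier E then p else 0)
      (\<lambda>E'. if E' = E \<and> q \<in> free_carrier E then q else 0)"
    unfolding fam_emb.abs_eq using Quotient3_rel[OF Quotient3_lpa_family] fam_emb_refl by blast
  also have "\<dots> \<longleftrightarrow> p - q \<in> rel_kernel E"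
    unfolding fam_rel_def using assms by (simp add: rel_kernelD(1) free_carrier_zero)
  finally show ?thesis using wf unfolding rel_kernel_def by simp
qed

lemma fam_emb_add:
  "p \<in> free_carrier E \<Longrightarrow> q \<in> free_carrier E \<Longrightarrow> fam_emb E (p + q) = fam_emb E p + fam_emb E q"
  by transfer (rule fam_rel_refl; simp add: free_carrier_add free_carrier_zero)

lemma fam_emb_uminus: "p \<in> free_carrier E \<Longrightarrow> fam_emb E (- p) = - fam_emb E p"
  by transfer (rule fam_rel_refl; simp add: free_carrier_uminus free_carrier_zero)

lemma fam_emb_zero: "fam_emb E 0 = 0"
  by transfer (rule fam_rel_refl; simp add: free_carrier_zero)

lemma fam_emb_mult:
  "p \<in> free_carrier E \<Longrightarrow> q \<in> free_carrier E \<Longrightarrow> fam_emb E (p * q) = fam_emb E p * fam_emb E q"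
  by transfer (rule fam_rel_refl; simp add: free_carrier_mult free_carrier_zero)

lemma fam_emb_scale: "p \<in> free_carrier E \<Longrightarrow> fam_emb E (scale k p) = fam_scale k (fam_emb E p)"
  by transfer (rule fam_rel_refl; simp add: free_carrier_scale free_carrier_zero scale_laws)

lemma fam_emb_comp: "p \<in> free_carrier E \<Longrightarrow> fam_emb E (free_comp n p) = fam_comp n (fam_emb E p)"
  by transfer (rule fam_rel_refl; simp add: free_carrier_comp free_carrier_zero free_comp_zero)

lemma fam_emb_sum:
  "(\<And>i. i \<in> F \<Longrightarrow> f i \<in> free_carrier E) \<Longrightarrow> fam_emb E (sum f F) = (\<Sum>i\<in>F. fam_emb E (f i))"
  by (induction F rule: infinite_finite_induct) (auto simp: fam_emb_zero fam_emb_add free_carrier_sum)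

text \<open>Multiplying by y only sees its component at E, so the factor at E is an ideal of the
  product ring.\<close>

lemma fam_mult_emb:
  "\<exists>q\<in>free_carrier E. \<forall>p\<in>free_carrier E. y * fam_emb E p = fam_emb E (q * p) \<and> fam_emb E p * y = fam_emb E (p * q)"
proof (induction y rule: lpa_family.abs_induct)
  case (1 y)
  then have y: "y E' \<in> free_carrier E'" for E' unfolding fam_rel_def by blast
  show ?case
    unfolding fam_emb.abs_eq times_lpa_family.abs_eq[OF 1 fam_emb_refl] times_lpa_family.abs_eq[OF fam_emb_refl 1]
    by (intro bexI[of _ "y E"] ballI conjI Quotient3_rel_abs[OF Quotient3_lpa_family] fam_rel_refl)
       (simp_all add: y free_carrier_mult free_carrier_zero)
qed

lemma rel_fam_emb:
  assumes "p - q \<in> lpa_rels E" "p \<in> free_carrier E" "q \<in> free_carrier E"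
  shows "fam_emb E p = fam_emb E q"
proof -
  have "scale 1 (p - q) \<in> rel_ideal E" using assms(1) by (rule rel_ideal_rels)
  then show ?thesis by (simp add: fam_emb_eq[OF assms(2,3)] scale_laws(4))
qed

lemma lpa_simps:
  "carrier (lpa E) = lpa_class E ` free_carrier E" "zero (lpa E) = rel_ideal E"
  "A \<oplus>\<^bsub>lpa E\<^esub> B = A <+>\<^bsub>free_alg E\<^esub> B"
  "A \<otimes>\<^bsub>lpa E\<^esub> B = rcoset_mult (free_alg E) (rel_ideal E) A B"
  "k \<odot>\<^bsub>lpa E\<^esub> A = (\<Union>a\<in>A. lpa_class E (scale k a))"
  unfolding lpa_def Let_def FactRing_def A_RCOSETS_def RCOSETS_def lpa_class_def a_r_coset_def
  by auto

lemma lpa_class_add: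
  assumes "p \<in> free_carrier E" "q \<in> free_carrier E"
  shows "lpa_class E (p + q) = lpa_class E p \<oplus>\<^bsub>lpa E\<^esub> lpa_class E q"
proof -
  note R = free_idealD[OF free_ideal_rel_ideal[OF wf]]
  have "lpa_class E p \<oplus>\<^bsub>lpa E\<^esub> lpa_class E q = {(r + p) + (s + q) |r s. r \<in> rel_ideal E \<and> s \<in> rel_ideal E}"
    unfolding lpa_simps lpa_class_eq set_add_def set_mult_def by auto
  also have "\<dots> = {(r + s) + (p + q) |r s. r \<in> rel_ideal E \<and> s \<in> rel_ideal E}" by (simp add: ac_simps)
  also have "\<dots> = lpa_class E (p + q)"
    unfolding lpa_class_eq
  proof (intro subset_antisym subsetI)
    fix x assume "x \<in> {r + (p + q) |r. r \<in> rel_ideal E}"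
    then obtain r where "x = r + 0 + (p + q)" "r \<in> rel_ideal E" by auto
    then show "x \<in> {r + s + (p + q) |r s. r \<in> rel_ideal E \<and> s \<in> rel_ideal E}" using R(1) by blast
  qed (use R(2) in blast)
  finally show ?thesis ..
qed

lemma lpa_class_mem:
  assumes "p \<in> free_carrier E" "a \<in> lpa_class E p"
  shows "a \<in> free_carrier E" "a - p \<in> rel_ideal E"
  using assms free_ideal_rel_ideal[OF wf] free_carrier_add unfolding lpa_class_eq free_ideal_def by auto

lemma lpa_class_self: "p \<in> lpa_class E p"
  using free_ideal_rel_ideal[OF wf] unfolding lpa_class_eq free_ideal_def by force

lemma lpa_class_mult:
  assumes p: "p \<in> free_carrier E" and q: "q \<in> free_carrier E"
  shows "lpa_class E (p * q) = lpa_class E p \<otimes>\<^bsub>lpa E\<^esub> lpa_class E q"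
proof -
  note R = free_idealD[OF free_ideal_rel_ideal[OF wf]]
  have "lpa_class E (a * b) = lpa_class E (p * q)" if a: "a \<in> lpa_class E p" and b: "b \<in> lpa_class E q" for a b
  proof -
    note am = lpa_class_mem[OF p a] and bm = lpa_class_mem[OF q b]
    have "a * b - p * q = (a - p) * b + p * (b - q)" by (simp add: algebra_simps)
    moreover have "(a - p) * b \<in> rel_ideal E" "p * (b - q) \<in> rel_ideal E" using R(5)[OF am(2) bm(1)] R(4)[OF bm(2) p] .
    ultimately have "a * b - p * q \<in> rel_ideal E" using R(2) by simp
    then show ?thesis using lpa_class_iff[OF wf] free_carrier_mult am bm p q by blast
  qed
  then show ?thesis
    unfolding lpa_simps rcoset_mult_def lpa_class_def[symmetric] free_alg_simps
    using lpa_class_self by blast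
qed

lemma lpa_class_scale:
  assumes p: "p \<in> free_carrier E"
  shows "lpa_class E (scale k p) = k \<odot>\<^bsub>lpa E\<^esub> lpa_class E p"
proof -
  have "lpa_class E (scale k a) = lpa_class E (scale k p)" if a: "a \<in> lpa_class E p" for a
  proof -
    have "scale k a - scale k p \<in> rel_ideal E"
      using rel_ideal_scale[OF wf lpa_class_mem(2)[OF p a]] by (simp add: scale_diff)
    then show ?thesis using lpa_class_iff[OF wf] free_carrier_scale lpa_class_mem(1)[OF p a] p by blast
  qed
  then show ?thesis unfolding lpa_simps using lpa_class_self by blast
qed

lemma free_comp_decomposition: "p = (\<Sum>n\<in>word_deg ` Poly_Mapping.keys p. free_comp n p)"
  by (rule poly_mapping_eqI) (auto simp: lookup_sum lookup_free_comp in_keys_iff)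

lemma emb_words:
  fixes p :: "('v, 'e, 'k::field) free_elem"
  assumes "p \<in> free_carrier E"
  defines "B \<equiv> (\<lambda>v. fam_emb E (gen_elem (Vert v))) ` verts E \<union> (\<lambda>e. fam_emb E (gen_elem (Edge e))) ` arcs E
    \<union> (\<lambda>e. fam_emb E (gen_elem (Ghost e))) ` arcs E"
  shows "fam_emb E p \<in> aspan {fam_scale k w |k w. w \<in> gen_words B}"
proof -
  have words: "fam_emb E (Poly_Mapping.single (Word gs) 1 :: ('v, 'e, 'k) free_elem) \<in> gen_words B"
    if "gs \<noteq> []" "set gs \<subseteq> Vert ` verts E \<union> Edge ` arcs E \<union> Ghost ` arcs E" for gs
    using that
  proof (induction gs rule: rev_nonempty_induct)
    case (single g)
    then show ?case unfolding B_def by (intro gen_words_base) (auto simp: gen_elem_def)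
  next
    case (snoc g gs)
    have g: "fam_emb E (gen_elem g) \<in> B" "(gen_elem g :: ('v, 'e, 'k) free_elem) \<in> free_carrier E"
      using snoc.prems free_carrier_gen unfolding B_def by auto
    have gs: "(Poly_Mapping.single (Word gs) 1 :: ('v, 'e, 'k) free_elem) \<in> free_carrier E"
      using snoc by (intro free_carrier_single) (auto simp: valid_word_def)
    have "Poly_Mapping.single (Word (gs @ [g])) 1 = Poly_Mapping.single (Word gs) 1 * (gen_elem g :: ('v, 'e, 'k) free_elem)"
      unfolding gen_elem_def by (simp add: mult_single plus_fmon_def)
    then have eq: "fam_emb E (Poly_Mapping.single (Word (gs @ [g])) 1 :: ('v, 'e, 'k) free_elem)
        = fam_emb E (Poly_Mapping.single (Word gs) 1) * fam_emb E (gen_elem g)"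
      using fam_emb_mult[OF gs g(2)] by simp
    have "fam_emb E (Poly_Mapping.single (Word gs) 1 :: ('v, 'e, 'k) free_elem) \<in> gen_words B"
      using snoc.IH snoc.prems by simp
    then show ?case unfolding eq using g(1) by (rule gen_words_step)
  qed
  have "p \<in> free_carrier E \<and> fam_emb E p \<in> aspan {fam_scale k w |k w. w \<in> gen_words B}"
  proof (induction p rule: poly_mapping_induct_single)
    case zero
    show ?case by (simp add: fam_emb_zero free_carrier_zero aspan_zero)
  next
    case (add w c q)
    then have w: "valid_word E w" using assms(1) free_carrier_iff by blast
    then have s: "Poly_Mapping.single w c \<in> free_carrier E" "Poly_Mapping.single w 1 \<in> free_carrier E"
      by (simp_all add: free_carrier_single)
    have "Poly_Mapping.single w c = scale c (Poly_Mapping.single w 1)"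
      unfolding scale_conv by (simp add: mult_single)
    then have "fam_emb E (Poly_Mapping.single w c) = fam_scale c (fam_emb E (Poly_Mapping.single w 1))"
      using fam_emb_scale[OF s(2)] by simp
    moreover have "fam_emb E (Poly_Mapping.single w 1) \<in> gen_words B"
      using words[of "letters w"] w unfolding valid_word_def by simp
    ultimately have "fam_emb E (Poly_Mapping.single w c) \<in> {fam_scale k w |k w. w \<in> gen_words B}" by blast
    then show ?case
      using add(2) s(1) by (auto simp: fam_emb_add free_carrier_add intro: aspan_add aspan_base)
  qed
  then show ?thesis by blast
qed

theorem leavitt_lpa_family:
  "leavitt_lpa E (\<lambda>v. fam_emb E (gen_elem (Vert v)) :: ('v, 'e, 'k::field) lpa_family)
     (\<lambda>e. fam_emb E (gen_elem (Edge e))) (\<lambda>e. fam_emb E (gen_elem (Ghost e)))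
     fam_scale fam_comp (fam_emb E ` free_carrier E) (fam_proj E)"
proof -
  interpret wf_digraph E by (rule wf)
  note gens = free_carrier_gen
  note mult = fam_emb_mult[symmetric] and memb = free_carrier_mult free_carrier_zero
  let ?C = "fam_emb E ` free_carrier E :: ('v, 'e, 'k) lpa_family set"
  show ?thesis
  proof unfold_locales
    fix v assume v: "v \<in> verts E"
    show "fam_emb E (gen_elem (Vert v)) * fam_emb E (gen_elem (Vert v)) = (fam_emb E (gen_elem (Vert v)) :: ('v, 'e, 'k) lpa_family)"
      using v by (simp add: mult gens rel_fam_emb[OF lpa_rels.idem] memb)
    show "fam_comp 0 (fam_emb E (gen_elem (Vert v))) = (fam_emb E (gen_elem (Vert v)) :: ('v, 'e, 'k) lpa_family)"
      using v by (simp add: fam_emb_comp[symmetric] gens free_comp_gen)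
    show "fam_emb E (gen_elem (Vert v)) \<in> ?C" using v by (intro imageI gens)
    show "fam_proj E (fam_emb E (gen_elem (Vert v))) = (lpa_gen E (Vert v) :: ('v, 'e, 'k) lpa_elem)"
      using v by (simp add: fam_proj_emb gens lpa_gen_def)
    fix w assume w: "w \<in> verts E" "v \<noteq> w"
    show "fam_emb E (gen_elem (Vert v)) * fam_emb E (gen_elem (Vert w)) = (0 :: ('v, 'e, 'k) lpa_family)"
      using v w rel_fam_emb[of "gen_elem (Vert v) * gen_elem (Vert w)" 0] lpa_rels.orth[OF v w]
      by (simp add: mult gens memb fam_emb_zero)
  next
    fix e assume e: "e \<in> arcs E"
    note te = tail_in_verts[OF e] head_in_verts[OF e]
    show "fam_emb E (gen_elem (Vert (tail E e))) * fam_emb E (gen_elem (Edge e)) = (fam_emb E (gen_elem (Edge e)) :: ('v, 'e, 'k) lpa_family)"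
      using e te by (simp add: mult gens rel_fam_emb[OF lpa_rels.edge_source] memb)
    show "fam_emb E (gen_elem (Edge e)) * fam_emb E (gen_elem (Vert (head E e))) = (fam_emb E (gen_elem (Edge e)) :: ('v, 'e, 'k) lpa_family)"
      using e te by (simp add: mult gens rel_fam_emb[OF lpa_rels.edge_range] memb)
    show "fam_emb E (gen_elem (Vert (head E e))) * fam_emb E (gen_elem (Ghost e)) = (fam_emb E (gen_elem (Ghost e)) :: ('v, 'e, 'k) lpa_family)"
      using e te by (simp add: mult gens rel_fam_emb[OF lpa_rels.ghost_range] memb)
    show "fam_emb E (gen_elem (Ghost e)) * fam_emb E (gen_elem (Vert (tail E e))) = (fam_emb E (gen_elem (Ghost e)) :: ('v, 'e, 'k) lpa_family)"
      using e te by (simp add: mult gens rel_fam_emb[OF lpa_rels.ghost_source] memb)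
    show "fam_emb E (gen_elem (Ghost e)) * fam_emb E (gen_elem (Edge e)) = (fam_emb E (gen_elem (Vert (head E e))) :: ('v, 'e, 'k) lpa_family)"
      using e te by (simp add: mult gens rel_fam_emb[OF lpa_rels.CK1_same] memb)
    show "fam_comp 1 (fam_emb E (gen_elem (Edge e))) = (fam_emb E (gen_elem (Edge e)) :: ('v, 'e, 'k) lpa_family)"
      using e by (simp add: fam_emb_comp[symmetric] gens free_comp_gen)
    show "fam_comp (-1) (fam_emb E (gen_elem (Ghost e))) = (fam_emb E (gen_elem (Ghost e)) :: ('v, 'e, 'k) lpa_family)"
      using e by (simp add: fam_emb_comp[symmetric] gens free_comp_gen)
    show "fam_proj E (fam_emb E (gen_elem (Edge e))) = (lpa_gen E (Edge e) :: ('v, 'e, 'k) lpa_elem)"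
      "fam_proj E (fam_emb E (gen_elem (Ghost e))) = (lpa_gen E (Ghost e) :: ('v, 'e, 'k) lpa_elem)"
      using e by (simp_all add: fam_proj_emb gens lpa_gen_def)
    fix f assume f: "f \<in> arcs E" "e \<noteq> f"
    show "fam_emb E (gen_elem (Ghost e)) * fam_emb E (gen_elem (Edge f)) = (0 :: ('v, 'e, 'k) lpa_family)"
      using e f rel_fam_emb[of "gen_elem (Ghost e) * gen_elem (Edge f)" 0] lpa_rels.CK1_distinct[OF e f]
      by (simp add: mult gens memb fam_emb_zero)
  next
    fix v assume v: "regular_vertex E v"
    let ?s = "\<Sum>e\<in>out_arcs E v. gen_elem (Edge e) * gen_elem (Ghost e) :: ('v, 'e, 'k) free_elem"
    have "fam_emb E (gen_elem (Vert v)) = fam_emb E ?s"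
      using v lpa_rels.CK2[OF v]
      by (intro rel_fam_emb free_carrier_sum) (auto simp: gens memb regular_vertex_def)
    also have "\<dots> = (\<Sum>e\<in>out_arcs E v. fam_emb E (gen_elem (Edge e) * gen_elem (Ghost e)))"
      by (rule fam_emb_sum) (auto simp: gens memb)
    also have "\<dots> = (\<Sum>e\<in>out_arcs E v. fam_emb E (gen_elem (Edge e)) * fam_emb E (gen_elem (Ghost e)))"
      by (rule sum.cong) (auto simp: gens fam_emb_mult)
    finally show "fam_emb E (gen_elem (Vert v))
      = (\<Sum>e\<in>out_arcs E v. fam_emb E (gen_elem (Edge e)) * fam_emb E (gen_elem (Ghost e)) :: ('v, 'e, 'k) lpa_family)" .
  next
    fix k l :: 'k and x y :: "('v, 'e, 'k) lpa_family" and n d :: int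
    show "fam_scale k (x + y) = fam_scale k x + fam_scale k y"
      by transfer (rule fam_rel_refl; simp add: fam_rel_def free_carrier_scale free_carrier_add scale_laws)
    show "fam_scale (k + l) x = fam_scale k x + fam_scale l x"
      by transfer (rule fam_rel_refl; simp add: fam_rel_def free_carrier_scale free_carrier_add scale_laws)
    show "fam_scale k (fam_scale l x) = fam_scale (k * l) x"
      by transfer (rule fam_rel_refl; simp add: fam_rel_def free_carrier_scale free_carrier_add scale_laws)
    show "fam_scale 1 x = x"
      by transfer (rule fam_rel_refl; simp add: fam_rel_def free_carrier_scale free_carrier_add scale_laws)
    show "fam_scale k x * y = fam_scale k (x * y)"
      by transfer (rule fam_rel_refl; simp add: fam_rel_def free_carrier_scale free_carrier_mult scale_laws)
    show "x * fam_scale k y = fam_scale k (x * y)"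
      by transfer (rule fam_rel_refl; simp add: fam_rel_def free_carrier_scale free_carrier_mult scale_laws)
    show "fam_comp n (x + y) = fam_comp n x + fam_comp n y"
      by transfer (rule fam_rel_refl; simp add: fam_rel_def free_carrier_comp free_carrier_add free_comp_add)
    show "fam_comp n (fam_scale k x) = fam_scale k (fam_comp n x)"
      by transfer (rule fam_rel_refl; simp add: fam_rel_def free_carrier_comp free_carrier_scale free_comp_scale)
    show "fam_comp n (fam_comp d x) = (if n = d then fam_comp d x else 0)"
    proof (cases "n = d")
      case True
      have "fam_comp d (fam_comp d x) = fam_comp d x"
        by transfer (rule fam_rel_refl; simp add: fam_rel_def free_carrier_comp free_comp_comp)
      then show ?thesis using True by simp
    next
      case False
      have "fam_comp n (fam_comp d x) = 0"
        using False by transfer (rule fam_rel_refl; simp add: fam_rel_def free_carrier_zero free_comp_comp)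
      then show ?thesis using False by simp
    qed
    \<comment> \<open>Proved first with a component in place of x, as an unconditional equation that
      transfers; a homogeneous x is its own component.\<close>
    have "fam_comp n (fam_comp d x * y) = fam_comp d x * fam_comp (n - d) y"
      by transfer (rule fam_rel_refl; simp add: fam_rel_def free_carrier_comp free_carrier_mult free_comp_mult_left)
    then show "fam_comp d x = x \<Longrightarrow> fam_comp n (x * y) = x * fam_comp (n - d) y" by simp
    have "fam_comp n (x * fam_comp d y) = fam_comp (n - d) x * fam_comp d y"
      by transfer (rule fam_rel_refl; simp add: fam_rel_def free_carrier_comp free_carrier_mult free_comp_mult_right)
    then show "fam_comp d y = y \<Longrightarrow> fam_comp n (x * y) = fam_comp (n - d) x * y" by simp
  next
    show "idl ?C ?C"
      unfolding idl_def
    proof (intro conjI ballI allI order_refl)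
      show "0 \<in> ?C" using fam_emb_zero free_carrier_zero by (metis imageI)
      fix x assume "x \<in> ?C"
      then obtain p where p: "x = fam_emb E p" "p \<in> free_carrier E" by blast
      show "- x \<in> ?C" using p fam_emb_uminus free_carrier_uminus by (metis imageI)
      { fix y
        obtain q where "q \<in> free_carrier E" "y * x = fam_emb E (q * p)" "x * y = fam_emb E (p * q)"
          using fam_mult_emb[of y] p by blast
        then show "y * x \<in> ?C" "x * y \<in> ?C" using p free_carrier_mult by auto }
      fix y assume "y \<in> ?C"
      then obtain q where "y = fam_emb E q" "q \<in> free_carrier E" by blast
      then show "x + y \<in> ?C" using p fam_emb_add free_carrier_add by (metis imageI)
    qed
  next
    show "?C \<subseteq> aspan {fam_scale k w |k w. w \<in> gen_words ((\<lambda>v. fam_emb E (gen_elem (Vert v))) ` verts E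
        \<union> (\<lambda>e. fam_emb E (gen_elem (Edge e))) ` arcs E \<union> (\<lambda>e. fam_emb E (gen_elem (Ghost e))) ` arcs E)}"
      using emb_words by blast
  next
    show "bij_betw (fam_proj E) ?C (carrier (lpa E))"
      unfolding bij_betw_def
    proof
      show "inj_on (fam_proj E) ?C"
        unfolding inj_on_def by (auto simp: fam_proj_emb lpa_class_iff[OF wf] fam_emb_eq)
      show "fam_proj E ` ?C = carrier (lpa E)"
        unfolding lpa_simps image_image by (rule image_cong) (auto simp: fam_proj_emb)
    qed
    show "fam_proj E 0 = (\<zero>\<^bsub>lpa E\<^esub> :: ('v, 'e, 'k) lpa_elem)"
      using fam_proj_emb[OF free_carrier_zero] unfolding fam_emb_zero lpa_simps lpa_class_eq by simp
  next
    fix x y :: "('v, 'e, 'k) lpa_family" assume "x \<in> ?C" "y \<in> ?C"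
    then obtain p q where pq: "x = fam_emb E p" "y = fam_emb E q" "p \<in> free_carrier E" "q \<in> free_carrier E" by blast
    show "fam_proj E (x + y) = fam_proj E x \<oplus>\<^bsub>lpa E\<^esub> fam_proj E y"
      using pq lpa_class_add[OF pq(3,4)] fam_emb_add[OF pq(3,4)] free_carrier_add[OF pq(3,4)]
      by (metis fam_proj_emb)
    show "fam_proj E (x * y) = fam_proj E x \<otimes>\<^bsub>lpa E\<^esub> fam_proj E y"
      using pq lpa_class_mult[OF pq(3,4)] fam_emb_mult[OF pq(3,4)] free_carrier_mult[OF pq(3,4)]
      by (metis fam_proj_emb)
  next
    fix x :: "('v, 'e, 'k) lpa_family" and k :: 'k assume "x \<in> ?C"
    then obtain p where p: "x = fam_emb E p" "p \<in> free_carrier E" by blast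
    show "fam_proj E (fam_scale k x) = k \<odot>\<^bsub>lpa E\<^esub> fam_proj E x"
      using p lpa_class_scale[OF p(2)] fam_emb_scale[OF p(2)] free_carrier_scale[OF p(2)]
      by (metis fam_proj_emb)
    have "x = fam_emb E (\<Sum>n\<in>word_deg ` Poly_Mapping.keys p. free_comp n p)"
      using p(1) free_comp_decomposition[of p] by simp
    also have "\<dots> = (\<Sum>n\<in>word_deg ` Poly_Mapping.keys p. fam_comp n x)"
      using p by (simp add: fam_emb_sum free_carrier_comp fam_emb_comp)
    finally have "x = (\<Sum>n\<in>word_deg ` Poly_Mapping.keys p. fam_comp n x)" .
    then show "\<exists>N. finite N \<and> x = (\<Sum>n\<in>N. fam_comp n x)" by (intro exI[of _ "word_deg ` Poly_Mapping.keys p"]) simp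
  next
    fix n
    show "(lpa_component E n :: ('v, 'e, 'k) lpa_elem set) = fam_proj E ` {x \<in> ?C. fam_comp n x = x}"
    proof (intro subset_antisym subsetI)
      fix a :: "('v, 'e, 'k) lpa_elem" assume "a \<in> lpa_component E n"
      then obtain p where p: "a = lpa_class E p" "p \<in> free_carrier E" "\<forall>w\<in>Poly_Mapping.keys p. word_deg w = n"
        unfolding lpa_component_def word_deg_def by blast
      have "free_comp n p = p"
        by (rule poly_mapping_eqI) (use p(3) in \<open>auto simp: lookup_free_comp in_keys_iff\<close>)
      then have "fam_comp n (fam_emb E p) = fam_emb E p" using fam_emb_comp[OF p(2)] by metis
      then show "a \<in> fam_proj E ` {x \<in> ?C. fam_comp n x = x}" using p fam_proj_emb[OF p(2)] by force
    next
      fix a :: "('v, 'e, 'k) lpa_elem" assume "a \<in> fam_proj E ` {x \<in> ?C. fam_comp n x = x}"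
      then obtain p where p: "p \<in> free_carrier E" "fam_comp n (fam_emb E p) = fam_emb E p" "a = fam_proj E (fam_emb E p)"
        by blast
      then have "a = lpa_class E (free_comp n p)"
        using fam_emb_comp[OF p(1)] fam_proj_emb[OF free_carrier_comp[OF p(1)]] by metis
      moreover have "\<forall>w\<in>Poly_Mapping.keys (free_comp n p). word_deg w = n"
        by (auto simp: in_keys_iff lookup_free_comp split: if_splits)
      ultimately show "a \<in> lpa_component E n"
        unfolding lpa_component_def word_deg_def using free_carrier_comp[OF p(1)] by blast
    qed
  qed
qed

end

theorem theorem3p9:
  fixes E :: "('v, 'e) pre_digraph"
    and I :: "('v, 'e, 'k::field) lpa_elem set"
    and H S :: "'v set"
  assumes "wf_digraph E"
    and "two_sided_ideal (lpa E) I"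
    and "I \<noteq> carrier (lpa E)"
    and "H = gr_verts E I"
    and "S = gr_breaking E I"
  shows
    "let L = lpa E;
         C1 = (\<exists>\<A>. finite \<A> \<and> \<A> \<noteq> {} \<and> (\<forall>A\<in>\<A>. irreducible_ideal L A) \<and> I = \<Inter>\<A>);
         C1s = (\<exists>\<A>. finite \<A> \<and> \<A> \<noteq> {} \<and> (\<forall>A\<in>\<A>. strongly_irreducible_ideal L A) \<and> I = \<Inter>\<A>);
         C2 = (\<exists>m P. graded_prime_decomposition E (gr_part E I) m P);
         C3 = (\<exists>m (P :: nat \<Rightarrow> ('v, 'e, 'k) lpa_elem set) k (f :: nat \<Rightarrow> 'k poly)
                 (c :: nat \<Rightarrow> 'e list).
                 gr_part E I = pair_ideal E H S \<and>
                 graded_prime_decomposition E (gr_part E I) m P \<and>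
                 k \<le> m \<and>
                 (\<forall>t\<in>{1..k}.
                    cycle_without_exits (quotient_graph E H S) (map Inl (c t)) \<and>
                    lpa_gen E (Vert (cycle_base E (c t))) \<notin> P t \<and>
                    poly.coeff (f t) 0 \<noteq> 0) \<and>
                 I = pair_ideal E H S <+>\<^bsub>L\<^esub>
                       ideal_sum L {1..k} (\<lambda>t. ideal_gen L {poly_at_cycle E (f t) (c t)}));
         C4 = (\<exists>J Js. (\<forall>A\<in>set (J # Js). strongly_irreducible_ideal L A) \<and>
                 I = foldl (ideal_prod L) J Js)
     in (C1 \<longleftrightarrow> C2) \<and> (C1s \<longleftrightarrow> C2) \<and> (C3 \<longleftrightarrow> C2) \<and> (C4 \<longleftrightarrow> C2)"
  using leavitt_lpa.finite_decompositions[OF leavitt_lpa_family[OF assms(1)] assms(2-5)]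
  unfolding Let_def .

end
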